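(* Let $I=[a,b]$, $r,s\in\mathbb{N}$ with $s\le r$, $1\le p<\infty$, $\gamma\in(0,1]$, and for each $n\in\mathbb{N}$ let $X_n=(x_{k,n})_{k=0}^n\subset[a,b]$ be a set of points with $x_{0,n}<\dots<x_{n,n}$ and $\min_k(x_{k+1,n}-x_{k,n})\ge\gamma/n$. Then for $f\in L^p(I)$ and $n\in\mathbb{N}$ with $\gamma/n\le(b-a)/r$ $$\mathcal{K}_s(f,X_n)_p\asymp\tilde\Omega_{r,s}\left(f,\tfrac\gamma n,X_n\right)_p,$$ i.e. each side is bounded by a positive constant times the other, with constants independent of $f$ and $n$, where $$\mathcal{K}_s(f,X_n)_p=\inf_{g\in W^s_p(I)}\left(\|f-g\|_{\ell_p(X_n)}+\|f-g\|_p+n^{-s}\|g^{(s)}\|_p\right).$$ Moreover, there exists $C>0$, independent of $f$ and $n$, such that for every bounded $f\in L^p(I)$ and every $n\in\mathbb{N}$ with $\gamma/n\le(b-a)/r$ and $1/n\le(b-a)/s$ $$\tilde\Omega_{r,s}\left(f,\tfrac\gamma n,X_n\right)_p\le C\,\tau_s(f,1/n)_p.$$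
   Context: Conventions: $\mathbb{N}=\{1,2,\dots\}$; $L^p(I)$ consists of pointwise defined functions (functions equal almost everywhere are not identified); $\|\cdot\|_p$ is the $L^p(I)$ norm. $W^s_p(I)$ is the usual Sobolev space, whose elements are taken as functions $g$ with $g,\dots,g^{(s-1)}$ absolutely continuous on $I$ and $g^{(s)}\in L^p(I)$. In $\min_k(x_{k+1,n}-x_{k,n})$ one sets $x_{n+1,n}=(b-a)+x_{1,n}$. Discrete semi-norm: $\|f\|_{\ell_p(X_n)}=\big(\frac{b-a}{n}\sum_{k=0}^n|f(x_{k,n})|^p\big)^{1/p}$. Modulus of smoothness: $\Delta_h^sf(x)=\sum_{k=0}^s\binom sk(-1)^{s-k}f(x+kh)$, $\omega_s(f,\delta)_p=\sup_{0<h\le\delta}\big(\int_a^{b-sh}|\Delta_h^sf(x)|^p\,dx\big)^{1/p}$ (the integral is $0$ if $sh\ge b-a$). Local and averaged moduli, for $f$ bounded and measurable on $[a,b]$ and $0\le\delta\le(b-a)/s$: $\omega_s(f,x;\delta)=\sup\{|\Delta_h^sf(t)|:\ t,\,t+sh\in[x-\frac{s\delta}2,x+\frac{s\delta}2]\cap[a,b]\}$ and $\tau_s(f,\delta)_p=\|\omega_s(f,\cdot;\delta)\|_p$. Steklov averages, for $0<\delta\le(b-a)/r$: $\tilde f_{\delta,r}(x)=(-\delta)^{-r}\int_0^\delta\cdots\int_0^\delta\sum_{m=1}^r(-1)^{r-m+1}\binom r{r-m}f(x+m\theta_x)\,dt_1\cdots dt_r$, with $\theta_x=\frac{t_1+\dots+t_r}{r}-\frac{x-a}{b-a}\delta$.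 Semi-discrete modulus: $\tilde\Omega_{r,s}(f,\frac\gamma n,X_n)_p=\|\tilde f_{\gamma/n,r}-f\|_{\ell_p(X_n)}+\omega_s(f,1/n)_p$. *)

theory Defs
  imports "HOL-Analysis.Analysis"
begin

text \<open>
  Throughout, \<open>I = {a..b}\<close>. Functions are total on \<^typ>\<open>real\<close>, but the spaces, norms and moduli below only
  look at values on \<open>I\<close> (for the Steklov averages when \<open>0 < \<delta> \<le> (b - a) / r\<close> and \<open>x \<in> I\<close>).
\<close>

section \<open>Lebesgue and Sobolev spaces\<close>

definition Lp_space :: "real \<Rightarrow> real set \<Rightarrow> (real \<Rightarrow> real) set" where
  "Lp_space p S =
     {f \<in> borel_measurable (lebesgue_on S). integrable (lebesgue_on S) (\<lambda>x. \<bar>f x\<bar> powr p)}"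

definition Lp_norm :: "real \<Rightarrow> real set \<Rightarrow> (real \<Rightarrow> real) \<Rightarrow> real" where
  "Lp_norm p S f = (LINT x|lebesgue_on S. \<bar>f x\<bar> powr p) powr (1 / p)"

text \<open>
  Absolute continuity in the \<open>\<epsilon>\<close>-\<open>\<delta>\<close> sense: \<open>d\<close> is a finite set of non-overlapping compact
  intervals \<open>k = {Inf k..Sup k}\<close>.
\<close>
definition abs_continuous_on :: "real set \<Rightarrow> (real \<Rightarrow> real) \<Rightarrow> bool" where
  "abs_continuous_on S g \<longleftrightarrow>
     (\<forall>\<epsilon>>0. \<exists>\<delta>>0. \<forall>d. d division_of (\<Union>d) \<and> \<Union>d \<subseteq> S \<and> (\<Sum>k\<in>d. Sup k - Inf k) < \<delta> \<longrightarrow>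
        (\<Sum>k\<in>d. \<bar>g (Sup k) - g (Inf k)\<bar>) < \<epsilon>)"

text \<open>
  The classical derivative of order \<open>j\<close> on \<open>I\<close>, one-sided at the end points. Where the derivative
  does not exist the value is a fixed arbitrary number.
\<close>
definition nth_deriv :: "real \<Rightarrow> real \<Rightarrow> nat \<Rightarrow> (real \<Rightarrow> real) \<Rightarrow> real \<Rightarrow> real" where
  "nth_deriv a b j g = ((\<lambda>u x. vector_derivative u (at x within {a..b})) ^^ j) g"

text \<open>
  The differentiability clauses make explicit that \<open>g', \<dots>, g\<^sup>(\<^sup>s\<^sup>-\<^sup>1\<^sup>)\<close> exist everywhere on \<open>I\<close> and
  \<open>g\<^sup>(\<^sup>s\<^sup>)\<close> exists almost everywhere; the latter is automatic by absolute continuity.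
\<close>
definition Sobolev :: "real \<Rightarrow> real \<Rightarrow> real \<Rightarrow> nat \<Rightarrow> (real \<Rightarrow> real) set" where
  "Sobolev p a b s = {g.
     (\<forall>j<s - 1. \<forall>x\<in>{a..b}. nth_deriv a b j g differentiable (at x within {a..b})) \<and>
     (\<forall>j<s. abs_continuous_on {a..b} (nth_deriv a b j g)) \<and>
     (AE x in lebesgue_on {a..b}. nth_deriv a b (s - 1) g differentiable (at x within {a..b})) \<and>
     nth_deriv a b s g \<in> Lp_space p {a..b}}"

section \<open>Point sets and the discrete semi-norm\<close>

text \<open>
  A point set \<open>x\<^sub>0, \<dots>, x\<^sub>n\<close> is given by a function \<open>x :: nat \<Rightarrow> real\<close> restricted to \<open>{0..n}\<close>;
  the value at \<open>n + 1\<close> is overridden by the convention \<open>x\<^sub>n\<^sub>+\<^sub>1 = (b - a) + x\<^sub>1\<close>.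
\<close>
definition min_gap :: "real \<Rightarrow> real \<Rightarrow> nat \<Rightarrow> (nat \<Rightarrow> real) \<Rightarrow> real" where
  "min_gap a b n x =
     (let y = x(n + 1 := (b - a) + x 1) in Min ((\<lambda>k. y (k + 1) - y k) ` {0..n}))"

definition lp_seminorm ::
  "real \<Rightarrow> real \<Rightarrow> real \<Rightarrow> nat \<Rightarrow> (nat \<Rightarrow> real) \<Rightarrow> (real \<Rightarrow> real) \<Rightarrow> real" where
  "lp_seminorm p a b n x f = ((b - a) / real n * (\<Sum>k=0..n. \<bar>f (x k)\<bar> powr p)) powr (1 / p)"

section \<open>Moduli of smoothness\<close>

definition fwd_diff :: "nat \<Rightarrow> real \<Rightarrow> (real \<Rightarrow> real) \<Rightarrow> real \<Rightarrow> real" where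
  "fwd_diff s h f x = (\<Sum>k=0..s. real (s choose k) * (-1) ^ (s - k) * f (x + real k * h))"

text \<open>The interval \<open>{a..b - s * h}\<close> is empty or a null set, hence the norm is 0, if \<open>s * h \<ge> b - a\<close>.\<close>
definition modulus :: "real \<Rightarrow> real \<Rightarrow> real \<Rightarrow> nat \<Rightarrow> (real \<Rightarrow> real) \<Rightarrow> real \<Rightarrow> real" where
  "modulus p a b s f \<delta> = (SUP h\<in>{0<..\<delta>}. Lp_norm p {a..b - real s * h} (fwd_diff s h f))"

text \<open>The step \<open>h\<close> ranges over all reals such that both \<open>t\<close> and \<open>t + s * h\<close> lie in the window.\<close>
definition local_modulus :: "real \<Rightarrow> real \<Rightarrow> nat \<Rightarrow> (real \<Rightarrow> real) \<Rightarrow> real \<Rightarrow> real \<Rightarrow> real" where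
  "local_modulus a b s f x \<delta> =
     (let W = {x - real s * \<delta> / 2..x + real s * \<delta> / 2} \<inter> {a..b}
      in Sup {\<bar>fwd_diff s h f t\<bar> | t h. t \<in> W \<and> t + real s * h \<in> W})"

definition averaged_modulus ::
  "real \<Rightarrow> real \<Rightarrow> real \<Rightarrow> nat \<Rightarrow> (real \<Rightarrow> real) \<Rightarrow> real \<Rightarrow> real" where
  "averaged_modulus p a b s f \<delta> = Lp_norm p {a..b} (\<lambda>x. local_modulus a b s f x \<delta>)"

section \<open>Steklov averages and the semi-discrete modulus\<close>

text \<open>
  \<open>iter_int \<delta> r F\<close> is \<open>\<integral>\<^sub>0\<^sup>\<delta> \<dots> \<integral>\<^sub>0\<^sup>\<delta> F [t\<^sub>1, \<dots>, t\<^sub>r] dt\<^sub>1 \<dots> dt\<^sub>r\<close>. It is a genuinely iterated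
  integral: for a merely Lebesgue measurable \<open>f\<close>, the function \<open>f (t\<^sub>1 + \<dots> + t\<^sub>r)\<close> need not be
  measurable for the (uncompleted) product measure.
\<close>
primrec iter_int :: "real \<Rightarrow> nat \<Rightarrow> (real list \<Rightarrow> real) \<Rightarrow> real" where
  "iter_int \<delta> 0 F = F []"
| "iter_int \<delta> (Suc r) F = (LINT t|lebesgue_on {0..\<delta>}. iter_int \<delta> r (\<lambda>ts. F (t # ts)))"

definition steklov :: "real \<Rightarrow> real \<Rightarrow> real \<Rightarrow> nat \<Rightarrow> (real \<Rightarrow> real) \<Rightarrow> real \<Rightarrow> real" where
  "steklov a b \<delta> r f x =
     (- \<delta>) powi (- int r) *
     iter_int \<delta> r (\<lambda>ts.
       let \<theta> = sum_list ts / real r - (x - a) / (b - a) * \<delta>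
       in \<Sum>m=1..r. (-1) ^ (r - m + 1) * real (r choose (r - m)) * f (x + real m * \<theta>))"

definition semi_discrete_modulus ::
  "real \<Rightarrow> real \<Rightarrow> real \<Rightarrow> nat \<Rightarrow> nat \<Rightarrow> real \<Rightarrow> nat \<Rightarrow> (nat \<Rightarrow> real) \<Rightarrow> (real \<Rightarrow> real) \<Rightarrow> real" where
  "semi_discrete_modulus p a b r s \<gamma> n x f =
     lp_seminorm p a b n x (\<lambda>y. steklov a b (\<gamma> / real n) r f y - f y) +
     modulus p a b s f (1 / real n)"

section \<open>The K-functional\<close>

definition K_functional ::
  "real \<Rightarrow> real \<Rightarrow> real \<Rightarrow> nat \<Rightarrow> nat \<Rightarrow> (nat \<Rightarrow> real) \<Rightarrow> (real \<Rightarrow> real) \<Rightarrow> real" where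
  "K_functional p a b s n x f =
     (INF g\<in>Sobolev p a b s.
        lp_seminorm p a b n x (\<lambda>y. f y - g y) +
        Lp_norm p {a..b} (\<lambda>y. f y - g y) +
        real n powi (- int s) * Lp_norm p {a..b} (nth_deriv a b s g))"

end

theory Submission
  imports Defs
begin

text \<open>
  Write \<open>\<delta> = \<gamma> / n\<close>. The Steklov average \<open>f~\<close> at \<open>x\<close> is an iterated mean, over steps \<open>\<theta>\<close> with \<open>\<bar>\<theta>\<bar> \<le> \<delta>\<close>, of
  the kernel \<open>f x - (-1)^r * fwd_diff r \<theta> f x\<close>. All but one of the iterated means can be bounded trivially, so for
  every constant \<open>K\<close> the distance \<open>\<bar>f~ x - K\<bar>\<close> is at most a constant times the plain mean of the distance between the
  kernel and \<open>K\<close> (\<open>abs_steklov_diff_le\<close>). Since \<open>\<theta>\<close> is integrated, a value \<open>w (x + \<kappa> * \<theta>)\<close> turns into an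
  integral of \<open>w\<close> over a window of length comparable to \<open>\<delta>\<close> around \<open>x\<close> (\<open>abs_steklov_minus_le_window\<close>). The windows
  around the points of \<open>X n\<close> overlap boundedly often, because the points have distance at least \<open>\<delta>\<close>; with Jensen's
  inequality, discrete norms of functions dominated by such window means are bounded by norms on
  \<open>[a, b]\<close> (\<open>lp_seminorm_window_le\<close>). Two choices of \<open>K\<close> prove the theorem.

  For a Sobolev function \<open>g\<close> let \<open>E\<close> be the sum of the norm of \<open>f - g\<close> and of \<open>n^-s\<close> times the norm of the
  derivative of \<open>g\<close> of order \<open>s\<close>. The choice \<open>K = g x\<close> shows that the discrete norm of \<open>f~ - g\<close> is at most a
  constant times \<open>E\<close> (\<open>lp_seminorm_steklov_minus_Sobolev_le\<close>). Hence the discrete norms of \<open>f~ - f\<close> and \<open>f - g\<close>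
  agree up to constant factors and multiples of \<open>E\<close>. The modulus of smoothness is also at most a constant
  times \<open>E\<close> (\<open>modulus_le_Sobolev\<close>), which bounds the semi-discrete modulus by the K-functional. Conversely, some
  \<open>g\<close> makes \<open>E\<close> at most a constant times the modulus of smoothness (\<open>modulus_Sobolev_approximation\<close>). It is the
  Steklov average of order \<open>s + 1\<close> of a Borel representative of \<open>f\<close>: its distance from \<open>f\<close> is an average of
  differences of \<open>f\<close>, and so is its derivative of order \<open>s\<close>.

  The choice \<open>K = f x\<close> leaves differences of \<open>f\<close>, each of which is at most the local modulus at the midpoint of its
  nodes. As \<open>\<theta>\<close> varies, the midpoint sweeps the window of \<open>x\<close>, so the discrete norm of \<open>f~ - f\<close> is bounded by the
  averaged modulus (\<open>abs_steklov_minus_le_local_modulus\<close>). For this the local modulus must be measurable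
  (\<open>local_modulus_measurable\<close>).

  Constants are irrelevant throughout; in particular the triangle inequality for norms is used with the factor 4.
\<close>

section \<open>Finite differences\<close>

lemma fwd_diff_0 [simp]: "fwd_diff 0 h f x = f x"
  by (simp add: fwd_diff_def)

lemma fwd_diff_Suc:
  "fwd_diff (Suc k) h f x = fwd_diff k h f (x + h) - fwd_diff k h f x"
proof -
  let ?g = "\<lambda>i. f (x + real i * h)"
  have A: "fwd_diff (Suc k) h f x = (-1) ^ Suc k * f x
      + (\<Sum>i=0..k. real (Suc k choose Suc i) * (-1) ^ (k - i) * ?g (Suc i))"
    unfolding fwd_diff_def by (subst sum.atLeast0_atMost_Suc_shift) simp
  have B: "fwd_diff k h f x = (-1) ^ k * f x
      + (\<Sum>i=0..k. - (real (k choose Suc i) * (-1) ^ (k - i) * ?g (Suc i)))"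
  proof -
    have "fwd_diff k h f x = (\<Sum>i=0..Suc k. - (real (k choose i) * (-1) ^ (Suc k - i) * ?g i))"
      unfolding fwd_diff_def by (auto simp: Suc_diff_le intro!: sum.cong)
    also have "\<dots> = - ((-1) ^ Suc k * f x)
      + (\<Sum>i=0..k. - (real (k choose Suc i) * (-1) ^ (k - i) * ?g (Suc i)))"
      by (subst sum.atLeast0_atMost_Suc_shift) simp
    finally show ?thesis by simp
  qed
  have C: "fwd_diff k h f (x + h) = (\<Sum>i=0..k. real (k choose i) * (-1) ^ (k - i) * ?g (Suc i))"
    unfolding fwd_diff_def by (simp add: algebra_simps)
  show ?thesis
    unfolding A B C by (simp add: sum_negf sum.distrib distrib_left distrib_right)
qed

lemma fwd_diff_minus_step:
  "fwd_diff k (- h) f x = (-1) ^ k * fwd_diff k h f (x - real k * h)"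
proof (induction k arbitrary: x)
  case (Suc k)
  have "x - h - real k * h = x - real (Suc k) * h" "x - real (Suc k) * h + h = x - real k * h"
    by (simp_all add: algebra_simps)
  then show ?case
    by (simp only: fwd_diff_Suc Suc) (simp add: Suc algebra_simps)
qed simp

lemma fwd_diff_diff:
  "fwd_diff k h (\<lambda>x. f x - g x) x = fwd_diff k h f x - fwd_diff k h g x"
  by (induction k arbitrary: x) (simp_all add: fwd_diff_Suc)

lemma fwd_diff_cong:
  assumes "\<And>j. j \<le> k \<Longrightarrow> f (x + real j * h) = g (x + real j * h)"
  shows "fwd_diff k h f x = fwd_diff k h g x"
  using assms by (simp add: fwd_diff_def)

lemma abs_fwd_diff_add_le:
  "\<bar>fwd_diff (s + j) h f x\<bar> \<le> 2 ^ j * (\<Sum>i=0..j. \<bar>fwd_diff s h f (x + real i * h)\<bar>)"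
proof (induction j arbitrary: x)
  case (Suc j)
  let ?D = "\<lambda>i. \<bar>fwd_diff s h f (x + real i * h)\<bar>"
  have "\<bar>fwd_diff (s + Suc j) h f x\<bar> \<le> \<bar>fwd_diff (s + j) h f (x + h)\<bar> + \<bar>fwd_diff (s + j) h f x\<bar>"
    by (simp add: fwd_diff_Suc)
  also have "\<dots> \<le> 2 ^ j * (\<Sum>i=0..j. \<bar>fwd_diff s h f (x + h + real i * h)\<bar>) + 2 ^ j * (\<Sum>i=0..j. ?D i)"
    by (intro add_mono Suc)
  also have "(\<Sum>i=0..j. \<bar>fwd_diff s h f (x + h + real i * h)\<bar>) = (\<Sum>i=0..j. ?D (Suc i))"
    by (simp add: algebra_simps)
  also have "\<dots> \<le> (\<Sum>i=0..Suc j. ?D i)"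
    by (subst sum.atLeast0_atMost_Suc_shift) simp
  also have "(\<Sum>i=0..j. ?D i) \<le> (\<Sum>i=0..Suc j. ?D i)"
    by simp
  finally show ?case by simp
qed simp

lemma abs_fwd_diff_le:
  "\<bar>fwd_diff s h f x\<bar> \<le> 2 ^ s * (\<Sum>i=0..s. \<bar>f (x + real i * h)\<bar>)"
  using abs_fwd_diff_add_le[of 0 s h f x] by simp

section \<open>Powers and means\<close>

text \<open>
  Compare every summand with the largest one. At the price of a constant, this replaces the triangle inequality
  of the norm in all estimates of sums.
\<close>
lemma powr_sum_le:
  fixes z :: "'i \<Rightarrow> real" and p :: real
  assumes "finite A" "0 \<le> p" "\<And>i. i \<in> A \<Longrightarrow> 0 \<le> z i"
  shows "(\<Sum>i\<in>A. z i) powr p \<le> real (card A) powr p * (\<Sum>i\<in>A. z i powr p)"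
proof (cases "A = {}")
  case False
  define M where "M = Max (z ` A)"
  have "M \<in> z ` A" unfolding M_def using assms False by (intro Max_in) auto
  then obtain m where m: "m \<in> A" "M = z m" by auto
  have le: "z i \<le> M" if "i \<in> A" for i unfolding M_def using assms that by simp
  have "(\<Sum>i\<in>A. z i) \<le> real (card A) * M"
    using sum_bounded_above[of A z M] le by simp
  then have "(\<Sum>i\<in>A. z i) powr p \<le> (real (card A) * M) powr p"
    using assms by (intro powr_mono2) (auto intro: sum_nonneg)
  also have "\<dots> = real (card A) powr p * z m powr p"
    using assms m by (simp add: powr_mult)
  also have "\<dots> \<le> real (card A) powr p * (\<Sum>i\<in>A. z i powr p)"
    using assms m by (intro mult_left_mono member_le_sum) auto
  finally show ?thesis .
qed simp

lemma powr_add_le: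
  fixes x y p :: real
  assumes "0 \<le> p" "0 \<le> x" "0 \<le> y"
  shows "(x + y) powr p \<le> 2 powr p * (x powr p + y powr p)"
  using powr_sum_le[of "{True, False}" p "\<lambda>b. if b then x else y"] assms by simp

lemma powr_tangent_le:
  fixes t m p :: real
  assumes "1 \<le> p" "0 \<le> t" "0 < m"
  shows "m powr p + p * m powr (p - 1) * (t - m) \<le> t powr p"
proof (cases "t = 0")
  case True
  have "m powr p = m powr (p - 1) * m"
    using assms by (simp add: powr_diff)
  then have "m powr p + p * m powr (p - 1) * (0 - m) = (1 - p) * m powr p"
    by (simp add: algebra_simps)
  then show ?thesis using True assms by (simp add: mult_nonpos_nonneg)
next
  case False
  have "p * m powr (p - 1) * (t - m) \<le> t powr p - m powr p"
  proof (rule convex_on_imp_above_tangent[of "{0<..}"])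
    show "convex_on {0<..} (\<lambda>x. x powr p)" using assms by (intro powr_convex)
    show "((\<lambda>x. x powr p) has_field_derivative p * m powr (p - 1)) (at m within {0<..})"
      using assms by (auto intro!: derivative_eq_intros has_field_derivative_powr)
  qed (use False assms in \<open>auto simp: interior_open\<close>)
  then show ?thesis by simp
qed

text \<open>
  Jensen's inequality: the tangent line of \<open>t powr p\<close> at the mean of \<open>u\<close> lies below the graph. Integrated with
  \<open>t = u x\<close>, its linear part vanishes and the power of the mean remains.
\<close>
lemma mean_powr_le:
  fixes u :: "real \<Rightarrow> real"
  assumes p: "1 \<le> p" and cd: "c < d"
    and u: "u integrable_on {c..d}" and up: "(\<lambda>x. u x powr p) integrable_on {c..d}"
    and nonneg: "\<And>x. x \<in> {c..d} \<Longrightarrow> 0 \<le> u x"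
  shows "(integral {c..d} u / (d - c)) powr p \<le> integral {c..d} (\<lambda>x. u x powr p) / (d - c)"
proof -
  define m where "m = integral {c..d} u / (d - c)"
  have m0: "0 \<le> m" unfolding m_def using cd nonneg by (intro divide_nonneg_nonneg integral_nonneg u) auto
  show ?thesis
  proof (cases "m = 0")
    case True
    then show ?thesis
      unfolding m_def[symmetric] using cd nonneg p up by (auto intro!: divide_nonneg_nonneg integral_nonneg)
  next
    case False
    have "((\<lambda>x. m powr p + p * m powr (p - 1) * (u x - m)) has_integral
        (d - c) * m powr p + p * m powr (p - 1) * (integral {c..d} u - (d - c) * m)) {c..d}"
      using has_integral_const_real[of "m powr p" c d] has_integral_const_real[of m c d] cd
      by (intro has_integral_add has_integral_mult_right has_integral_diff integrable_integral u) auto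
    moreover have "integral {c..d} u - (d - c) * m = 0"
      unfolding m_def using cd by simp
    ultimately have I: "((\<lambda>x. m powr p + p * m powr (p - 1) * (u x - m)) has_integral (d - c) * m powr p) {c..d}"
      by simp
    have "(d - c) * m powr p \<le> integral {c..d} (\<lambda>x. u x powr p)"
      using False m0 p by (intro has_integral_le[OF I integrable_integral[OF up]] powr_tangent_le) (auto simp: nonneg)
    then show ?thesis
      unfolding m_def[symmetric] using cd by (simp add: field_simps)
  qed
qed

lemma abs_fwd_diff_powr_le:
  assumes "0 \<le> p"
  shows "\<bar>fwd_diff s h f x\<bar> powr p
    \<le> (2 ^ s) powr p * (real (s + 1) powr p * (\<Sum>i=0..s. \<bar>f (x + real i * h)\<bar> powr p))"
proof -
  have "\<bar>fwd_diff s h f x\<bar> powr p \<le> (2 ^ s * (\<Sum>i=0..s. \<bar>f (x + real i * h)\<bar>)) powr p"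
    using assms by (intro powr_mono2 abs_fwd_diff_le) auto
  also have "\<dots> \<le> (2 ^ s) powr p * (real (card {0..s}) powr p * (\<Sum>i=0..s. \<bar>f (x + real i * h)\<bar> powr p))"
    unfolding powr_mult using assms by (intro mult_left_mono powr_sum_le) auto
  finally show ?thesis by simp
qed

section \<open>Lebesgue norms as gauge integrals\<close>

text \<open>
  For non-negative functions Lebesgue and gauge integrability on an interval agree; without integrability both integrals
  are 0. The norms can therefore be handled with gauge integrals alone.
\<close>
lemma Lp_norm_eq:
  "Lp_norm p {c..d} u = (integral {c..d} (\<lambda>x. \<bar>u x\<bar> powr p)) powr (1 / p)"
proof (cases "(\<lambda>x. \<bar>u x\<bar> powr p) integrable_on {c..d}")
  case True
  then have "integrable (lebesgue_on {c..d}) (\<lambda>x. \<bar>u x\<bar> powr p)"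
    by (intro absolutely_integrable_imp_integrable nonnegative_absolutely_integrable_1) auto
  then have "(LINT x|lebesgue_on {c..d}. \<bar>u x\<bar> powr p) = integral {c..d} (\<lambda>x. \<bar>u x\<bar> powr p)"
    by (rule lebesgue_integral_eq_integral) auto
  then show ?thesis
    by (simp only: Lp_norm_def)
next
  case False
  then have "\<not> integrable (lebesgue_on {c..d}) (\<lambda>x. \<bar>u x\<bar> powr p)"
    using integrable_on_lebesgue_on[of "{c..d}" "\<lambda>x. \<bar>u x\<bar> powr p"] by auto
  then show ?thesis
    using False by (simp add: Lp_norm_def not_integrable_integral_eq not_integrable_integral)
qed

lemma Lp_space_iff:
  "u \<in> Lp_space p {c..d} \<longleftrightarrow>
     u \<in> borel_measurable (lebesgue_on {c..d}) \<and> (\<lambda>x. \<bar>u x\<bar> powr p) integrable_on {c..d}"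
  (is "_ \<longleftrightarrow> ?M \<and> ?I")
proof -
  have "integrable (lebesgue_on {c..d}) (\<lambda>x. \<bar>u x\<bar> powr p) \<longleftrightarrow> ?I"
  proof
    assume ?I
    then show "integrable (lebesgue_on {c..d}) (\<lambda>x. \<bar>u x\<bar> powr p)"
      by (intro absolutely_integrable_imp_integrable nonnegative_absolutely_integrable_1) auto
  qed (simp add: integrable_on_lebesgue_on)
  then show ?thesis by (simp add: Lp_space_def)
qed

lemma le_powr_self:
  fixes t p :: real
  assumes "0 \<le> t" "1 \<le> p"
  shows "t \<le> 1 + t powr p"
proof (cases "t \<le> 1")
  case True
  then show ?thesis using powr_ge_zero[of t p] by linarith
next
  case False
  then have "t powr 1 \<le> t powr p" using assms by (intro powr_mono) auto
  then show ?thesis using False by simp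
qed

lemma Lp_space_absolutely_integrable:
  assumes "u \<in> Lp_space p {c..d}" "1 \<le> p"
  shows "u absolutely_integrable_on {c..d}"
proof (rule measurable_bounded_by_integrable_imp_absolutely_integrable)
  show "(\<lambda>x. 1 + \<bar>u x\<bar> powr p) integrable_on {c..d}"
    using assms by (intro integrable_add) (auto simp: Lp_space_iff)
qed (use assms le_powr_self in \<open>auto simp: Lp_space_iff\<close>)

lemma Lp_space_bounded_by:
  assumes "u \<in> borel_measurable (lebesgue_on {c..d})" "w integrable_on {c..d}"
    "\<And>x. x \<in> {c..d} \<Longrightarrow> \<bar>u x\<bar> powr p \<le> w x"
  shows "u \<in> Lp_space p {c..d}"
proof -
  have "(\<lambda>x. \<bar>u x\<bar> powr p) absolutely_integrable_on {c..d}"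
    using assms by (intro measurable_bounded_by_integrable_imp_absolutely_integrable[of _ _ w]) auto
  then show ?thesis using assms by (auto simp: Lp_space_iff absolutely_integrable_on_def)
qed

lemma Lp_space_diff:
  assumes "u \<in> Lp_space p {c..d}" "v \<in> Lp_space p {c..d}" "1 \<le> p"
  shows "(\<lambda>x. u x - v x) \<in> Lp_space p {c..d}"
proof (rule Lp_space_bounded_by)
  show "(\<lambda>x. 2 powr p * (\<bar>u x\<bar> powr p + \<bar>v x\<bar> powr p)) integrable_on {c..d}"
    using assms by (intro integrable_on_mult_right integrable_add) (auto simp: Lp_space_iff)
  show "\<bar>u x - v x\<bar> powr p \<le> 2 powr p * (\<bar>u x\<bar> powr p + \<bar>v x\<bar> powr p)" for x
    using powr_add_le[of p "\<bar>u x\<bar>" "\<bar>v x\<bar>"] powr_mono2[of p "\<bar>u x - v x\<bar>" "\<bar>u x\<bar> + \<bar>v x\<bar>"] assms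
    by linarith
qed (use assms in \<open>auto simp: Lp_space_iff\<close>)

lemma continuous_on_imp_Lp_space:
  assumes "continuous_on {c..d} u" "1 \<le> p"
  shows "u \<in> Lp_space p {c..d}"
proof -
  have "continuous_on {c..d} (\<lambda>x. \<bar>u x\<bar> powr p)"
    using assms by (intro continuous_on_powr' continuous_intros) auto
  then show ?thesis
    using assms by (auto simp: Lp_space_iff intro!: continuous_imp_measurable_on_sets_lebesgue
      integrable_continuous_real)
qed

lemma powr_inverse_le_iff:
  fixes A B p :: real
  assumes "1 \<le> p" "0 \<le> A" "0 \<le> B"
  shows "A powr (1 / p) \<le> B \<longleftrightarrow> A \<le> B powr p"
proof
  assume "A powr (1 / p) \<le> B"
  then have "(A powr (1 / p)) powr p \<le> B powr p" using assms by (intro powr_mono2) auto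
  then show "A \<le> B powr p" using assms by (simp add: powr_powr)
next
  assume "A \<le> B powr p"
  then have "A powr (1 / p) \<le> (B powr p) powr (1 / p)" using assms by (intro powr_mono2) auto
  then show "A powr (1 / p) \<le> B" using assms by (simp add: powr_powr)
qed

lemma Lp_norm_nonneg [simp]: "0 \<le> Lp_norm p S u"
  by (simp add: Lp_norm_def)

lemma Lp_norm_powr:
  assumes "1 \<le> p"
  shows "Lp_norm p {c..d} u powr p = integral {c..d} (\<lambda>x. \<bar>u x\<bar> powr p)"
  using assms integral_nonneg[of "\<lambda>x. \<bar>u x\<bar> powr p" "{c..d}"]
  by (cases "(\<lambda>x. \<bar>u x\<bar> powr p) integrable_on {c..d}")
     (auto simp: Lp_norm_eq powr_powr not_integrable_integral)

lemma Lp_norm_le_iff: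
  assumes "1 \<le> p" "0 \<le> B"
  shows "Lp_norm p {c..d} u \<le> B \<longleftrightarrow> integral {c..d} (\<lambda>x. \<bar>u x\<bar> powr p) \<le> B powr p"
proof -
  have "0 \<le> integral {c..d} (\<lambda>x. \<bar>u x\<bar> powr p)"
    using integral_nonneg[of "\<lambda>x. \<bar>u x\<bar> powr p" "{c..d}"]
    by (cases "(\<lambda>x. \<bar>u x\<bar> powr p) integrable_on {c..d}") (auto simp: not_integrable_integral)
  then show ?thesis using assms by (simp add: Lp_norm_eq powr_inverse_le_iff)
qed


section \<open>Iterated means\<close>

definition locally_integrable :: "(real \<Rightarrow> real) \<Rightarrow> bool" where
  "locally_integrable u \<longleftrightarrow> (\<forall>c d. u absolutely_integrable_on {c..d})"

lemma locally_integrableD: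
  assumes "locally_integrable u"
  shows "u absolutely_integrable_on {c..d}" "u integrable_on {c..d}"
    "(\<lambda>x. \<bar>u x\<bar>) integrable_on {c..d}"
  using assms unfolding locally_integrable_def absolutely_integrable_on_def by auto

lemma locally_integrable_continuous:
  "continuous_on UNIV u \<Longrightarrow> locally_integrable u"
  unfolding locally_integrable_def
  by (auto intro: absolutely_integrable_continuous_real continuous_on_subset)

lemma locally_integrable_const [simp]: "locally_integrable (\<lambda>x. K)"
  by (intro locally_integrable_continuous continuous_intros)

lemma locally_integrable_abs: "locally_integrable u \<Longrightarrow> locally_integrable (\<lambda>x. \<bar>u x\<bar>)"
  unfolding locally_integrable_def absolutely_integrable_on_def by auto

lemma locally_integrable_diff:
  "locally_integrable u \<Longrightarrow> locally_integrable v \<Longrightarrow> locally_integrable (\<lambda>x. u x - v x)"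
  unfolding locally_integrable_def by (blast intro: set_integral_diff)

lemma locally_integrable_add:
  "locally_integrable u \<Longrightarrow> locally_integrable v \<Longrightarrow> locally_integrable (\<lambda>x. u x + v x)"
  unfolding locally_integrable_def by (blast intro: set_integral_add)

lemma locally_integrable_cmult:
  "locally_integrable u \<Longrightarrow> locally_integrable (\<lambda>x. K * u x)"
  unfolding locally_integrable_def using set_integrable_mult_right by blast

lemma locally_integrable_sum:
  "finite I \<Longrightarrow> (\<And>i. i \<in> I \<Longrightarrow> locally_integrable (H i)) \<Longrightarrow> locally_integrable (\<lambda>x. \<Sum>i\<in>I. H i x)"
  by (induction I rule: finite_induct) (auto intro: locally_integrable_add)

lemma has_integral_affine_real:
  fixes u :: "real \<Rightarrow> real"
  assumes "(u has_integral I) {m * \<alpha> + c..m * \<beta> + c}" "0 < m"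
  shows "((\<lambda>t. u (m * t + c)) has_integral I / m) {\<alpha>..\<beta>}"
  using has_integral_affinity'[of u I "m * \<alpha> + c" "m * \<beta> + c" m c] assms
  by (simp add: field_simps)

lemma integral_affine_real:
  fixes u :: "real \<Rightarrow> real"
  assumes "0 < m"
  shows "integral {\<alpha>..\<beta>} (\<lambda>t. u (m * t + c)) = integral {m * \<alpha> + c..m * \<beta> + c} u / m"
proof (cases "u integrable_on {m * \<alpha> + c..m * \<beta> + c}")
  case True
  then show ?thesis using assms by (intro integral_unique has_integral_affine_real integrable_integral)
next
  case False
  have "\<not> (\<lambda>t. u (m * t + c)) integrable_on {\<alpha>..\<beta>}"
  proof
    assume "(\<lambda>t. u (m * t + c)) integrable_on {\<alpha>..\<beta>}"
    then obtain I where "((\<lambda>t. u (m * t + c)) has_integral I) {(1/m) * (m * \<alpha> + c) + (- c / m)..(1/m) * (m * \<beta> + c) + (- c / m)}"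
      using assms by (auto simp: integrable_on_def field_simps)
    from has_integral_affine_real[OF this] False assms show False
      by (auto simp: integrable_on_def field_simps)
  qed
  then show ?thesis using False by (simp add: not_integrable_integral)
qed

lemma integrable_affine_real:
  fixes u :: "real \<Rightarrow> real"
  assumes "u integrable_on {m * \<alpha> + c..m * \<beta> + c}" "0 < m"
  shows "(\<lambda>t. u (m * t + c)) integrable_on {\<alpha>..\<beta>}"
  using assms has_integral_affine_real unfolding integrable_on_def by blast

lemma locally_integrable_affine:
  assumes "locally_integrable u" "0 < m"
  shows "locally_integrable (\<lambda>t. u (m * t + c))"
  unfolding locally_integrable_def absolutely_integrable_on_def
  using assms integrable_affine_real[of u m _ c] integrable_affine_real[of "\<lambda>x. \<bar>u x\<bar>" m _ c]
  by (auto simp: locally_integrableD)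

definition mean :: "real \<Rightarrow> (real \<Rightarrow> real) \<Rightarrow> real \<Rightarrow> real" where
  "mean h u y = integral {y..y + h} u / h"

lemma mean_continuous:
  assumes u: "locally_integrable u" and h: "0 \<le> h"
  shows "continuous_on UNIV (mean h u)"
proof (subst continuous_on_eq_continuous_at[OF open_UNIV], intro ballI)
  fix y0 :: real
  let ?U = "\<lambda>y. integral {y0 - 1..y} u"
  have U: "continuous_on {y0 - 1..y0 + 1 + h} ?U"
    by (intro indefinite_integral_continuous_1 locally_integrableD u)
  have "continuous_on {y0 - 1..y0 + 1} (\<lambda>y. (?U (y + h) - ?U y) / h)"
    unfolding divide_inverse
    by (intro continuous_intros continuous_on_compose2[OF U]) (use h in auto)
  moreover have "(?U (y + h) - ?U y) / h = mean h u y" if "y \<in> {y0 - 1..y0 + 1}" for y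
    using Henstock_Kurzweil_Integration.integral_combine[of "y0 - 1" y "y + h" u] that h
      locally_integrableD(2)[OF u] by (simp add: mean_def)
  ultimately have "continuous_on {y0 - 1..y0 + 1} (mean h u)"
    by (metis (no_types, lifting) continuous_on_cong)
  then show "isCont (mean h u) y0"
    by (rule continuous_on_interior) (simp add: interior_atLeastAtMost_real)
qed

text \<open>
  This is the smoothing property that makes Steklov averages differentiable; it needs a continuous \<open>u\<close> in order to
  hold at every point.
\<close>
lemma mean_has_derivative:
  assumes u: "continuous_on UNIV u" and h: "0 < h"
  shows "(mean h u has_vector_derivative (u (y + h) - u y) / h) (at y)"
proof -
  let ?U = "\<lambda>z. integral {y - 1..z} u"
  have int: "u integrable_on {c..d}" for c d
    using u by (intro integrable_continuous_real continuous_on_subset[OF u]) auto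
  have U: "(?U has_vector_derivative u z) (at z)" if "z \<in> {y - 1<..<y + h + 1}" for z
  proof -
    have "(?U has_vector_derivative u z) (at z within {y - 1..y + h + 1})"
      using that by (intro integral_has_vector_derivative continuous_on_subset[OF u]) auto
    then show ?thesis
      using that by (metis at_within_interior interior_atLeastAtMost_real)
  qed
  have U1: "(?U has_field_derivative u y) (at y)" "(?U has_field_derivative u (y + h)) (at (y + h))"
    using U[of y] U[of "y + h"] h by (auto simp: has_real_derivative_iff_has_vector_derivative)
  have "((\<lambda>z. (?U (z + h) - ?U z) / h) has_field_derivative (u (y + h) - u y) / h) (at y)"
    using U1(1) U1(2)[unfolded DERIV_shift[of ?U]] by (intro DERIV_cdivide DERIV_diff)
  moreover have "\<forall>\<^sub>F z in nhds y. (?U (z + h) - ?U z) / h = mean h u z"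
  proof (rule eventually_nhds_in_open[THEN eventually_mono, of "{y - 1<..<y + 1}"])
    fix z assume "z \<in> {y - 1<..<y + 1}"
    then show "(?U (z + h) - ?U z) / h = mean h u z"
      using Henstock_Kurzweil_Integration.integral_combine[of "y - 1" z "z + h" u] h int
      by (simp add: mean_def)
  qed auto
  ultimately show ?thesis
    by (simp add: DERIV_cong_ev[OF refl] has_real_derivative_iff_has_vector_derivative[symmetric])
qed

lemma mean_iterate_locally_integrable:
  assumes "locally_integrable u" "0 \<le> h"
  shows "locally_integrable ((mean h ^^ k) u)"
  by (induction k) (auto intro: assms locally_integrable_continuous mean_continuous)

lemma mean_iterate_continuous:
  assumes "locally_integrable u" "0 \<le> h"
  shows "continuous_on UNIV ((mean h ^^ Suc k) u)"
  using assms by (auto intro: mean_continuous mean_iterate_locally_integrable)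

lemma mean_const: "0 < h \<Longrightarrow> mean h (\<lambda>x. K) = (\<lambda>x. K)"
  by (simp add: mean_def fun_eq_iff)

lemma mean_iterate_const: "0 < h \<Longrightarrow> (mean h ^^ k) (\<lambda>x. K) = (\<lambda>x. K)"
  by (induction k) (auto simp: mean_const)

lemma mean_iterate_sum:
  assumes "finite I" "\<And>i. i \<in> I \<Longrightarrow> locally_integrable (H i)" "0 \<le> h"
  shows "(mean h ^^ k) (\<lambda>x. \<Sum>i\<in>I. c i * H i x) = (\<lambda>x. \<Sum>i\<in>I. c i * (mean h ^^ k) (H i) x)"
proof (induction k)
  case (Suc k)
  have "mean h (\<lambda>x. \<Sum>i\<in>I. c i * (mean h ^^ k) (H i) x) y = (\<Sum>i\<in>I. c i * mean h ((mean h ^^ k) (H i)) y)" for y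
  proof -
    have "(\<lambda>x. c i * (mean h ^^ k) (H i) x) integrable_on {y..y + h}" if "i \<in> I" for i
      using assms that by (intro integrable_on_mult_right locally_integrableD mean_iterate_locally_integrable) auto
    then have "integral {y..y + h} (\<lambda>x. \<Sum>i\<in>I. c i * (mean h ^^ k) (H i) x)
        = (\<Sum>i\<in>I. c i * integral {y..y + h} ((mean h ^^ k) (H i)))"
      using assms(1) by (subst integral_sum) auto
    then show ?thesis by (simp add: mean_def sum_divide_distrib)
  qed
  then show ?case by (simp add: Suc fun_eq_iff)
qed simp

lemma mean_iterate_diff:
  assumes "locally_integrable u" "locally_integrable v" "0 \<le> h"
  shows "(mean h ^^ k) (\<lambda>x. u x - v x) = (\<lambda>x. (mean h ^^ k) u x - (mean h ^^ k) v x)"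
  using mean_iterate_sum[of "{True, False}" "\<lambda>b. if b then u else v" h k "\<lambda>b. if b then 1 else -1"]
    assms by simp

text \<open>
  The summands of the Steklov kernel depend on \<open>m * \<theta>\<close>: means over the same variable \<open>\<tau>\<close> are means of \<open>f\<close> with
  the step \<open>m * h\<close>.
\<close>
lemma mean_iterate_affine:
  assumes "0 < m"
  shows "(mean h ^^ k) (\<lambda>x. u (m * x + y)) \<tau> = (mean (m * h) ^^ k) u (m * \<tau> + y)"
proof (induction k arbitrary: \<tau>)
  case (Suc k)
  have IH: "(mean h ^^ k) (\<lambda>x. u (m * x + y)) = (\<lambda>x. (mean (m * h) ^^ k) u (m * x + y))"
    by (intro ext Suc)
  have "mean h ((mean h ^^ k) (\<lambda>x. u (m * x + y))) \<tau>
      = integral {\<tau>..\<tau> + h} (\<lambda>x. (mean (m * h) ^^ k) u (m * x + y)) / h"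
    unfolding IH mean_def[of h] ..
  also have "\<dots> = mean (m * h) ((mean (m * h) ^^ k) u) (m * \<tau> + y)"
    unfolding mean_def[of "m * h" "(mean (m * h) ^^ k) u"]
      integral_affine_real[OF assms, of _ _ "(mean (m * h) ^^ k) u"]
    using assms by (simp add: algebra_simps)
  finally show ?case by simp
qed simp

text \<open>The innermost mean is bounded by an integral over a window of length \<open>h\<close>; the others only enlarge the window.\<close>
lemma abs_mean_iterate_le:
  assumes u: "locally_integrable u" and h: "0 < h"
  shows "\<bar>(mean h ^^ Suc k) u y\<bar> \<le> integral {y..y + real (Suc k) * h} (\<lambda>x. \<bar>u x\<bar>) / h"
proof (induction k arbitrary: y)
  case 0
  have "\<bar>integral {y..y + h} u\<bar> \<le> integral {y..y + h} (\<lambda>x. \<bar>u x\<bar>)"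
    using integral_norm_bound_integral[of u "{y..y + h}" "\<lambda>x. \<bar>u x\<bar>"] locally_integrableD[OF u] by simp
  then show ?case using h by (simp add: mean_def divide_right_mono)
next
  case (Suc k)
  let ?B = "integral {y..y + real (Suc (Suc k)) * h} (\<lambda>x. \<bar>u x\<bar>) / h"
  have "\<bar>(mean h ^^ Suc k) u z\<bar> \<le> ?B" if "z \<in> {y..y + h}" for z
  proof -
    have "integral {z..z + real (Suc k) * h} (\<lambda>x. \<bar>u x\<bar>) \<le> integral {y..y + real (Suc (Suc k)) * h} (\<lambda>x. \<bar>u x\<bar>)"
      using that by (intro integral_subset_le locally_integrableD u) (auto simp: algebra_simps)
    then show ?thesis using Suc[of z] h
      by (meson divide_right_mono less_imp_le order_trans)
  qed
  then have "\<bar>integral {y..y + h} ((mean h ^^ Suc k) u)\<bar> \<le> integral {y..y + h} (\<lambda>x. ?B)"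
    using integral_norm_bound_integral[of "(mean h ^^ Suc k) u" "{y..y + h}" "\<lambda>x. ?B",
        OF locally_integrableD(2)[OF mean_iterate_locally_integrable[OF u]] integrable_const_ivl] h
    by (simp del: funpow.simps)
  then have "\<bar>integral {y..y + h} ((mean h ^^ Suc k) u)\<bar> \<le> h * ?B"
    using h by simp
  then have "\<bar>integral {y..y + h} ((mean h ^^ Suc k) u)\<bar> / h \<le> ?B"
    using h by (simp add: field_simps)
  moreover have "(mean h ^^ Suc (Suc k)) u y = integral {y..y + h} ((mean h ^^ Suc k) u) / h"
    by (simp add: mean_def)
  ultimately show ?case using h by simp
qed

lemma abs_mean_iterate_diff_const_le:
  assumes u: "locally_integrable u" and h: "0 < h"
  shows "\<bar>(mean h ^^ Suc k) u y - K\<bar> \<le> integral {y..y + real (Suc k) * h} (\<lambda>x. \<bar>u x - K\<bar>) / h"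
  using abs_mean_iterate_le[of "\<lambda>x. u x - K" h k y] mean_iterate_diff[of u "\<lambda>x. K" h "Suc k"]
    mean_iterate_const[of h "Suc k" K] assms
  by (simp add: locally_integrable_diff del: funpow.simps)

section \<open>Steklov averages as iterated means\<close>

lemma iter_int_cong:
  assumes "\<And>ts. length ts = k \<Longrightarrow> set ts \<subseteq> {0..\<delta>} \<Longrightarrow> F ts = G ts"
  shows "iter_int \<delta> k F = iter_int \<delta> k G"
  using assms
proof (induction k arbitrary: F G)
  case (Suc k)
  have "iter_int \<delta> k (\<lambda>ts. F (t # ts)) = iter_int \<delta> k (\<lambda>ts. G (t # ts))" if "t \<in> {0..\<delta>}" for t
    by (intro Suc.IH Suc.prems) (use that in auto)
  then show ?case
    by (auto intro!: Bochner_Integration.integral_cong)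
qed simp

text \<open>
  The arguments of \<open>u\<close> involve the sum of the variables divided by \<open>r\<close>, so an integration over \<open>[0, \<delta>]\<close> is \<open>\<delta>\<close> times
  a mean over a window of length \<open>\<delta> / r\<close>. All the integrands after the innermost one are continuous, so
  the iterated Lebesgue integrals never degenerate to their default value.
\<close>
lemma iter_int_eq_mean_iterate:
  assumes u: "locally_integrable u" and \<delta>: "0 < \<delta>" and r: "0 < r"
  shows "iter_int \<delta> k (\<lambda>ts. u (c + sum_list ts / r)) = \<delta> ^ k * (mean (\<delta> / r) ^^ k) u c"
proof (induction k arbitrary: c)
  case (Suc k)
  let ?M = "(mean (\<delta> / r) ^^ k) u"
  have M: "locally_integrable ?M"
    using u \<delta> r by (intro mean_iterate_locally_integrable) auto
  have "iter_int \<delta> k (\<lambda>ts. u (c + sum_list (t # ts) / r)) = \<delta> ^ k * ?M (1 / r * t + c)" for t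
    using Suc[of "c + t / r"] by (simp add: add_divide_distrib add_ac)
  then have "iter_int \<delta> (Suc k) (\<lambda>ts. u (c + sum_list ts / r))
      = (LINT t|lebesgue_on {0..\<delta>}. \<delta> ^ k * ?M (1 / r * t + c))"
    by simp
  also have "\<dots> = integral {0..\<delta>} (\<lambda>t. \<delta> ^ k * ?M (1 / r * t + c))"
    using r by (intro lebesgue_integral_eq_integral absolutely_integrable_imp_integrable
        locally_integrableD locally_integrable_cmult locally_integrable_affine M) auto
  also have "\<dots> = \<delta> ^ k * (r * integral {c..c + \<delta> / r} ?M)"
    using r integral_affine_real[of "1 / r" 0 \<delta> ?M c] by (simp add: add.commute mult.commute)
  also have "\<dots> = \<delta> ^ Suc k * mean (\<delta> / r) ?M c"
    using \<delta> r by (simp add: mean_def)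
  finally show ?case by simp
qed simp

text \<open>
  The integrand of the Steklov average up to the sign \<open>(-1)^r\<close>, which cancels against \<open>(- \<delta>) powi (- r)\<close>. With this
  sign the kernel reproduces constants.
\<close>
definition steklov_kernel :: "nat \<Rightarrow> (real \<Rightarrow> real) \<Rightarrow> real \<Rightarrow> real \<Rightarrow> real" where
  "steklov_kernel r f x \<theta> = (\<Sum>m=1..r. (-1) ^ (m + 1) * real (r choose m) * f (x + real m * \<theta>))"

lemma steklov_kernel_locally_integrable:
  assumes "locally_integrable f"
  shows "locally_integrable (\<lambda>\<tau>. steklov_kernel r f x (\<tau> - c))"
proof -
  have "locally_integrable (\<lambda>\<tau>. f (real m * \<tau> + (x - real m * c)))" if "m \<in> {1..r}" for m
    using that by (intro locally_integrable_affine assms) auto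
  then show ?thesis
    unfolding steklov_kernel_def
    by (intro locally_integrable_sum locally_integrable_cmult) (auto simp: algebra_simps)
qed

lemma steklov_kernel_eq:
  "steklov_kernel r f x \<theta> = f x - (-1) ^ r * fwd_diff r \<theta> f x"
proof -
  have "(-1) ^ r * fwd_diff r \<theta> f x = (\<Sum>k=0..r. real (r choose k) * (-1) ^ k * f (x + real k * \<theta>))"
    unfolding fwd_diff_def sum_distrib_left
  proof (intro sum.cong refl)
    fix k assume "k \<in> {0..r}"
    then have "(-1) ^ r * (-1) ^ (r - k) = ((-1) ^ k :: real)"
      by (metis (no_types) atLeastAtMost_iff le_add_diff_inverse power_add power_minus1_even mult.assoc mult.right_neutral mult_2 )
    then show "(-1) ^ r * (real (r choose k) * (-1) ^ (r - k) * f (x + real k * \<theta>)) = real (r choose k) * (-1) ^ k * f (x + real k * \<theta>)"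
      by (metis (no_types) mult.assoc mult.commute)
  qed
  also have "\<dots> = f x + (\<Sum>k=1..r. real (r choose k) * (-1) ^ k * f (x + real k * \<theta>))"
    by (simp add: sum.atLeast_Suc_atMost)
  also have "(\<Sum>k=1..r. real (r choose k) * (-1) ^ k * f (x + real k * \<theta>)) = - steklov_kernel r f x \<theta>"
    unfolding steklov_kernel_def by (simp add: sum_negf[symmetric] algebra_simps)
  finally show ?thesis by simp
qed

text \<open>
  With \<open>u = (x - a) / (b - a)\<close> the argument stays between \<open>x - u * (b - a) = a\<close> and
  \<open>x + (1 - u) * (b - a) = b\<close>. This is why the window of the Steklov average slides with \<open>x\<close>.
\<close>
lemma sliding_window_mem:
  fixes a b \<delta> \<kappa> x \<tau> :: real
  assumes "a < b" "0 \<le> \<kappa>" "\<kappa> * \<delta> \<le> b - a" "x \<in> {a..b}" "\<tau> \<in> {0..\<delta>}"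
  shows "x + \<kappa> * (\<tau> - (x - a) / (b - a) * \<delta>) \<in> {a..b}"
proof -
  define u where "u = (x - a) / (b - a)"
  have u: "0 \<le> u" "u \<le> 1" "x = a + u * (b - a)"
    using assms by (auto simp: u_def field_simps)
  have "\<kappa> * (\<tau> - u * \<delta>) \<ge> - (u * (\<kappa> * \<delta>))"
    using assms by (simp add: algebra_simps)
  moreover have "u * (\<kappa> * \<delta>) \<le> u * (b - a)"
    using assms u by (intro mult_left_mono)
  moreover have "\<kappa> * (\<tau> - u * \<delta>) \<le> (1 - u) * (\<kappa> * \<delta>)"
    using assms mult_left_mono[of \<tau> \<delta> \<kappa>] by (simp add: algebra_simps)
  moreover have "(1 - u) * (\<kappa> * \<delta>) \<le> (1 - u) * (b - a)"
    using assms u by (intro mult_left_mono) auto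
  moreover have "x + (1 - u) * (b - a) = b" using u by (simp add: algebra_simps)
  ultimately show ?thesis using u unfolding u_def[symmetric] by auto
qed

lemma steklov_eq_mean_iterate:
  assumes ab: "a < b" and r: "1 \<le> r" and \<delta>: "0 < \<delta>" "\<delta> \<le> (b - a) / real r" and x: "x \<in> {a..b}"
    and f0: "locally_integrable f0" "\<And>y. y \<in> {a..b} \<Longrightarrow> f0 y = f y"
  shows "steklov a b \<delta> r f x = (mean (\<delta> / real r) ^^ r) (\<lambda>\<tau>. steklov_kernel r f0 x (\<tau> - (x - a) / (b - a) * \<delta>)) 0"
proof -
  define u where "u = (x - a) / (b - a)"
  define H where "H = (\<lambda>\<tau>. steklov_kernel r f0 x (\<tau> - u * \<delta>))"
  have H: "locally_integrable H"
    unfolding H_def by (intro steklov_kernel_locally_integrable f0)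
  \<comment> \<open>Comparing parities is safe although the subtraction truncates, since \<open>m \<le> r\<close>.\<close>
  have sgn: "(-1) ^ (r - m + 1) * real (r choose (r - m)) = (-1) ^ r * ((-1) ^ (m + 1) * real (r choose m))"
    if "m \<in> {1..r}" for m
  proof -
    have "even (r - m + 1) \<longleftrightarrow> even (r + (m + 1))" using that by auto
    then have "(-1) ^ (r - m + 1) = ((-1) ^ (r + (m + 1)) :: real)"
      by (simp only: uminus_power_if power_one)
    then show ?thesis using that binomial_symmetric[of m r] by (simp add: power_add)
  qed
  have "iter_int \<delta> r (\<lambda>ts. let \<theta> = sum_list ts / real r - (x - a) / (b - a) * \<delta>
       in \<Sum>m=1..r. (-1) ^ (r - m + 1) * real (r choose (r - m)) * f (x + real m * \<theta>))
     = iter_int \<delta> r (\<lambda>ts. (-1) ^ r * H (0 + sum_list ts / real r))"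
  proof (rule iter_int_cong)
    fix ts :: "real list" assume ts: "length ts = r" "set ts \<subseteq> {0..\<delta>}"
    define \<tau> where "\<tau> = sum_list ts / real r"
    have "0 \<le> sum_list ts" using ts by (intro sum_list_nonneg) auto
    moreover have "sum_list ts \<le> real (length ts) * \<delta>"
      using ts(2) by (induction ts) (auto simp: algebra_simps)
    ultimately have \<tau>: "\<tau> \<in> {0..\<delta>}" using ts r by (simp add: \<tau>_def field_simps)
    have mem: "x + real m * (\<tau> - u * \<delta>) \<in> {a..b}" if "m \<in> {1..r}" for m
      unfolding u_def
    proof (rule sliding_window_mem[OF ab _ _ x \<tau>])
      have "real m * \<delta> \<le> real r * \<delta>" using that \<delta> by simp
      also have "\<dots> \<le> b - a" using \<delta> r by (simp add: field_simps)
      finally show "real m * \<delta> \<le> b - a" .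
    qed simp
    have "(\<Sum>m=1..r. (-1) ^ (r - m + 1) * real (r choose (r - m)) * f (x + real m * (\<tau> - u * \<delta>)))
      = (\<Sum>m=1..r. (-1) ^ r * ((-1) ^ (m + 1) * real (r choose m) * f0 (x + real m * (\<tau> - u * \<delta>))))"
      by (intro sum.cong refl) (simp only: sgn f0(2)[OF mem] mult.assoc)
    also have "\<dots> = (-1) ^ r * H \<tau>"
      unfolding H_def steklov_kernel_def by (simp add: sum_distrib_left)
    finally show "(let \<theta> = sum_list ts / real r - (x - a) / (b - a) * \<delta>
       in \<Sum>m=1..r. (-1) ^ (r - m + 1) * real (r choose (r - m)) * f (x + real m * \<theta>)) = (-1) ^ r * H (0 + sum_list ts / real r)"
      by (simp add: Let_def u_def \<tau>_def)
  qed
  also have "\<dots> = \<delta> ^ r * (mean (\<delta> / real r) ^^ r) (\<lambda>\<tau>. (-1) ^ r * H \<tau>) 0"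
    using \<delta> r H by (intro iter_int_eq_mean_iterate locally_integrable_cmult) auto
  also have "(mean (\<delta> / real r) ^^ r) (\<lambda>\<tau>. (-1) ^ r * H \<tau>) 0 = (-1) ^ r * (mean (\<delta> / real r) ^^ r) H 0"
    using mean_iterate_sum[of "{0::nat}" "\<lambda>_. H" "\<delta> / real r" r "\<lambda>_. (-1) ^ r"] H \<delta> by simp
  finally have "steklov a b \<delta> r f x = (- \<delta>) powi (- int r) * (\<delta> ^ r * ((-1) ^ r * (mean (\<delta> / real r) ^^ r) H 0))"
    by (simp add: steklov_def)
  also have "\<dots> = (mean (\<delta> / real r) ^^ r) H 0"
  proof -
    have "(- \<delta>) powi (- int r) = inverse ((-1) ^ r * \<delta> ^ r)"
      by (simp only: power_int_minus power_int_of_nat power_minus[of \<delta>])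
    moreover have "inverse (A * B) * (B * (A * M)) = M" if "A \<noteq> 0" "B \<noteq> 0" for A B M :: real
      using that by (simp add: field_simps)
    ultimately show ?thesis using \<delta> by simp
  qed
  finally show ?thesis by (simp add: H_def u_def)
qed

text \<open>
  The constant \<open>K\<close> is reproduced by the means. It is chosen later as a value of \<open>f\<close> or of a Sobolev function at \<open>x\<close>.
\<close>
lemma abs_steklov_diff_le:
  assumes ab: "a < b" and r: "1 \<le> r" and \<delta>: "0 < \<delta>" "\<delta> \<le> (b - a) / real r" and x: "x \<in> {a..b}"
    and f0: "locally_integrable f0" "\<And>y. y \<in> {a..b} \<Longrightarrow> f0 y = f y"
  shows "\<bar>steklov a b \<delta> r f x - K\<bar>
    \<le> real r / \<delta> * integral {0..\<delta>} (\<lambda>\<tau>. \<bar>steklov_kernel r f0 x (\<tau> - (x - a) / (b - a) * \<delta>) - K\<bar>)"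
proof -
  define H where "H = (\<lambda>\<tau>. steklov_kernel r f0 x (\<tau> - (x - a) / (b - a) * \<delta>))"
  have H: "locally_integrable H"
    unfolding H_def by (intro steklov_kernel_locally_integrable f0)
  obtain k where k: "r = Suc k" using r by (cases r) auto
  have "\<bar>(mean (\<delta> / real r) ^^ r) H 0 - K\<bar> \<le> integral {0..0 + real r * (\<delta> / real r)} (\<lambda>x. \<bar>H x - K\<bar>) / (\<delta> / real r)"
    unfolding k using \<delta> by (intro abs_mean_iterate_diff_const_le H) auto
  then show ?thesis
    using r steklov_eq_mean_iterate[OF assms] by (simp add: H_def mult.commute)
qed


section \<open>Absolutely continuous functions and Sobolev functions\<close>

lemma abs_continuous_onE:
  assumes "abs_continuous_on S g" "0 < \<epsilon>"
  obtains \<delta> where "0 < \<delta>" "\<And>d. \<lbrakk>d division_of \<Union>d; \<Union>d \<subseteq> S; (\<Sum>k\<in>d. Sup k - Inf k) < \<delta>\<rbrakk> \<Longrightarrow>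
    (\<Sum>k\<in>d. \<bar>g (Sup k) - g (Inf k)\<bar>) < \<epsilon>"
  using assms(1)[unfolded abs_continuous_on_def, rule_format, OF assms(2)] by (elim exE conjE) blast

text \<open>
  The fundamental theorem of calculus for absolutely continuous functions. Tags at which the
  derivative exists are treated as in the classical proof; the other tags form a null set, so a
  gauge can confine their intervals to an open set of small measure, and absolute continuity bounds
  the total increment over these intervals.
\<close>
lemma abs_continuous_on_ftc:
  fixes u v :: "real \<Rightarrow> real"
  assumes ac: "abs_continuous_on {a..b} u" and N: "negligible N"
    and deriv: "\<And>t. t \<in> {a..b} - N \<Longrightarrow> (u has_vector_derivative v t) (at t within {a..b})"
    and xy: "a \<le> x" "x \<le> y" "y \<le> b"
  shows "(v has_integral u y - u x) {x..y}"
proof -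
  define w where "w t = (if t \<in> N then 0 else v t)" for t
  have "(w has_integral u y - u x) (cbox x y)"
    unfolding has_integral
  proof (intro allI impI)
    fix e :: real assume "0 < e"
    \<comment> \<open>The summand 1 keeps the denominator positive when \<open>x = y\<close>.\<close>
    define e1 where "e1 = e / (2 * (1 + (y - x)))"
    have e1: "0 < e1" "e1 * (y - x) < e / 2"
    proof -
      show pos: "0 < e1" using \<open>0 < e\<close> xy by (auto simp: e1_def intro!: divide_pos_pos)
      have "1 + (y - x) \<noteq> 0" using xy by simp
      then have "e1 * (1 + (y - x)) = e / 2" by (simp add: e1_def del: diff_add_eq add_diff_eq distrib_left_numeral)
      then show "e1 * (y - x) < e / 2" using pos by (simp add: distrib_left)
    qed
    obtain \<delta> where \<delta>: "0 < \<delta>" and ac\<delta>: "\<And>d. \<lbrakk>d division_of \<Union>d; \<Union>d \<subseteq> {a..b}; (\<Sum>k\<in>d. Sup k - Inf k) < \<delta>\<rbrakk> \<Longrightarrow>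
        (\<Sum>k\<in>d. \<bar>u (Sup k) - u (Inf k)\<bar>) < e / 2"
      by (rule abs_continuous_onE[OF ac half_gt_zero[OF \<open>0 < e\<close>]]) (rule that)
    obtain T where T: "open T" "N \<subseteq> T" "T - N \<in> lmeasurable" "emeasure lebesgue (T - N) < ennreal \<delta>"
      using sets_lebesgue_outer_open[OF negligible_imp_sets[OF N] \<delta>] by metis
    have TN: "T \<in> lmeasurable" "measure lebesgue T < \<delta>"
    proof -
      have "T \<in> lmeasurable \<and> measure lebesgue T = measure lebesgue (T - N)"
      proof -
        have "negligible ((T - N) - T \<union> (T - (T - N)))"
          by (rule negligible_subset[OF N]) auto
        then show ?thesis
          using T(3) by (metis lmeasurable_negligible_symdiff measure_negligible_symdiff)
      qed
      then show "T \<in> lmeasurable" "measure lebesgue T < \<delta>"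
        using T(3,4) \<delta> by (auto simp: emeasure_eq_measure2 ennreal_less_iff)
    qed
    have "\<exists>d>0. \<forall>z\<in>{a..b}. \<bar>z - t\<bar> < d \<longrightarrow> \<bar>u z - u t - (z - t) * v t\<bar> \<le> e1 * \<bar>z - t\<bar>"
      if "t \<in> {a..b} - N" for t
      using deriv[OF that] e1(1) unfolding has_vector_derivative_def has_derivative_within_alt by auto
    then obtain D where D: "\<And>t. t \<in> {a..b} - N \<Longrightarrow> 0 < D t"
      "\<And>t z. \<lbrakk>t \<in> {a..b} - N; z \<in> {a..b}; \<bar>z - t\<bar> < D t\<rbrakk> \<Longrightarrow> \<bar>u z - u t - (z - t) * v t\<bar> \<le> e1 * \<bar>z - t\<bar>"
      by metis
    define \<gamma> where "\<gamma> t = (if t \<in> N then T else ball t (if t \<in> {a..b} then D t else 1))" for t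
    have gauge: "gauge \<gamma>"
      unfolding gauge_def \<gamma>_def using T D(1) by auto
    have riemann: "norm ((\<Sum>(t, k)\<in>P. measure lborel k *\<^sub>R w t) - (u y - u x)) < e"
      if P: "P tagged_division_of cbox x y" "\<gamma> fine P" for P
    proof -
      have fin: "finite P" using P by blast
      have K: "\<exists>p q. k = {p..q} \<and> p \<le> t \<and> t \<le> q \<and> x \<le> p \<and> q \<le> y \<and> k \<subseteq> \<gamma> t" if tk: "(t, k) \<in> P" for t k
      proof -
        obtain p q where pq: "k = cbox p q" using tagged_division_ofD(4)[OF P(1) tk] by blast
        have "t \<in> k" "k \<subseteq> cbox x y" "k \<subseteq> \<gamma> t"
          using tagged_division_ofD(2,3)[OF P(1) tk] P(2) tk by (auto simp: fine_def)
        then show ?thesis unfolding pq by (auto intro!: exI[of _ p] exI[of _ q])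
      qed
      let ?good = "{(t, k) \<in> P. t \<notin> N}" and ?bad = "{(t, k) \<in> P. t \<in> N}"
      have split: "P = ?good \<union> ?bad" "?good \<inter> ?bad = {}" "finite ?good" "finite ?bad"
        using fin by (auto intro: finite_subset[OF _ fin])
      define \<Phi> where "\<Phi> = (\<lambda>(t, k). measure lborel k *\<^sub>R w t - (u (Sup k) - u (Inf k)))"
      have "(\<Sum>(t, k)\<in>P. measure lborel k *\<^sub>R w t) - (u y - u x) = (\<Sum>tk\<in>P. \<Phi> tk)"
        using additive_tagged_division_1[of x y P u] P(1) xy
        by (simp add: \<Phi>_def sum_subtractf case_prod_unfold)
      also have "\<dots> = (\<Sum>tk\<in>?good. \<Phi> tk) + (\<Sum>tk\<in>?bad. \<Phi> tk)"
        using split by (subst (1) split(1)) (rule sum.union_disjoint)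
      finally have eq: "(\<Sum>(t, k)\<in>P. measure lborel k *\<^sub>R w t) - (u y - u x) = (\<Sum>tk\<in>?good. \<Phi> tk) + (\<Sum>tk\<in>?bad. \<Phi> tk)" .
      have "\<bar>\<Sum>tk\<in>?good. \<Phi> tk\<bar> \<le> (\<Sum>tk\<in>?good. e1 * (case tk of (t, k) \<Rightarrow> Sup k - Inf k))"
      proof (rule order_trans[OF sum_abs], rule sum_mono)
        fix tk assume tk: "tk \<in> ?good"
        obtain t k where [simp]: "tk = (t, k)" by (cases tk)
        obtain p q where pq: "k = {p..q}" "p \<le> t" "t \<le> q" "x \<le> p" "q \<le> y" "k \<subseteq> \<gamma> t"
          using K[of t k] tk by auto
        have t: "t \<in> {a..b} - N" using tk pq xy by auto
        have "p \<in> ball t (D t)" "q \<in> ball t (D t)"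
          using pq(2,3,6) t unfolding pq(1) \<gamma>_def by (simp_all add: subset_iff)
        then have "\<bar>u p - u t - (p - t) * v t\<bar> \<le> e1 * \<bar>p - t\<bar>" "\<bar>u q - u t - (q - t) * v t\<bar> \<le> e1 * \<bar>q - t\<bar>"
          using pq xy D(2)[OF t, of p] D(2)[OF t, of q] by (simp_all add: dist_real_def abs_minus_commute)
        moreover have "(q - p) * v t - (u q - u p) = (u p - u t - (p - t) * v t) - (u q - u t - (q - t) * v t)"
          by (simp add: algebra_simps)
        ultimately have "\<bar>(q - p) * v t - (u q - u p)\<bar> \<le> e1 * (t - p) + e1 * (q - t)"
          using pq by auto
        then show "\<bar>\<Phi> tk\<bar> \<le> e1 * (case tk of (t, k) \<Rightarrow> Sup k - Inf k)"
          using pq t by (simp add: \<Phi>_def w_def algebra_simps)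
      qed
      also have "\<dots> \<le> (\<Sum>tk\<in>P. e1 * (case tk of (t, k) \<Rightarrow> Sup k - Inf k))"
      proof (rule sum_mono2[OF fin])
        fix tk assume "tk \<in> P - ?good"
        then show "0 \<le> e1 * (case tk of (t, k) \<Rightarrow> Sup k - Inf k)"
          using K e1 by (cases tk) fastforce
      qed auto
      also have "\<dots> = e1 * (y - x)"
        using additive_tagged_division_1[of x y P "\<lambda>t. t"] P(1) xy
        by (simp add: sum_distrib_left[symmetric])
      finally have good: "\<bar>\<Sum>tk\<in>?good. \<Phi> tk\<bar> < e / 2" using e1(2) by (rule le_less_trans)
      let ?d = "snd ` ?bad"
      have tpd: "?bad tagged_partial_division_of cbox x y"
      proof (rule tagged_partial_division_subset)
        show "P tagged_partial_division_of cbox x y"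
          using P(1) unfolding tagged_division_of_def by (rule conjunct1)
      qed auto
      have div: "?d division_of \<Union>?d" by (rule partial_division_of_tagged_division[OF tpd])
      have Kd: "k \<subseteq> {a..b} \<and> k \<subseteq> T \<and> Sup k - Inf k = measure lebesgue k" if "k \<in> ?d" for k
      proof -
        from \<open>k \<in> ?d\<close> obtain t where t: "(t, k) \<in> P" "t \<in> N" by auto
        then obtain p q where "k = {p..q}" "p \<le> t" "t \<le> q" "x \<le> p" "q \<le> y" "k \<subseteq> \<gamma> t"
          using K by blast
        then show ?thesis using t(2) xy by (auto simp: \<gamma>_def)
      qed
      then have sub: "\<Union>?d \<subseteq> {a..b}" "\<Union>?d \<subseteq> T" by blast+
      have "(\<Sum>k\<in>?d. Sup k - Inf k) = (\<Sum>k\<in>?d. measure lebesgue k)"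
        by (rule sum.cong) (simp_all only: Kd)
      also have "\<dots> = measure lebesgue (\<Union>?d)" by (rule content_division[OF div])
      also have "\<dots> \<le> measure lebesgue T"
        using lmeasurable_division[OF div] TN sub by (intro measure_mono_fmeasurable) auto
      finally have "(\<Sum>k\<in>?d. \<bar>u (Sup k) - u (Inf k)\<bar>) < e / 2"
        using TN by (intro ac\<delta> div sub) auto
      moreover have "(\<Sum>(t, k)\<in>?bad. \<bar>u (Sup k) - u (Inf k)\<bar>) = (\<Sum>k\<in>?d. \<bar>u (Sup k) - u (Inf k)\<bar>)"
      proof -
        \<comment> \<open>\<open>Sup {}\<close> and \<open>Inf {}\<close> are unspecified, so the sum is rewritten with a function that vanishes at \<open>{}\<close>.\<close>
        define F where "F k = (if k = {} then 0 else \<bar>u (Sup k) - u (Inf k)\<bar>)" for k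
        have F: "\<bar>u (Sup k) - u (Inf k)\<bar> = F k" if "(t, k) \<in> P" for t k
          using K[OF that] by (auto simp: F_def)
        have "(\<Sum>(t, k)\<in>?bad. F k) = (\<Sum>k\<in>?d. F k)"
        proof (rule sum.over_tagged_division_lemma[OF tagged_partial_division_of_Union_self[OF tpd]])
          fix p q :: real assume "box p q = {}"
          then show "F (cbox p q) = 0"
            by (cases "p = q") (auto simp: F_def)
        qed
        moreover have "(\<Sum>(t, k)\<in>?bad. \<bar>u (Sup k) - u (Inf k)\<bar>) = (\<Sum>(t, k)\<in>?bad. F k)"
          by (intro sum.cong) (auto simp: F)
        moreover have "(\<Sum>k\<in>?d. \<bar>u (Sup k) - u (Inf k)\<bar>) = (\<Sum>k\<in>?d. F k)"
          by (intro sum.cong) (auto simp: F)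
        ultimately show ?thesis by simp
      qed
      moreover have "\<bar>\<Sum>tk\<in>?bad. \<Phi> tk\<bar> \<le> (\<Sum>(t, k)\<in>?bad. \<bar>u (Sup k) - u (Inf k)\<bar>)"
        by (rule order_trans[OF sum_abs], rule sum_mono) (auto simp: \<Phi>_def w_def)
      ultimately show ?thesis using good eq by simp
    qed
    show "\<exists>\<gamma>. gauge \<gamma> \<and> (\<forall>P. P tagged_division_of cbox x y \<and> \<gamma> fine P \<longrightarrow>
        norm ((\<Sum>(t, k)\<in>P. measure lborel k *\<^sub>R w t) - (u y - u x)) < e)"
      by (intro exI[of _ \<gamma>] conjI gauge allI impI) (elim conjE, rule riemann)
  qed
  then have "(w has_integral u y - u x) {x..y}" by simp
  then show ?thesis
    by (rule has_integral_spike[OF N, rotated]) (simp add: w_def)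
qed

lemma shift_has_vector_derivative:
  fixes G G' :: "real \<Rightarrow> real"
  assumes "\<And>y. y \<in> {a..b} \<Longrightarrow> (G has_vector_derivative G' y) (at y within {a..b})"
    and "a \<le> c + t" "d + t \<le> b" "y \<in> {c..d}"
  shows "((\<lambda>y. G (y + t)) has_vector_derivative G' (y + t)) (at y within {c..d})"
proof -
  have "((\<lambda>y. y + t) has_vector_derivative 1) (at y within {c..d})"
    by (auto intro!: derivative_eq_intros)
  moreover have "(G has_vector_derivative G' (y + t)) (at (y + t) within (\<lambda>y. y + t) ` {c..d})"
    by (rule has_vector_derivative_within_subset[OF assms(1)]) (use assms in auto)
  ultimately show ?thesis
    using vector_diff_chain_within[of "\<lambda>y. y + t" 1 y "{c..d}" G] by (simp add: o_def)
qed

lemma fwd_diff_has_vector_derivative: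
  fixes G G' :: "real \<Rightarrow> real"
  assumes "\<And>y. y \<in> {a..b} \<Longrightarrow> (G has_vector_derivative G' y) (at y within {a..b})"
    and "0 \<le> h" "a \<le> c" "d + real k * h \<le> b" "y \<in> {c..d}"
  shows "(fwd_diff k h G has_vector_derivative fwd_diff k h G' y) (at y within {c..d})"
  unfolding fwd_diff_def
proof (intro has_vector_derivative_sum has_vector_derivative_mult_right)
  fix i assume "i \<in> {0..k}"
  then have "real i * h \<le> real k * h" using assms by (intro mult_right_mono) auto
  moreover have "0 \<le> real i * h" using assms by simp
  ultimately have "a \<le> c + real i * h" "d + real i * h \<le> b" using assms by linarith+
  then show "((\<lambda>x. G (x + real i * h)) has_vector_derivative G' (y + real i * h)) (at y within {c..d})"
    using assms by (intro shift_has_vector_derivative[of a b]) auto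
qed

text \<open>
  Each use of the mean value theorem trades one difference for one derivative and a factor \<open>h\<close>;
  only the last difference is bounded by an integral.
\<close>
lemma abs_fwd_diff_le_integral:
  fixes G :: "nat \<Rightarrow> real \<Rightarrow> real" and w :: "real \<Rightarrow> real"
  assumes w: "locally_integrable w" "\<And>t. 0 \<le> w t"
    and h: "0 < h" "a \<le> x" "x + real (Suc k) * h \<le> b"
    and der: "\<And>j y. j < k \<Longrightarrow> y \<in> {a..b} \<Longrightarrow> (G j has_vector_derivative G (Suc j) y) (at y within {a..b})"
    and last: "\<And>y z. a \<le> y \<Longrightarrow> y \<le> z \<Longrightarrow> z \<le> b \<Longrightarrow> \<bar>G k z - G k y\<bar> \<le> integral {y..z} w"
  shows "\<bar>fwd_diff (Suc k) h (G 0) x\<bar> \<le> h ^ k * integral {x..x + real (Suc k) * h} w"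
  using h(2,3) der last
proof (induction k arbitrary: G x)
  case 0
  then show ?case using h by (simp add: fwd_diff_Suc)
next
  case (Suc k)
  have len: "real (Suc (Suc k)) * h = h + real (Suc k) * h" by (simp add: algebra_simps)
  have "\<exists>\<xi>\<in>{x..x + h}. fwd_diff (Suc k) h (G 0) (x + h) - fwd_diff (Suc k) h (G 0) x
      = (x + h - x) *\<^sub>R fwd_diff (Suc k) h (G 1) \<xi>"
  proof (rule mvt_very_simple)
    fix y assume y: "x \<le> y" "y \<le> x + h"
    have "(fwd_diff (Suc k) h (G 0) has_vector_derivative fwd_diff (Suc k) h (G 1) y) (at y within {x..x + h})"
    proof (rule fwd_diff_has_vector_derivative)
      show "(G 0 has_vector_derivative G 1 y) (at y within {a..b})" if "y \<in> {a..b}" for y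
        using Suc.prems(3)[of 0] that by simp
    qed (use h(1) Suc.prems(1,2) y len in auto)
    then show "(fwd_diff (Suc k) h (G 0) has_derivative (\<lambda>t. t *\<^sub>R fwd_diff (Suc k) h (G 1) y)) (at y within {x..x + h})"
      by (simp add: has_vector_derivative_def)
  qed (use h in auto)
  then obtain \<xi> where \<xi>: "\<xi> \<in> {x..x + h}"
    "fwd_diff (Suc (Suc k)) h (G 0) x = h * fwd_diff (Suc k) h (G 1) \<xi>"
    by (auto simp: fwd_diff_Suc[of "Suc k" h "G 0"])
  have "\<bar>fwd_diff (Suc k) h (G (Suc 0)) \<xi>\<bar> \<le> h ^ k * integral {\<xi>..\<xi> + real (Suc k) * h} w"
    using \<xi> Suc.prems len by (intro Suc.IH[of \<xi> "\<lambda>j. G (Suc j)"]) auto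
  also have "\<dots> \<le> h ^ k * integral {x..x + real (Suc (Suc k)) * h} w"
    using \<xi> h w by (intro mult_left_mono integral_subset_le locally_integrableD) (auto simp: len simp del: of_nat_Suc)
  finally have "h * \<bar>fwd_diff (Suc k) h (G (Suc 0)) \<xi>\<bar> \<le> h * (h ^ k * integral {x..x + real (Suc (Suc k)) * h} w)"
    using h by simp
  then show ?case using h by (simp add: \<xi>(2) abs_mult)
qed

text \<open>Extension by zero: windows around points of \<open>[a, b]\<close> may leave the interval, and means should exist there as well.\<close>
definition restrict_zero :: "real \<Rightarrow> real \<Rightarrow> (real \<Rightarrow> real) \<Rightarrow> real \<Rightarrow> real" where
  "restrict_zero a b u x = (if x \<in> {a..b} then u x else 0)"

lemma restrict_zero_locally_integrable:
  assumes "u absolutely_integrable_on {a..b}"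
  shows "locally_integrable (restrict_zero a b u)"
proof -
  have "restrict_zero a b u absolutely_integrable_on UNIV"
    using assms absolutely_integrable_restrict_UNIV[of "{a..b}" u]
    by (simp add: restrict_zero_def[abs_def])
  then show ?thesis
    unfolding locally_integrable_def by (meson absolutely_integrable_on_subinterval subset_UNIV)
qed

lemma nth_deriv_Suc:
  "nth_deriv a b (Suc j) g x = vector_derivative (nth_deriv a b j g) (at x within {a..b})"
  by (simp add: nth_deriv_def)

lemma Sobolev_abs_fwd_diff_le:
  assumes p: "1 \<le> p" and s: "1 \<le> s" and g: "g \<in> Sobolev p a b s"
    and x: "0 < h" "a \<le> x" "x + real s * h \<le> b"
  shows "\<bar>fwd_diff s h g x\<bar>
    \<le> h ^ (s - 1) * integral {x..x + real s * h} (\<lambda>t. \<bar>restrict_zero a b (nth_deriv a b s g) t\<bar>)"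
proof -
  obtain k where k: "s = Suc k" using s by (cases s) auto
  let ?G = "\<lambda>j. nth_deriv a b j g" and ?v = "nth_deriv a b s g"
  have v: "?v absolutely_integrable_on {a..b}"
    using g p by (auto simp: Sobolev_def intro: Lp_space_absolutely_integrable)
  then have w: "locally_integrable (restrict_zero a b ?v)" by (rule restrict_zero_locally_integrable)
  have "AE t in lebesgue. t \<in> {a..b} \<longrightarrow> ?G k differentiable (at t within {a..b})"
    using g k by (simp add: Sobolev_def AE_restrict_space_iff)
  then obtain N where N: "negligible N" "\<And>t. t \<in> {a..b} - N \<Longrightarrow> ?G k differentiable (at t within {a..b})"
    unfolding eventually_ae_filter_negligible by blast
  have last: "\<bar>?G k z - ?G k y\<bar> \<le> integral {y..z} (\<lambda>t. \<bar>restrict_zero a b ?v t\<bar>)"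
    if "a \<le> y" "y \<le> z" "z \<le> b" for y z
  proof -
    have "(?v has_integral ?G k z - ?G k y) {y..z}"
    proof (rule abs_continuous_on_ftc[OF _ N(1) _ that])
      show "abs_continuous_on {a..b} (?G k)" using g k by (simp add: Sobolev_def)
      show "(?G k has_vector_derivative ?v t) (at t within {a..b})" if "t \<in> {a..b} - N" for t
        using N(2)[OF that] unfolding k nth_deriv_Suc vector_derivative_works[symmetric] .
    qed
    then have "(restrict_zero a b ?v has_integral ?G k z - ?G k y) {y..z}"
      by (rule has_integral_eq[rotated]) (use that in \<open>auto simp: restrict_zero_def\<close>)
    then show ?thesis
      using integral_norm_bound_integral[of "restrict_zero a b ?v" "{y..z}" "\<lambda>t. \<bar>restrict_zero a b ?v t\<bar>"]
        locally_integrableD[OF w] by (auto simp: has_integral_iff)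
  qed
  have "\<bar>fwd_diff (Suc k) h (?G 0) x\<bar>
    \<le> h ^ k * integral {x..x + real (Suc k) * h} (\<lambda>t. \<bar>restrict_zero a b ?v t\<bar>)"
  proof (rule abs_fwd_diff_le_integral)
    show "(?G j has_vector_derivative ?G (Suc j) y) (at y within {a..b})" if "j < k" "y \<in> {a..b}" for j y
      using g that unfolding nth_deriv_Suc vector_derivative_works[symmetric] by (simp add: Sobolev_def k)
  qed (use x k w last in \<open>auto intro: locally_integrable_abs\<close>)
  then show ?thesis by (simp add: k nth_deriv_def)
qed

lemma abs_fwd_diff_symmetric:
  "\<bar>fwd_diff s (- h) f x\<bar> = \<bar>fwd_diff s h f (x - real s * h)\<bar>"
  by (simp add: fwd_diff_minus_step abs_mult)

lemma fwd_diff_zero_step: "1 \<le> s \<Longrightarrow> fwd_diff s 0 f x = 0"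
  by (cases s) (simp_all add: fwd_diff_Suc)

text \<open>
  Negative steps reduce to positive ones by reversing the order of the nodes. Steps of both signs occur in the sliding
  window.
\<close>
lemma Sobolev_abs_fwd_diff_le_signed:
  assumes p: "1 \<le> p" and s: "1 \<le> s" and g: "g \<in> Sobolev p a b s"
    and x: "x \<in> {a..b}" "x + real s * \<theta> \<in> {a..b}" and cd: "x \<in> {c..d}" "x + real s * \<theta> \<in> {c..d}"
  shows "\<bar>fwd_diff s \<theta> g x\<bar>
    \<le> \<bar>\<theta>\<bar> ^ (s - 1) * integral {c..d} (\<lambda>t. \<bar>restrict_zero a b (nth_deriv a b s g) t\<bar>)"
proof -
  let ?w = "\<lambda>t. \<bar>restrict_zero a b (nth_deriv a b s g) t\<bar>"
  have "locally_integrable (restrict_zero a b (nth_deriv a b s g))"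
    using g p by (auto simp: Sobolev_def intro: Lp_space_absolutely_integrable restrict_zero_locally_integrable)
  then have w: "?w integrable_on {y..z}" for y z by (rule locally_integrableD)
  have mono: "integral {y..z} ?w \<le> integral {c..d} ?w" if "c \<le> y" "z \<le> d" for y z
    using that by (intro integral_subset_le w) auto
  consider "\<theta> = 0" | "\<theta> > 0" | "\<theta> < 0" by linarith
  then show ?thesis
  proof cases
    case 1
    then show ?thesis using s w by (auto simp: fwd_diff_zero_step intro!: mult_nonneg_nonneg integral_nonneg)
  next
    case 2
    have "\<bar>fwd_diff s \<theta> g x\<bar> \<le> \<theta> ^ (s - 1) * integral {x..x + real s * \<theta>} ?w"
      using 2 x by (intro Sobolev_abs_fwd_diff_le[OF p s g]) auto
    also have "\<dots> \<le> \<theta> ^ (s - 1) * integral {c..d} ?w"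
      using cd 2 by (intro mult_left_mono mono) auto
    finally show ?thesis using 2 by simp
  next
    case 3
    define y where "y = x + real s * \<theta>"
    have y: "y + real s * (- \<theta>) = x" "x - real s * (- \<theta>) = y" by (auto simp: y_def)
    have "\<bar>fwd_diff s (- \<theta>) g y\<bar> \<le> (- \<theta>) ^ (s - 1) * integral {y..y + real s * (- \<theta>)} ?w"
      using 3 x y by (intro Sobolev_abs_fwd_diff_le[OF p s g]) (auto simp: y_def)
    also have "\<dots> \<le> (- \<theta>) ^ (s - 1) * integral {c..d} ?w"
      using cd 3 by (intro mult_left_mono mono) (auto simp: y_def)
    finally show ?thesis using 3 abs_fwd_diff_symmetric[of s "- \<theta>" g x] by (simp add: y y_def)
  qed
qed


section \<open>Quasi-norms and restrictions\<close>

lemma powr_add_le_add_powr: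
  fixes A B p :: real
  assumes "1 \<le> p" "0 \<le> A" "0 \<le> B"
  shows "2 powr p * (A powr p + B powr p) \<le> (4 * (A + B)) powr p"
proof -
  have "A powr p \<le> (A + B) powr p" "B powr p \<le> (A + B) powr p"
    using assms by (auto intro!: powr_mono2)
  moreover have "(2::real) powr 1 \<le> 2 powr p" using assms by (intro powr_mono) auto
  then have "2 * (A + B) powr p \<le> 2 powr p * (A + B) powr p"
    by (intro mult_right_mono) auto
  ultimately have "A powr p + B powr p \<le> 2 powr p * (A + B) powr p" by linarith
  then have "2 powr p * (A powr p + B powr p) \<le> 2 powr p * (2 powr p * (A + B) powr p)"
    by (intro mult_left_mono) auto
  also have "\<dots> = (2 * (2 * (A + B))) powr p" by (simp only: powr_mult)
  also have "2 * (2 * (A + B)) = 4 * (A + B)" by simp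
  finally show ?thesis .
qed

text \<open>
  Minkowski's inequality with the constant 4 in place of 1, which is all that an equivalence up to constants requires.
  It follows from the pointwise bound for powers of sums.
\<close>
lemma Lp_norm_add_le:
  assumes p: "1 \<le> p" and uv: "u \<in> Lp_space p {c..d}" "v \<in> Lp_space p {c..d}"
    and z: "\<And>x. x \<in> {c..d} \<Longrightarrow> \<bar>z x\<bar> \<le> \<bar>u x\<bar> + \<bar>v x\<bar>"
  shows "Lp_norm p {c..d} z \<le> 4 * (Lp_norm p {c..d} u + Lp_norm p {c..d} v)"
proof (cases "(\<lambda>x. \<bar>z x\<bar> powr p) integrable_on {c..d}")
  case False
  then show ?thesis using p by (simp add: Lp_norm_eq not_integrable_integral)
next
  case True
  have I: "(\<lambda>x. \<bar>u x\<bar> powr p) integrable_on {c..d}" "(\<lambda>x. \<bar>v x\<bar> powr p) integrable_on {c..d}"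
    using uv by (auto simp: Lp_space_iff)
  have "integral {c..d} (\<lambda>x. \<bar>z x\<bar> powr p) \<le> integral {c..d} (\<lambda>x. 2 powr p * (\<bar>u x\<bar> powr p + \<bar>v x\<bar> powr p))"
  proof (rule integral_le[OF True])
    show "\<bar>z x\<bar> powr p \<le> 2 powr p * (\<bar>u x\<bar> powr p + \<bar>v x\<bar> powr p)" if "x \<in> {c..d}" for x
      using powr_add_le[of p "\<bar>u x\<bar>" "\<bar>v x\<bar>"] powr_mono2[of p "\<bar>z x\<bar>" "\<bar>u x\<bar> + \<bar>v x\<bar>"] p z[OF that]
      by linarith
  qed (intro integrable_on_mult_right integrable_add I)
  also have "\<dots> = 2 powr p * (Lp_norm p {c..d} u powr p + Lp_norm p {c..d} v powr p)"
    using I p by (simp add: Lp_norm_powr integral_add)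
  also have "\<dots> \<le> (4 * (Lp_norm p {c..d} u + Lp_norm p {c..d} v)) powr p"
    using p by (intro powr_add_le_add_powr) auto
  finally show ?thesis using p by (simp add: Lp_norm_le_iff)
qed

lemma lp_seminorm_nonneg [simp]: "0 \<le> lp_seminorm p a b n x f"
  by (simp add: lp_seminorm_def)

lemma lp_seminorm_powr:
  assumes "1 \<le> p" "a \<le> b"
  shows "lp_seminorm p a b n x f powr p = (b - a) / real n * (\<Sum>k=0..n. \<bar>f (x k)\<bar> powr p)"
proof -
  have "0 \<le> (b - a) / real n * (\<Sum>k=0..n. \<bar>f (x k)\<bar> powr p)"
    using assms by (intro mult_nonneg_nonneg sum_nonneg) auto
  moreover have "1 / p * p = 1" using assms(1) by simp
  ultimately show ?thesis unfolding lp_seminorm_def powr_powr by (simp only: powr_one)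
qed

lemma lp_seminorm_le_iff:
  assumes "1 \<le> p" "a \<le> b" "0 \<le> B"
  shows "lp_seminorm p a b n x f \<le> B \<longleftrightarrow> (b - a) / real n * (\<Sum>k=0..n. \<bar>f (x k)\<bar> powr p) \<le> B powr p"
proof -
  have "0 \<le> (b - a) / real n * (\<Sum>k=0..n. \<bar>f (x k)\<bar> powr p)"
    using assms by (intro mult_nonneg_nonneg sum_nonneg) auto
  then show ?thesis using assms unfolding lp_seminorm_def by (intro powr_inverse_le_iff) auto
qed

lemma lp_seminorm_add_le:
  assumes p: "1 \<le> p" and ab: "a \<le> b"
    and z: "\<And>y. \<bar>z y\<bar> \<le> \<bar>u y\<bar> + \<bar>v y\<bar>"
  shows "lp_seminorm p a b n x z \<le> 4 * (lp_seminorm p a b n x u + lp_seminorm p a b n x v)"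
proof -
  have "(\<Sum>k=0..n. \<bar>z (x k)\<bar> powr p) \<le> (\<Sum>k=0..n. 2 powr p * (\<bar>u (x k)\<bar> powr p + \<bar>v (x k)\<bar> powr p))"
  proof (rule sum_mono)
    show "\<bar>z (x k)\<bar> powr p \<le> 2 powr p * (\<bar>u (x k)\<bar> powr p + \<bar>v (x k)\<bar> powr p)" for k
      using powr_add_le[of p "\<bar>u (x k)\<bar>" "\<bar>v (x k)\<bar>"] powr_mono2[of p "\<bar>z (x k)\<bar>" "\<bar>u (x k)\<bar> + \<bar>v (x k)\<bar>"] p z[of "x k"]
      by linarith
  qed
  then have "(b - a) / real n * (\<Sum>k=0..n. \<bar>z (x k)\<bar> powr p)
      \<le> (b - a) / real n * (\<Sum>k=0..n. 2 powr p * (\<bar>u (x k)\<bar> powr p + \<bar>v (x k)\<bar> powr p))"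
    using ab by (intro mult_left_mono) auto
  also have "\<dots> = 2 powr p * (lp_seminorm p a b n x u powr p + lp_seminorm p a b n x v powr p)"
    unfolding lp_seminorm_powr[OF p ab] sum_distrib_left[symmetric] sum.distrib
    by (simp add: algebra_simps)
  also have "\<dots> \<le> (4 * (lp_seminorm p a b n x u + lp_seminorm p a b n x v)) powr p"
    using p by (intro powr_add_le_add_powr) auto
  finally show ?thesis using p ab by (simp add: lp_seminorm_le_iff)
qed

lemma restrict_zero_in [simp]: "x \<in> {a..b} \<Longrightarrow> restrict_zero a b u x = u x"
  by (simp add: restrict_zero_def)

lemma restrict_zero_integral:
  assumes "u integrable_on {a..b}"
  shows "restrict_zero a b u integrable_on {c..d}"
    "(\<And>x. x \<in> {a..b} \<Longrightarrow> 0 \<le> u x) \<Longrightarrow> integral {c..d} (restrict_zero a b u) \<le> integral {a..b} u"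
proof -
  have eq: "restrict_zero a b u = (\<lambda>x. if x \<in> {a..b} then u x else 0)"
    by (simp add: restrict_zero_def fun_eq_iff)
  have int: "u integrable_on ({a..b} \<inter> {c..d})"
    using integrable_on_subinterval[OF assms, of "max a c" "min b d"] by (simp add: Int_atLeastAtMost)
  then show "restrict_zero a b u integrable_on {c..d}"
    unfolding eq integrable_restrict_Int .
  assume "\<And>x. x \<in> {a..b} \<Longrightarrow> 0 \<le> u x"
  then show "integral {c..d} (restrict_zero a b u) \<le> integral {a..b} u"
    unfolding eq integral_restrict_Int using int assms by (intro integral_subset_le) auto
qed

section \<open>Discrete norms dominated by window means\<close>

text \<open>
  The override at \<open>n + 1\<close> affects the last gap only; for \<open>k < n\<close> the minimum bounds a genuine gap.
\<close>
lemma min_gap_imp_spaced: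
  assumes "\<delta> \<le> min_gap a b n x" "k < n"
  shows "x k + \<delta> \<le> x (Suc k)"
proof -
  define y where "y = x(n + 1 := (b - a) + x 1)"
  have "min_gap a b n x = Min ((\<lambda>k. y (k + 1) - y k) ` {0..n})"
    by (simp add: min_gap_def y_def Let_def)
  also have "\<dots> \<le> y (k + 1) - y k"
    using assms by (intro Min_le) auto
  also have "\<dots> = x (Suc k) - x k" using assms by (simp add: y_def)
  finally show ?thesis using assms by simp
qed

lemma spaced_diff:
  fixes x :: "nat \<Rightarrow> real"
  assumes "\<And>k. k < n \<Longrightarrow> x k + \<delta> \<le> x (Suc k)" "i \<le> j" "j \<le> n"
  shows "real (j - i) * \<delta> \<le> x j - x i"
  using assms(2,3)
proof (induction j rule: dec_induct)
  case (step j)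
  then have "real (j - i) * \<delta> \<le> x j - x i" "x j + \<delta> \<le> x (Suc j)" using assms(1) by auto
  then show ?case using step by (simp add: Suc_diff_le algebra_simps)
qed simp

text \<open>
  The first and the last point whose windows contain \<open>t\<close> are at most \<open>2 * R * \<delta>\<close> apart, and consecutive
  points are at least \<open>\<delta>\<close> apart.
\<close>
lemma card_windows_le:
  fixes x :: "nat \<Rightarrow> real"
  assumes sp: "\<And>k. k < n \<Longrightarrow> x k + \<delta> \<le> x (Suc k)" and \<delta>: "0 < \<delta>"
  shows "card {k \<in> {0..n}. t \<in> {x k - real R * \<delta>..x k + real R * \<delta>}} \<le> 2 * R + 1" (is "card ?K \<le> _")
proof (cases "?K = {}")
  case False
  have fin: "finite ?K" by simp
  let ?i = "Min ?K" and ?j = "Max ?K"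
  have mem: "?i \<in> ?K" "?j \<in> ?K" and ij: "?i \<le> ?j"
    using Min_in[OF fin False] Max_in[OF fin False] Min_le[OF fin, of ?j] by auto
  have "real (?j - ?i) * \<delta> \<le> x ?j - x ?i"
    using mem ij by (intro spaced_diff[of n x, OF sp]) auto
  also have "\<dots> \<le> real (2 * R) * \<delta>" using mem by (auto simp: algebra_simps)
  finally have "?j - ?i \<le> 2 * R" using \<delta> by simp
  moreover have "card ?K \<le> card {?i..?j}"
    using Min_le[OF fin] Max_ge[OF fin] by (intro card_mono) auto
  ultimately show ?thesis by simp
next
  case True
  then show ?thesis by (simp only: card.empty)
qed

lemma sum_window_integrals_le:
  fixes x :: "nat \<Rightarrow> real" and w :: "real \<Rightarrow> real"
  assumes sp: "\<And>k. k < n \<Longrightarrow> x k + \<delta> \<le> x (Suc k)" and \<delta>: "0 < \<delta>"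
    and w: "\<And>c d. w integrable_on {c..d}" "\<And>t. 0 \<le> w t" "\<And>c d. integral {c..d} w \<le> B"
  shows "(\<Sum>k=0..n. integral {x k - real R * \<delta>..x k + real R * \<delta>} w) \<le> real (2 * R + 1) * B"
proof -
  let ?W = "\<lambda>k. {x k - real R * \<delta>..x k + real R * \<delta>}"
  define c where "c = x 0 - real R * \<delta>"
  define d where "d = x n + real R * \<delta>"
  have "?W k \<subseteq> {c..d}" if "k \<in> {0..n}" for k
  proof -
    have "0 \<le> real (k - 0) * \<delta>" "0 \<le> real (n - k) * \<delta>" using \<delta> by auto
    moreover have "real (k - 0) * \<delta> \<le> x k - x 0" "real (n - k) * \<delta> \<le> x n - x k"
      using that by (intro spaced_diff[of n x, OF sp]; simp)+
    ultimately show ?thesis by (auto simp: c_def d_def)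
  qed
  then have W: "?W k \<inter> {c..d} = ?W k" if "k \<in> {0..n}" for k
    using that by blast
  have int: "(\<lambda>t. if t \<in> ?W k then w t else 0) integrable_on {c..d}" if "k \<in> {0..n}" for k
    unfolding integrable_restrict_Int W[OF that] by (rule w)
  have "(\<Sum>k=0..n. integral (?W k) w) = (\<Sum>k=0..n. integral {c..d} (\<lambda>t. if t \<in> ?W k then w t else 0))"
    by (intro sum.cong refl) (simp only: integral_restrict_Int W)
  also have "\<dots> = integral {c..d} (\<lambda>t. \<Sum>k=0..n. if t \<in> ?W k then w t else 0)"
    using int by (subst integral_sum) auto
  also have "\<dots> \<le> integral {c..d} (\<lambda>t. real (2 * R + 1) * w t)"
  proof (rule integral_le)
    fix t
    have "(\<Sum>k=0..n. if t \<in> ?W k then w t else 0) = real (card {k \<in> {0..n}. t \<in> ?W k}) * w t"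
      by (subst sum.inter_filter[symmetric]) simp_all
    also have "\<dots> \<le> real (2 * R + 1) * w t"
      using card_windows_le[of n x \<delta> t R, OF sp \<delta>] w(2) by (intro mult_right_mono) (auto simp flip: of_nat_le_iff)
    finally show "(\<Sum>k=0..n. if t \<in> ?W k then w t else 0) \<le> real (2 * R + 1) * w t" .
  next
    show "(\<lambda>t. \<Sum>k=0..n. if t \<in> ?W k then w t else 0) integrable_on {c..d}"
      using int by (intro integrable_sum) simp_all
    show "(\<lambda>t. real (2 * R + 1) * w t) integrable_on {c..d}"
      by (intro integrable_on_mult_right w)
  qed
  also have "\<dots> \<le> real (2 * R + 1) * B"
    using w(3)[of c d] by (simp del: of_nat_add of_nat_Suc)
  finally show ?thesis .
qed

text \<open>
  Jensen's inequality turns the window means into means of \<open>\<bar>v\<bar> powr p\<close>, and the windows of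
  points at mutual distance \<open>\<delta>\<close> overlap at most \<open>2 R + 1\<close> times. This is how the discrete norm is
  controlled by a norm on \<open>[a, b]\<close>.
\<close>
lemma lp_seminorm_window_le:
  fixes x :: "nat \<Rightarrow> real"
  assumes ab: "a < b" and p: "1 \<le> p" and n: "1 \<le> n" and \<gamma>: "0 < \<gamma>" and R: "1 \<le> R"
    and sp: "\<And>k. k < n \<Longrightarrow> x k + \<gamma> / real n \<le> x (Suc k)"
    and v: "v \<in> Lp_space p {a..b}" and A: "0 \<le> A"
    and \<phi>: "\<And>k. k \<le> n \<Longrightarrow> \<bar>\<phi> (x k)\<bar> \<le> A * (real n / \<gamma>) *
        integral {x k - real R * (\<gamma> / real n)..x k + real R * (\<gamma> / real n)} (\<lambda>t. \<bar>restrict_zero a b v t\<bar>)"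
  shows "lp_seminorm p a b n x \<phi> \<le> 2 * real R * (1 + 2 * (b - a) / \<gamma>) * A * Lp_norm p {a..b} v"
proof -
  define \<delta> where "\<delta> = \<gamma> / real n"
  have \<delta>: "0 < \<delta>" "real n / \<gamma> = 1 / \<delta>" using \<gamma> n by (auto simp: \<delta>_def)
  \<comment> \<open>The length of the windows; \<open>N\<close> below is the \<open>p\<close>-th power of the norm of \<open>v\<close>.\<close>
  define L where "L = 2 * real R * \<delta>"
  have L: "0 < L" using \<delta> R by (simp add: L_def)
  let ?W = "\<lambda>k. {x k - real R * \<delta>..x k + real R * \<delta>}" and ?v = "restrict_zero a b v"
  define w where "w t = \<bar>?v t\<bar> powr p" for t
  define N where "N = integral {a..b} (\<lambda>t. \<bar>v t\<bar> powr p)"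
  have vp: "(\<lambda>t. \<bar>v t\<bar> powr p) integrable_on {a..b}" using v by (simp add: Lp_space_iff)
  have w_eq: "w = restrict_zero a b (\<lambda>t. \<bar>v t\<bar> powr p)"
    using p by (simp add: w_def fun_eq_iff restrict_zero_def)
  have w: "w integrable_on {c..d}" "integral {c..d} w \<le> N" for c d
    using restrict_zero_integral[OF vp] unfolding w_eq N_def by auto
  have lv: "locally_integrable ?v"
    using v p by (intro restrict_zero_locally_integrable Lp_space_absolutely_integrable)
  have pt: "\<bar>\<phi> (x k)\<bar> powr p \<le> (2 * real R * A) powr p / L * integral (?W k) w" if "k \<le> n" for k
  proof -
    let ?I = "integral (?W k) (\<lambda>t. \<bar>?v t\<bar>)"
    have "\<bar>\<phi> (x k)\<bar> \<le> 2 * real R * A * (?I / L)"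
      using \<phi>[OF that] \<delta> R unfolding \<delta>_def[symmetric] L_def by (simp add: field_simps)
    moreover have "0 \<le> ?I"
      using locally_integrableD[OF lv] by (intro integral_nonneg) auto
    ultimately have "\<bar>\<phi> (x k)\<bar> powr p \<le> (2 * real R * A) powr p * (?I / L) powr p"
      using p powr_mono2[of p "\<bar>\<phi> (x k)\<bar>" "2 * real R * A * (?I / L)"]
      unfolding powr_mult[of "2 * real R * A"] by simp
    also have "(?I / L) powr p \<le> integral (?W k) w / L"
    proof -
      have len: "x k + real R * \<delta> - (x k - real R * \<delta>) = L" by (simp add: L_def)
      show ?thesis
        using mean_powr_le[OF p, of "x k - real R * \<delta>" "x k + real R * \<delta>" "\<lambda>t. \<bar>?v t\<bar>"]
          w(1) locally_integrableD(3)[OF lv] \<delta> R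
        unfolding len w_def[abs_def] by simp
    qed
    finally show ?thesis by (simp add: mult_left_mono divide_simps)
  qed
  have "(b - a) / real n * (\<Sum>k=0..n. \<bar>\<phi> (x k)\<bar> powr p)
      \<le> (b - a) / real n * (\<Sum>k=0..n. (2 * real R * A) powr p / L * integral (?W k) w)"
    using ab n by (intro mult_left_mono sum_mono pt) auto
  also have "\<dots> = (b - a) / real n * ((2 * real R * A) powr p / L) * (\<Sum>k=0..n. integral (?W k) w)"
    by (simp only: sum_distrib_left mult.assoc)
  also have "\<dots> \<le> (b - a) / real n * ((2 * real R * A) powr p / L) * (real (2 * R + 1) * N)"
    using ab n L sp unfolding \<delta>_def[symmetric]
    by (intro mult_left_mono sum_window_integrals_le \<delta> w) (auto simp: w_def)
  also have "\<dots> = (2 * real R * A) powr p * ((b - a) / \<gamma> * (real (2 * R + 1) / (2 * real R))) * N"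
    using n \<gamma> R by (simp add: L_def \<delta>_def mult_ac)
  also have "\<dots> \<le> (2 * real R * A) powr p * (1 + 2 * (b - a) / \<gamma>) powr p * N"
  proof -
    \<comment> \<open>Adding 1 makes the base at least 1, so that the factor may be replaced by its \<open>p\<close>-th power.\<close>
    have "(b - a) / \<gamma> * (real (2 * R + 1) / (2 * real R)) \<le> (b - a) / \<gamma> * 2"
      using ab \<gamma> R by (intro mult_left_mono) (auto simp: field_simps)
    also have "\<dots> \<le> (1 + 2 * (b - a) / \<gamma>) powr 1" using ab \<gamma> by (simp add: field_simps)
    also have "\<dots> \<le> (1 + 2 * (b - a) / \<gamma>) powr p" using ab \<gamma> p by (intro powr_mono) auto
    finally show ?thesis
      using vp by (intro mult_right_mono mult_left_mono) (auto simp: N_def intro!: integral_nonneg)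
  qed
  also have "\<dots> = (2 * real R * (1 + 2 * (b - a) / \<gamma>) * A * Lp_norm p {a..b} v) powr p"
    unfolding N_def Lp_norm_powr[OF p, symmetric] using ab \<gamma> A by (simp add: powr_mult)
  finally show ?thesis
    using ab \<gamma> A p by (subst lp_seminorm_le_iff) auto
qed

lemma integral_sliding_window_le:
  fixes w :: "real \<Rightarrow> real"
  assumes w: "\<And>c d. w integrable_on {c..d}" "\<And>t. 0 \<le> w t"
    and \<kappa>: "0 < \<kappa>" "\<kappa> \<le> R" and u: "0 \<le> u" "u \<le> 1" and \<delta>: "0 \<le> \<delta>"
  shows "integral {0..\<delta>} (\<lambda>\<tau>. w (x + \<kappa> * (\<tau> - u * \<delta>))) \<le> integral {x - R * \<delta>..x + R * \<delta>} w / \<kappa>"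
proof -
  have "integral {0..\<delta>} (\<lambda>\<tau>. w (x + \<kappa> * (\<tau> - u * \<delta>))) = integral {0..\<delta>} (\<lambda>\<tau>. w (\<kappa> * \<tau> + (x - \<kappa> * u * \<delta>)))"
    by (simp add: algebra_simps)
  also have "\<dots> = integral {x - \<kappa> * u * \<delta>..x + \<kappa> * (1 - u) * \<delta>} w / \<kappa>"
    by (subst integral_affine_real[OF \<kappa>(1)]) (simp add: algebra_simps)
  also have "\<dots> \<le> integral {x - R * \<delta>..x + R * \<delta>} w / \<kappa>"
  proof (intro divide_right_mono integral_subset_le w(1) ballI)
    have "\<kappa> * u \<le> R * 1" "\<kappa> * (1 - u) \<le> R * 1" using \<kappa> u by (intro mult_mono; simp)+
    then have "\<kappa> * u * \<delta> \<le> R * \<delta>" "\<kappa> * (1 - u) * \<delta> \<le> R * \<delta>" using \<delta> by (auto intro!: mult_right_mono)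
    then show "{x - \<kappa> * u * \<delta>..x + \<kappa> * (1 - u) * \<delta>} \<subseteq> {x - R * \<delta>..x + R * \<delta>}" by auto
  qed (use \<kappa> w in auto)
  finally show ?thesis .
qed


section \<open>Steklov averages of perturbed Sobolev functions\<close>

lemma abs_steklov_kernel_le:
  "\<bar>steklov_kernel r f x \<theta>\<bar> \<le> 2 ^ r * (\<Sum>m=1..r. \<bar>f (x + real m * \<theta>)\<bar>)"
  unfolding steklov_kernel_def sum_distrib_left
proof (rule order_trans[OF sum_abs], rule sum_mono)
  fix m
  have "real (r choose m) \<le> 2 ^ r"
    using binomial_le_pow2[of r m] by (simp flip: of_nat_le_iff)
  then show "\<bar>(-1) ^ (m + 1) * real (r choose m) * f (x + real m * \<theta>)\<bar> \<le> 2 ^ r * \<bar>f (x + real m * \<theta>)\<bar>"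
    by (simp add: abs_mult mult_right_mono)
qed

lemma abs_continuous_on_imp_continuous_on:
  assumes "abs_continuous_on {a..b} g"
  shows "continuous_on {a..b} g"
  unfolding continuous_on_iff
proof (intro ballI allI impI)
  fix x e :: real assume x: "x \<in> {a..b}" and e: "0 < e"
  obtain \<delta> where \<delta>: "0 < \<delta>" and *: "\<And>d. \<lbrakk>d division_of \<Union>d; \<Union>d \<subseteq> {a..b}; (\<Sum>k\<in>d. Sup k - Inf k) < \<delta>\<rbrakk> \<Longrightarrow>
      (\<Sum>k\<in>d. \<bar>g (Sup k) - g (Inf k)\<bar>) < e"
    by (rule abs_continuous_onE[OF assms e]) (rule that)
  have le: "\<bar>g z - g y\<bar> < e" if "a \<le> y" "y \<le> z" "z \<le> b" "z - y < \<delta>" for y z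
  proof -
    have "{{y..z}} division_of \<Union>{{y..z}}"
      using division_of_self[of y z] that by simp
    then show ?thesis using *[of "{{y..z}}"] that by simp
  qed
  show "\<exists>d>0. \<forall>y\<in>{a..b}. dist y x < d \<longrightarrow> dist (g y) (g x) < e"
  proof (intro exI[of _ \<delta>] conjI \<delta> ballI impI)
    fix y assume "y \<in> {a..b}" "dist y x < \<delta>"
    then show "dist (g y) (g x) < e"
      using le[of x y] le[of y x] x by (cases "x \<le> y") (auto simp: dist_real_def abs_minus_commute)
  qed
qed

lemma Sobolev_in_Lp_space:
  assumes "g \<in> Sobolev p a b s" "1 \<le> s" "1 \<le> p"
  shows "g \<in> Lp_space p {a..b}" "nth_deriv a b s g \<in> Lp_space p {a..b}"
proof -
  have "abs_continuous_on {a..b} (nth_deriv a b 0 g)"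
    using assms by (simp add: Sobolev_def)
  then have "continuous_on {a..b} g"
    using abs_continuous_on_imp_continuous_on by (simp add: nth_deriv_def)
  then show "g \<in> Lp_space p {a..b}" using assms by (intro continuous_on_imp_Lp_space)
  show "nth_deriv a b s g \<in> Lp_space p {a..b}" using assms by (simp add: Sobolev_def)
qed

lemma sliding_parameter_bounds:
  fixes a b x \<tau> \<delta> :: real
  assumes "a < b" "x \<in> {a..b}" "\<tau> \<in> {0..\<delta>}"
  shows "\<bar>\<tau> - (x - a) / (b - a) * \<delta>\<bar> \<le> \<delta>" "0 \<le> (x - a) / (b - a)" "(x - a) / (b - a) \<le> 1"
proof -
  define u where "u = (x - a) / (b - a)"
  show u: "0 \<le> (x - a) / (b - a)" "(x - a) / (b - a) \<le> 1" using assms by (auto simp: field_simps)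
  have "0 \<le> u * \<delta>" "u * \<delta> \<le> 1 * \<delta>"
    using u assms unfolding u_def[symmetric] by (auto intro!: mult_left_le_one_le)
  then show "\<bar>\<tau> - (x - a) / (b - a) * \<delta>\<bar> \<le> \<delta>"
    using assms unfolding u_def[symmetric] by auto
qed

text \<open>
  The combined form in which the sliding window is used: averaging over the window turns a bound for the kernel by
  values of \<open>w\<close> at \<open>x + \<kappa> * \<theta>\<close> into a bound by the mean of \<open>w\<close> near \<open>x\<close>, provided that \<open>\<kappa>\<close> stays away from 0.
\<close>
lemma abs_steklov_minus_le_window:
  fixes \<kappa> :: "'i \<Rightarrow> real"
  assumes ab: "a < b" and r: "1 \<le> r" and \<delta>: "0 < \<delta>" "\<delta> \<le> (b - a) / real r" and x: "x \<in> {a..b}"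
    and f0: "locally_integrable f0" "\<And>y. y \<in> {a..b} \<Longrightarrow> f0 y = f y"
    and w: "locally_integrable w" "\<And>t. 0 \<le> w t"
    and J: "finite J" "\<And>i. i \<in> J \<Longrightarrow> 1 / 2 \<le> \<kappa> i" "\<And>i. i \<in> J \<Longrightarrow> \<kappa> i \<le> real r" and A: "0 \<le> A"
    and bound: "\<And>\<tau>. \<tau> \<in> {0..\<delta>} \<Longrightarrow> \<bar>steklov_kernel r f0 x (\<tau> - (x - a) / (b - a) * \<delta>) - K\<bar>
      \<le> A * (\<Sum>i\<in>J. w (x + \<kappa> i * (\<tau> - (x - a) / (b - a) * \<delta>))) + B"
  shows "\<bar>steklov a b \<delta> r f x - K\<bar> \<le> real r / \<delta> *
    (A * (real (card J) * (2 * integral {x - real r * \<delta>..x + real r * \<delta>} w)) + \<delta> * B)"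
proof -
  define u where "u = (x - a) / (b - a)"
  define I where "I = integral {x - real r * \<delta>..x + real r * \<delta>} w"
  have I0: "0 \<le> I" unfolding I_def using locally_integrableD(2)[OF w(1)] w(2) by (intro integral_nonneg) auto
  have wi: "(\<lambda>\<tau>. w (x + \<kappa> i * (\<tau> - u * \<delta>))) integrable_on {0..\<delta>}" if "i \<in> J" for i
    using locally_integrableD(2)[OF locally_integrable_affine[OF w(1), of "\<kappa> i" "x - \<kappa> i * (u * \<delta>)"]] J(2)[OF that]
    by (simp add: algebra_simps)
  have wsum: "(\<lambda>\<tau>. A * (\<Sum>i\<in>J. w (x + \<kappa> i * (\<tau> - u * \<delta>)))) integrable_on {0..\<delta>}"
    by (intro integrable_on_mult_right integrable_sum J(1) wi)
  have le: "integral {0..\<delta>} (\<lambda>\<tau>. w (x + \<kappa> i * (\<tau> - u * \<delta>))) \<le> 2 * I" if i: "i \<in> J" for i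
  proof -
    have "integral {0..\<delta>} (\<lambda>\<tau>. w (x + \<kappa> i * (\<tau> - u * \<delta>))) \<le> I / \<kappa> i"
      unfolding I_def using J(2,3)[OF i] \<delta> sliding_parameter_bounds[OF ab x, of 0 \<delta>] w(2)
      by (intro integral_sliding_window_le locally_integrableD(2)[OF w(1)]) (auto simp: u_def)
    also have "\<dots> \<le> I / (1 / 2)" using J(2)[OF i] I0 by (intro divide_left_mono) auto
    finally show ?thesis by simp
  qed
  have "integral {0..\<delta>} (\<lambda>\<tau>. \<bar>steklov_kernel r f0 x (\<tau> - u * \<delta>) - K\<bar>)
      \<le> integral {0..\<delta>} (\<lambda>\<tau>. A * (\<Sum>i\<in>J. w (x + \<kappa> i * (\<tau> - u * \<delta>))) + B)"
  proof (rule integral_le)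
    show "(\<lambda>\<tau>. \<bar>steklov_kernel r f0 x (\<tau> - u * \<delta>) - K\<bar>) integrable_on {0..\<delta>}"
      by (intro locally_integrableD(3) locally_integrable_diff steklov_kernel_locally_integrable f0 locally_integrable_const)
    show "(\<lambda>\<tau>. A * (\<Sum>i\<in>J. w (x + \<kappa> i * (\<tau> - u * \<delta>))) + B) integrable_on {0..\<delta>}"
      by (intro integrable_add wsum integrable_const_ivl)
  qed (use bound in \<open>simp add: u_def\<close>)
  also have "\<dots> = A * (\<Sum>i\<in>J. integral {0..\<delta>} (\<lambda>\<tau>. w (x + \<kappa> i * (\<tau> - u * \<delta>)))) + \<delta> * B"
    using \<delta>(1) integral_sum[OF J(1) wi] by (simp add: integral_add[OF wsum integrable_const_ivl])
  also have "\<dots> \<le> A * (\<Sum>i\<in>J. 2 * I) + \<delta> * B"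
    by (intro add_right_mono mult_left_mono sum_mono le A)
  finally have "integral {0..\<delta>} (\<lambda>\<tau>. \<bar>steklov_kernel r f0 x (\<tau> - u * \<delta>) - K\<bar>) \<le> A * (real (card J) * (2 * I)) + \<delta> * B"
    by simp
  then have "real r / \<delta> * integral {0..\<delta>} (\<lambda>\<tau>. \<bar>steklov_kernel r f0 x (\<tau> - u * \<delta>) - K\<bar>)
      \<le> real r / \<delta> * (A * (real (card J) * (2 * I)) + \<delta> * B)"
    using \<delta> by (intro mult_left_mono) auto
  then show ?thesis
    using abs_steklov_diff_le[OF ab r \<delta> x f0, of K] unfolding u_def I_def by linarith
qed

text \<open>
  The kernel reproduces \<open>g x\<close> up to a difference of \<open>g\<close> of order \<open>r\<close>, which is of the order
  \<open>\<delta> ^ (s - 1)\<close> times the integral of the \<open>s\<close>-th derivative; the perturbation \<open>f - g\<close> contributes its mean.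
\<close>
lemma abs_steklov_minus_Sobolev_le:
  fixes f g :: "real \<Rightarrow> real"
  assumes ab: "a < b" and s: "1 \<le> s" "s \<le> r" and p: "1 \<le> p" and \<delta>: "0 < \<delta>" "\<delta> \<le> (b - a) / real r"
    and f: "f \<in> Lp_space p {a..b}" and g: "g \<in> Sobolev p a b s" and x: "x \<in> {a..b}"
  defines "v \<equiv> nth_deriv a b s g"
  shows "\<bar>steklov a b \<delta> r f x - g x\<bar> \<le> real r * (2 ^ r * (real (r + 1) * 2)) * (1 / \<delta>) *
    integral {x - real r * \<delta>..x + real r * \<delta>} (\<lambda>t. \<bar>restrict_zero a b (\<lambda>t. \<bar>f t - g t\<bar> + \<delta> ^ s * \<bar>v t\<bar>) t\<bar>)"
proof -
  define u where "u = (x - a) / (b - a)"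
  define F where "F = restrict_zero a b (\<lambda>t. f t - g t)"
  define f0 where "f0 = restrict_zero a b f"
  define v0 where "v0 = restrict_zero a b v"
  let ?W = "{x - real r * \<delta>..x + real r * \<delta>}"
  define V where "V = integral ?W (\<lambda>t. \<bar>v0 t\<bar>)"
  define FW where "FW = integral ?W (\<lambda>t. \<bar>F t\<bar>)"
  have r: "1 \<le> r" using s by simp
  have Lp: "g \<in> Lp_space p {a..b}" "v \<in> Lp_space p {a..b}"
    using Sobolev_in_Lp_space[OF g s(1) p] by (auto simp: v_def)
  have lF: "locally_integrable F" and lf: "locally_integrable f0" and lv: "locally_integrable v0"
    unfolding F_def f0_def v0_def
    using f p Lp by (auto intro!: restrict_zero_locally_integrable Lp_space_absolutely_integrable[of _ p] Lp_space_diff)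
  have V0: "0 \<le> V" and FW0: "0 \<le> FW"
    unfolding V_def FW_def using locally_integrableD lv lF by (auto intro!: integral_nonneg)
  have bound: "\<bar>steklov_kernel r f0 x (\<tau> - u * \<delta>) - g x\<bar>
      \<le> 2 ^ r * (\<Sum>m\<in>{1..r}. \<bar>F (x + real m * (\<tau> - u * \<delta>))\<bar>) + 2 ^ r * real (r + 1) * \<delta> ^ (s - 1) * V" if \<tau>: "\<tau> \<in> {0..\<delta>}" for \<tau>
  proof -
    define \<theta> where "\<theta> = \<tau> - u * \<delta>"
    have \<theta>: "\<bar>\<theta>\<bar> \<le> \<delta>" using sliding_parameter_bounds[OF ab x \<tau>] by (simp add: \<theta>_def u_def)
    have mem: "x + real m * \<theta> \<in> {a..b}" and memW: "x + real m * \<theta> \<in> ?W" if "m \<le> r" for m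
    proof -
      have m: "real m * \<delta> \<le> real r * \<delta>" using that \<delta> by simp
      also have "\<dots> \<le> b - a" using \<delta> r by (simp add: field_simps)
      finally show "x + real m * \<theta> \<in> {a..b}"
        unfolding \<theta>_def u_def using sliding_window_mem[OF ab _ _ x \<tau>] by simp
      have "\<bar>real m * \<theta>\<bar> \<le> real m * \<delta>" using \<theta> by (simp add: abs_mult mult_left_mono)
      then show "x + real m * \<theta> \<in> ?W" using m by auto
    qed
    have "steklov_kernel r f0 x \<theta> - steklov_kernel r g x \<theta> = steklov_kernel r F x \<theta>"
      unfolding steklov_kernel_def sum_subtractf[symmetric]
    proof (intro sum.cong refl)
      fix m assume "m \<in> {1..r}"
      then have "x + real m * \<theta> \<in> {a..b}" by (intro mem) simp
      then show "(-1) ^ (m + 1) * real (r choose m) * f0 (x + real m * \<theta>) - (-1) ^ (m + 1) * real (r choose m) * g (x + real m * \<theta>)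
          = (-1) ^ (m + 1) * real (r choose m) * F (x + real m * \<theta>)"
        unfolding F_def f0_def by (simp only: restrict_zero_in right_diff_distrib)
    qed
    then have "steklov_kernel r f0 x \<theta> - g x = steklov_kernel r F x \<theta> - (-1) ^ r * fwd_diff r \<theta> g x"
      using steklov_kernel_eq[of r g x \<theta>] by simp
    then have "\<bar>steklov_kernel r f0 x \<theta> - g x\<bar> \<le> \<bar>steklov_kernel r F x \<theta>\<bar> + \<bar>fwd_diff r \<theta> g x\<bar>"
      using abs_triangle_ineq4[of "steklov_kernel r F x \<theta>" "(-1) ^ r * fwd_diff r \<theta> g x"] by (simp add: abs_mult)
    moreover have "\<bar>fwd_diff r \<theta> g x\<bar> \<le> 2 ^ r * real (r + 1) * \<delta> ^ (s - 1) * V"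
    proof -
      have "\<bar>fwd_diff s \<theta> g (x + real i * \<theta>)\<bar> \<le> \<delta> ^ (s - 1) * V" if "i \<in> {0..r - s}" for i
      proof -
        have eq: "x + real i * \<theta> + real s * \<theta> = x + real (i + s) * \<theta>" by (simp add: algebra_simps)
        have "\<bar>fwd_diff s \<theta> g (x + real i * \<theta>)\<bar> \<le> \<bar>\<theta>\<bar> ^ (s - 1) * V"
          unfolding V_def v0_def v_def using that s
          by (intro Sobolev_abs_fwd_diff_le_signed[OF p s(1) g] mem memW; (unfold eq)?; (intro mem memW)?; simp)
        also have "\<dots> \<le> \<delta> ^ (s - 1) * V"
          using \<theta> V0 by (intro mult_right_mono power_mono) auto
        finally show ?thesis .
      qed
      then have "(\<Sum>i=0..r - s. \<bar>fwd_diff s \<theta> g (x + real i * \<theta>)\<bar>) \<le> (\<Sum>i=0..r - s. \<delta> ^ (s - 1) * V)"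
        by (intro sum_mono)
      also have "\<dots> = real (r - s + 1) * (\<delta> ^ (s - 1) * V)" by simp
      also have "\<dots> \<le> real (r + 1) * (\<delta> ^ (s - 1) * V)"
        using V0 \<delta> by (intro mult_right_mono) auto
      finally have "2 ^ (r - s) * (\<Sum>i=0..r - s. \<bar>fwd_diff s \<theta> g (x + real i * \<theta>)\<bar>) \<le> 2 ^ r * (real (r + 1) * (\<delta> ^ (s - 1) * V))"
        by (intro mult_mono power_increasing) (auto intro!: sum_nonneg)
      moreover have "\<bar>fwd_diff r \<theta> g x\<bar> \<le> 2 ^ (r - s) * (\<Sum>i=0..r - s. \<bar>fwd_diff s \<theta> g (x + real i * \<theta>)\<bar>)"
        using abs_fwd_diff_add_le[of s "r - s" \<theta> g x] s by simp
      ultimately show ?thesis by (simp add: mult.assoc)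
    qed
    ultimately show ?thesis
      using abs_steklov_kernel_le[of r F x \<theta>] unfolding \<theta>_def[symmetric] by linarith
  qed
  have "\<bar>steklov a b \<delta> r f x - g x\<bar> \<le> real r / \<delta> *
      (2 ^ r * (real (card {1..r}) * (2 * FW)) + \<delta> * (2 ^ r * real (r + 1) * \<delta> ^ (s - 1) * V))"
    unfolding FW_def
    by (rule abs_steklov_minus_le_window[OF ab r \<delta> x lf _ locally_integrable_abs[OF lF], where \<kappa> = real])
      (use bound in \<open>auto simp: f0_def u_def\<close>)
  also have "\<dots> = real r / \<delta> * (2 ^ r * (real r * 2 * FW + real (r + 1) * (\<delta> ^ s * V)))"
  proof -
    have "\<delta> ^ s = \<delta> * \<delta> ^ (s - 1)" using s(1) by (simp add: power_eq_if)
    then show ?thesis by (simp add: algebra_simps)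
  qed
  also have "\<dots> \<le> real r / \<delta> * (2 ^ r * (real (r + 1) * 2 * FW + real (r + 1) * 2 * (\<delta> ^ s * V)))"
    using FW0 V0 \<delta> by (intro mult_left_mono add_mono mult_right_mono) auto
  also have "\<dots> = real r * (2 ^ r * (real (r + 1) * 2)) * (1 / \<delta>) * (FW + \<delta> ^ s * V)"
    by (simp add: field_simps)
  also have "FW + \<delta> ^ s * V = integral ?W (\<lambda>t. \<bar>F t\<bar> + \<delta> ^ s * \<bar>v0 t\<bar>)"
    unfolding FW_def V_def using locally_integrableD(3) lF lv
    by (subst integral_add) (auto intro!: integrable_on_mult_right)
  also have "(\<lambda>t. \<bar>F t\<bar> + \<delta> ^ s * \<bar>v0 t\<bar>) = (\<lambda>t. \<bar>restrict_zero a b (\<lambda>t. \<bar>f t - g t\<bar> + \<delta> ^ s * \<bar>v t\<bar>) t\<bar>)"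
    using \<delta> by (auto simp: F_def v0_def restrict_zero_def fun_eq_iff)
  finally show ?thesis .
qed

lemma Lp_norm_cmult:
  assumes "1 \<le> p"
  shows "Lp_norm p {c..d} (\<lambda>x. K * u x) = \<bar>K\<bar> * Lp_norm p {c..d} u"
proof -
  have "Lp_norm p {c..d} (\<lambda>x. K * u x) = (\<bar>K\<bar> powr p * integral {c..d} (\<lambda>x. \<bar>u x\<bar> powr p)) powr (1 / p)"
    unfolding Lp_norm_eq abs_mult powr_mult[of "\<bar>K\<bar>"] by simp
  also have "\<dots> = \<bar>K\<bar> * Lp_norm p {c..d} u"
  proof -
    have "(\<bar>K\<bar> powr p) powr (1 / p) = \<bar>K\<bar>" using assms by (simp add: powr_powr)
    then show ?thesis unfolding Lp_norm_eq powr_mult[of "\<bar>K\<bar> powr p"] by (simp only:)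
  qed
  finally show ?thesis .
qed

lemma Lp_space_cmult_abs:
  assumes "u \<in> Lp_space p {c..d}"
  shows "(\<lambda>x. K * \<bar>u x\<bar>) \<in> Lp_space p {c..d}"
  using assms unfolding Lp_space_iff abs_mult powr_mult
  by (auto intro!: integrable_on_mult_right)

lemma Lp_space_add:
  assumes "u \<in> Lp_space p {c..d}" "v \<in> Lp_space p {c..d}" "1 \<le> p"
  shows "(\<lambda>x. u x + v x) \<in> Lp_space p {c..d}"
proof -
  have "(\<lambda>x. - v x) \<in> Lp_space p {c..d}" using assms by (auto simp: Lp_space_iff)
  then show ?thesis using Lp_space_diff[of u p c d "\<lambda>x. - v x"] assms by simp
qed

lemma lp_seminorm_steklov_minus_Sobolev_le:
  fixes x :: "nat \<Rightarrow> real"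
  assumes ab: "a < b" and s: "1 \<le> s" "s \<le> r" and p: "1 \<le> p" and \<gamma>: "0 < \<gamma>" "\<gamma> \<le> 1" and n: "1 \<le> n"
    and \<delta>: "\<gamma> / real n \<le> (b - a) / real r"
    and x: "\<And>k. k \<le> n \<Longrightarrow> x k \<in> {a..b}" and sp: "\<And>k. k < n \<Longrightarrow> x k + \<gamma> / real n \<le> x (Suc k)"
    and f: "f \<in> Lp_space p {a..b}" and g: "g \<in> Sobolev p a b s"
  shows "lp_seminorm p a b n x (\<lambda>y. steklov a b (\<gamma> / real n) r f y - g y)
    \<le> 2 * real r * (1 + 2 * (b - a) / \<gamma>) * (real r * (2 ^ r * (real (r + 1) * 2))) * 4 *
      (Lp_norm p {a..b} (\<lambda>y. f y - g y) + real n powi (- int s) * Lp_norm p {a..b} (nth_deriv a b s g))"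
proof -
  define v where "v = nth_deriv a b s g"
  define w where "w = (\<lambda>t. \<bar>f t - g t\<bar> + (\<gamma> / real n) ^ s * \<bar>v t\<bar>)"
  define C where "C = 2 * real r * (1 + 2 * (b - a) / \<gamma>) * (real r * (2 ^ r * (real (r + 1) * 2)))"
  have C: "0 \<le> C" using ab \<gamma> by (simp add: C_def)
  have v: "v \<in> Lp_space p {a..b}" and fg: "(\<lambda>t. f t - g t) \<in> Lp_space p {a..b}"
    using Sobolev_in_Lp_space[OF g s(1) p] f p by (auto simp: v_def intro!: Lp_space_diff)
  have w: "w \<in> Lp_space p {a..b}"
    unfolding w_def using Lp_space_cmult_abs[OF fg, of 1] p v
    by (intro Lp_space_add Lp_space_cmult_abs) auto
  have le: "lp_seminorm p a b n x (\<lambda>y. steklov a b (\<gamma> / real n) r f y - g y) \<le> C * Lp_norm p {a..b} w"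
    unfolding C_def
  proof (rule lp_seminorm_window_le[where x = x and n = n and \<gamma> = \<gamma>, OF ab p n \<gamma>(1) _ sp w])
    fix k assume k: "k \<le> n"
    show "\<bar>steklov a b (\<gamma> / real n) r f (x k) - g (x k)\<bar> \<le> real r * (2 ^ r * (real (r + 1) * 2)) * (real n / \<gamma>) *
       integral {x k - real r * (\<gamma> / real n)..x k + real r * (\<gamma> / real n)} (\<lambda>t. \<bar>restrict_zero a b w t\<bar>)"
      using abs_steklov_minus_Sobolev_le[OF ab s p _ \<delta> f g x[OF k]] n \<gamma>
      unfolding w_def v_def by simp
  qed (use s in auto)
  have "Lp_norm p {a..b} w \<le> 4 * (Lp_norm p {a..b} (\<lambda>t. f t - g t) + Lp_norm p {a..b} (\<lambda>t. (\<gamma> / real n) ^ s * \<bar>v t\<bar>))"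
    using p fg v \<gamma> by (intro Lp_norm_add_le Lp_space_cmult_abs) (auto simp: w_def)
  also have "Lp_norm p {a..b} (\<lambda>t. (\<gamma> / real n) ^ s * \<bar>v t\<bar>) = (\<gamma> / real n) ^ s * Lp_norm p {a..b} v"
    using p \<gamma> Lp_norm_cmult[of p a b "(\<gamma> / real n) ^ s" "\<lambda>t. \<bar>v t\<bar>"] by (simp add: Lp_norm_eq[of p a b "\<lambda>t. \<bar>v t\<bar>"] Lp_norm_eq[of p a b v])
  also have "\<dots> \<le> real n powi (- int s) * Lp_norm p {a..b} v"
  proof (rule mult_right_mono)
    have "(\<gamma> / real n) ^ s \<le> (1 / real n) ^ s" using \<gamma> by (intro power_mono divide_right_mono) auto
    then show "(\<gamma> / real n) ^ s \<le> real n powi (- int s)"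
      by (simp add: power_int_minus power_one_over inverse_eq_divide)
  qed simp
  finally have "Lp_norm p {a..b} w \<le> 4 * (Lp_norm p {a..b} (\<lambda>t. f t - g t) + real n powi (- int s) * Lp_norm p {a..b} v)"
    by simp
  from order_trans[OF le mult_left_mono[OF this C]] show ?thesis
    unfolding C_def v_def by (simp only: mult.assoc)
qed

section \<open>Moduli of smoothness of perturbed Sobolev functions\<close>

lemma Lp_norm_le_of_integral_le:
  assumes p: "1 \<le> p" and B: "0 \<le> B" and w: "w integrable_on {c..d}" "integral {c..d} w \<le> B powr p"
    and le: "\<And>x. x \<in> {c..d} \<Longrightarrow> \<bar>z x\<bar> powr p \<le> w x"
  shows "Lp_norm p {c..d} z \<le> B"
proof (cases "(\<lambda>x. \<bar>z x\<bar> powr p) integrable_on {c..d}")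
  case True
  then have "integral {c..d} (\<lambda>x. \<bar>z x\<bar> powr p) \<le> integral {c..d} w"
    by (intro integral_le w le)
  then show ?thesis using p B w by (simp add: Lp_norm_le_iff)
next
  case False
  then show ?thesis using p B by (simp add: Lp_norm_eq not_integrable_integral)
qed

text \<open>
  A Fubini identity in disguise, obtained from the antiderivative \<open>V\<close> of \<open>w\<close>:
  the integral of \<open>V (x + L) - V x\<close> telescopes.
\<close>
lemma integral_sliding_integral_le:
  fixes w :: "real \<Rightarrow> real"
  assumes w: "\<And>c d. w integrable_on {c..d}" "\<And>t. 0 \<le> w t" "\<And>c d. integral {c..d} w \<le> B" and L: "0 \<le> L"
  shows "(\<lambda>x. integral {x..x + L} w) integrable_on {\<alpha>..\<beta>}"
    "integral {\<alpha>..\<beta>} (\<lambda>x. integral {x..x + L} w) \<le> L * B"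
proof -
  define V where "V x = integral {\<alpha>..x} w" for x
  have V: "continuous_on {c..d} V" if "\<alpha> \<le> c" for c d
    unfolding V_def using that
    by (rule_tac continuous_on_subset[OF indefinite_integral_continuous_1[OF w(1), of \<alpha> "max c d"]]) auto
  have iV: "V integrable_on {c..d}" if "\<alpha> \<le> c" for c d
    using V[OF that] by (rule integrable_continuous_real)
  have iVL: "(\<lambda>x. V (x + L)) integrable_on {\<alpha>..\<beta>}"
    using integrable_affine_real[of V 1 \<alpha> L \<beta>] iV L by simp
  have eq: "integral {x..x + L} w = V (x + L) - V x" if "\<alpha> \<le> x" for x
    using Henstock_Kurzweil_Integration.integral_combine[of \<alpha> x "x + L" w] that L w by (simp add: V_def)
  have i: "(\<lambda>x. V (x + L) - V x) integrable_on {\<alpha>..\<beta>}"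
    by (intro integrable_diff iVL iV) simp
  then show "(\<lambda>x. integral {x..x + L} w) integrable_on {\<alpha>..\<beta>}"
    by (rule integrable_eq) (simp add: eq)
  have B: "0 \<le> B" using w(3)[of 1 0] by simp
  show "integral {\<alpha>..\<beta>} (\<lambda>x. integral {x..x + L} w) \<le> L * B"
  proof (cases "\<alpha> \<le> \<beta>")
    case True
    have "integral {\<alpha>..\<beta>} (\<lambda>x. integral {x..x + L} w) = integral {\<alpha>..\<beta>} (\<lambda>x. V (x + L) - V x)"
      by (intro integral_cong) (simp add: eq)
    also have "\<dots> = integral {\<alpha>..\<beta>} (\<lambda>x. V (x + L)) - integral {\<alpha>..\<beta>} V"
      by (intro integral_diff iVL iV) simp
    also have "integral {\<alpha>..\<beta>} (\<lambda>x. V (x + L)) = integral {\<alpha> + L..\<beta> + L} V"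
      using integral_affine_real[of 1 \<alpha> \<beta> V L] by simp
    also have "\<dots> - integral {\<alpha>..\<beta>} V = integral {\<beta>..\<beta> + L} V - integral {\<alpha>..\<alpha> + L} V"
      using Henstock_Kurzweil_Integration.integral_combine[of \<alpha> \<beta> "\<beta> + L" V]
        Henstock_Kurzweil_Integration.integral_combine[of \<alpha> "\<alpha> + L" "\<beta> + L" V] True L iV[of \<alpha>] by simp
    also have "integral {\<alpha>..\<alpha> + L} V \<ge> 0"
      using iV[of \<alpha>] w by (intro integral_nonneg) (auto simp: V_def intro!: integral_nonneg)
    then have "integral {\<beta>..\<beta> + L} V - integral {\<alpha>..\<alpha> + L} V \<le> integral {\<beta>..\<beta> + L} V" by simp
    also have "\<dots> \<le> integral {\<beta>..\<beta> + L} (\<lambda>_. B)"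
      using True w(3) by (intro integral_le iV) (auto simp: V_def)
    finally show ?thesis using L by simp
  qed (use B L in simp)
qed

text \<open>
  Split \<open>f\<close> into \<open>f - g\<close> and \<open>g\<close>. For \<open>f - g\<close> the nodes are estimated separately; for \<open>g\<close> the sliding integral
  is estimated by Jensen's inequality and \<open>integral_sliding_integral_le\<close>. The hypothesis on \<open>g\<close> is the one that
  Sobolev functions satisfy; the case \<open>g = 0\<close> shows that the modulus of smoothness is finite.
\<close>
lemma Lp_norm_fwd_diff_le:
  fixes f g v :: "real \<Rightarrow> real"
  assumes p: "1 \<le> p" and s: "1 \<le> s" and h: "0 < h"
    and F: "(\<lambda>x. f x - g x) \<in> Lp_space p {a..b}" and v: "v \<in> Lp_space p {a..b}"
    and g: "\<And>x. a \<le> x \<Longrightarrow> x + real s * h \<le> b \<Longrightarrow>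
      \<bar>fwd_diff s h g x\<bar> \<le> h ^ (s - 1) * integral {x..x + real s * h} (\<lambda>t. \<bar>restrict_zero a b v t\<bar>)"
  shows "Lp_norm p {a..b - real s * h} (fwd_diff s h f)
    \<le> 4 * (2 ^ s * real (s + 1) * real (s + 1) * Lp_norm p {a..b} (\<lambda>x. f x - g x) + real s * h ^ s * Lp_norm p {a..b} v)"
proof -
  define L where "L = real s * h"
  have L: "0 < L" using s h by (simp add: L_def)
  define A where "A = Lp_norm p {a..b} (\<lambda>x. f x - g x)"
  define N where "N = Lp_norm p {a..b} v"
  have AN: "0 \<le> A" "0 \<le> N" "integral {a..b} (\<lambda>x. \<bar>f x - g x\<bar> powr p) = A powr p" "integral {a..b} (\<lambda>x. \<bar>v x\<bar> powr p) = N powr p"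
    using p by (auto simp: A_def N_def Lp_norm_powr)
  have Fp: "(\<lambda>x. \<bar>f x - g x\<bar> powr p) integrable_on {a..b}" and vp: "(\<lambda>x. \<bar>v x\<bar> powr p) integrable_on {a..b}"
    using F v by (auto simp: Lp_space_iff)
  define F0 where "F0 = restrict_zero a b (\<lambda>x. \<bar>f x - g x\<bar> powr p)"
  define v0 where "v0 = restrict_zero a b (\<lambda>x. \<bar>v x\<bar> powr p)"
  have F0: "F0 integrable_on {c..d}" "integral {c..d} F0 \<le> A powr p" "0 \<le> F0 t" for c d t
    unfolding F0_def using restrict_zero_integral[OF Fp, of c d] AN by (auto simp: restrict_zero_def)
  have v0: "v0 integrable_on {c..d}" "integral {c..d} v0 \<le> N powr p" "0 \<le> v0 t" for c d t
    unfolding v0_def using restrict_zero_integral[OF vp, of c d] AN by (auto simp: restrict_zero_def)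
  have lv: "locally_integrable (restrict_zero a b v)"
    using v p by (intro restrict_zero_locally_integrable Lp_space_absolutely_integrable)
  define c1 where "c1 = (2 ^ s) powr p * real (s + 1) powr p"
  define c2 where "c2 = (real s * h ^ s) powr p"
  define W where "W x = 2 powr p * (c1 * (\<Sum>i=0..s. F0 (x + real i * h)) + c2 * (integral {x..x + L} v0 / L))" for x
  have F0i: "(\<lambda>x. F0 (x + real i * h)) integrable_on {c..d}" "integral {c..d} (\<lambda>x. F0 (x + real i * h)) \<le> A powr p" for c d i
    using integrable_affine_real[of F0 1 c "real i * h" d] integral_affine_real[of 1 c d F0 "real i * h"] F0 by auto
  have V: "(\<lambda>x. integral {x..x + L} v0) integrable_on {c..d}" "integral {c..d} (\<lambda>x. integral {x..x + L} v0) \<le> L * N powr p" for c d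
    using L by (auto intro!: integral_sliding_integral_le v0)
  have i1: "(\<lambda>x. c1 * (\<Sum>i=0..s. F0 (x + real i * h))) integrable_on {a..b - L}"
    by (intro integrable_on_mult_right integrable_sum F0i) auto
  have i2: "(\<lambda>x. c2 * (integral {x..x + L} v0 / L)) integrable_on {a..b - L}"
    unfolding divide_inverse by (intro integrable_on_mult_right integrable_on_mult_left V)
  show ?thesis
    unfolding L_def[symmetric] A_def[symmetric] N_def[symmetric]
  proof (rule Lp_norm_le_of_integral_le[OF p])
    show "W integrable_on {a..b - L}"
      unfolding W_def by (intro integrable_on_mult_right integrable_add i1 i2)
    have "integral {a..b - L} W = 2 powr p * (c1 * (\<Sum>i=0..s. integral {a..b - L} (\<lambda>x. F0 (x + real i * h)))
        + c2 * (integral {a..b - L} (\<lambda>x. integral {x..x + L} v0) / L))"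
      unfolding W_def using i1 i2 F0i by (simp add: integral_add integral_sum)
    also have "\<dots> \<le> 2 powr p * (c1 * (\<Sum>i=0..s. A powr p) + c2 * (L * N powr p / L))"
      using L by (intro mult_left_mono add_mono sum_mono F0i divide_right_mono V) (auto simp: c1_def c2_def)
    also have "\<dots> = 2 powr p * ((2 ^ s * real (s + 1) * A) powr p * real (s + 1) + (real s * h ^ s * N) powr p)"
      using L unfolding c1_def c2_def powr_mult by simp
    also have "\<dots> \<le> 2 powr p * ((2 ^ s * real (s + 1) * A) powr p * real (s + 1) powr p + (real s * h ^ s * N) powr p)"
      using powr_mono[of 1 p "real (s + 1)"] p by (intro mult_left_mono add_mono order_refl) auto
    also have "\<dots> = 2 powr p * ((2 ^ s * real (s + 1) * real (s + 1) * A) powr p + (real s * h ^ s * N) powr p)"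
      unfolding powr_mult by (simp add: mult_ac)
    also have "\<dots> \<le> (4 * (2 ^ s * real (s + 1) * real (s + 1) * A + real s * h ^ s * N)) powr p"
      using p AN h by (intro powr_add_le_add_powr) auto
    finally show "integral {a..b - L} W \<le> (4 * (2 ^ s * real (s + 1) * real (s + 1) * A + real s * h ^ s * N)) powr p" .
    fix x assume x: "x \<in> {a..b - L}"
    have mem: "x + real i * h \<in> {a..b}" if "i \<in> {0..s}" for i
    proof -
      have "real i * h \<le> L" "0 \<le> real i * h" using that h by (auto simp: L_def)
      then show ?thesis using x by auto
    qed
    have "\<bar>fwd_diff s h f x\<bar> \<le> \<bar>fwd_diff s h (\<lambda>x. f x - g x) x\<bar> + \<bar>fwd_diff s h g x\<bar>"
      by (simp add: fwd_diff_diff)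
    then have "\<bar>fwd_diff s h f x\<bar> powr p \<le> (\<bar>fwd_diff s h (\<lambda>x. f x - g x) x\<bar> + \<bar>fwd_diff s h g x\<bar>) powr p"
      using p by (intro powr_mono2) auto
    also have "\<dots> \<le> 2 powr p * (\<bar>fwd_diff s h (\<lambda>x. f x - g x) x\<bar> powr p + \<bar>fwd_diff s h g x\<bar> powr p)"
      using p by (intro powr_add_le) auto
    also have "\<dots> \<le> W x"
      unfolding W_def
    proof (intro mult_left_mono add_mono)
      have "\<bar>fwd_diff s h (\<lambda>x. f x - g x) x\<bar> powr p
          \<le> (2 ^ s) powr p * (real (s + 1) powr p * (\<Sum>i=0..s. \<bar>f (x + real i * h) - g (x + real i * h)\<bar> powr p))"
        using p abs_fwd_diff_powr_le[of p s h "\<lambda>x. f x - g x" x] by simp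
      also have "(\<Sum>i=0..s. \<bar>f (x + real i * h) - g (x + real i * h)\<bar> powr p) = (\<Sum>i=0..s. F0 (x + real i * h))"
        by (intro sum.cong refl) (simp add: F0_def mem del: atLeastAtMost_iff)
      finally show "\<bar>fwd_diff s h (\<lambda>x. f x - g x) x\<bar> powr p \<le> c1 * (\<Sum>i=0..s. F0 (x + real i * h))"
        by (simp add: c1_def)
      let ?I = "integral {x..x + L} (\<lambda>t. \<bar>restrict_zero a b v t\<bar>)"
      have "h ^ s = h * h ^ (s - 1)" using s by (metis Suc_le_eq power_eq_if less_numeral_extra(3) One_nat_def)
      then have "\<bar>fwd_diff s h g x\<bar> \<le> real s * h ^ s * (?I / L)"
        using g[of x] x h s by (simp add: L_def)
      then have "\<bar>fwd_diff s h g x\<bar> powr p \<le> c2 * (?I / L) powr p"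
        using p powr_mono2[of p "\<bar>fwd_diff s h g x\<bar>" "real s * h ^ s * (?I / L)"]
        unfolding c2_def powr_mult[of "real s * h ^ s"] by simp
      also have "(?I / L) powr p \<le> integral {x..x + L} v0 / L"
      proof -
        have "v0 = (\<lambda>t. \<bar>restrict_zero a b v t\<bar> powr p)"
          using p by (simp add: v0_def restrict_zero_def fun_eq_iff)
        then show ?thesis
          using mean_powr_le[OF p, of x "x + L" "\<lambda>t. \<bar>restrict_zero a b v t\<bar>"] L v0(1)[of x "x + L"] locally_integrableD(3)[OF lv]
          by simp
      qed
      finally show "\<bar>fwd_diff s h g x\<bar> powr p \<le> c2 * (integral {x..x + L} v0 / L)"
        by (simp add: c2_def mult_left_mono)
    qed auto
    finally show "\<bar>fwd_diff s h f x\<bar> powr p \<le> W x" .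
  qed (use AN h in auto)
qed

text \<open>
  The modulus is a supremum of reals, which is meaningful only for sets that are bounded above.
\<close>
lemma Lp_norm_fwd_diff_bdd_above:
  assumes "1 \<le> p" "1 \<le> s" "f \<in> Lp_space p {a..b}"
  shows "bdd_above ((\<lambda>h. Lp_norm p {a..b - real s * h} (fwd_diff s h f)) ` {0<..\<delta>})"
proof (rule bdd_aboveI2)
  fix h assume "h \<in> {0<..\<delta>}"
  have zero: "(\<lambda>x. 0) \<in> Lp_space p {a..b}" using assms by (intro continuous_on_imp_Lp_space) auto
  have z: "fwd_diff k h (\<lambda>x. 0) x = 0" for k x by (simp add: fwd_diff_def)
  show "Lp_norm p {a..b - real s * h} (fwd_diff s h f)
      \<le> 4 * (2 ^ s * real (s + 1) * real (s + 1) * Lp_norm p {a..b} f)"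
    using Lp_norm_fwd_diff_le[of p s h f "\<lambda>x. 0" a b "\<lambda>x. 0"] assms zero \<open>h \<in> _\<close>
    by (simp add: z restrict_zero_def Lp_norm_eq[of p a b "\<lambda>x. 0"])
qed

lemma Lp_norm_fwd_diff_le_modulus:
  assumes "1 \<le> p" "1 \<le> s" "f \<in> Lp_space p {a..b}" "0 < h" "h \<le> \<delta>"
  shows "Lp_norm p {a..b - real s * h} (fwd_diff s h f) \<le> modulus p a b s f \<delta>"
  unfolding modulus_def
  using assms by (intro cSUP_upper Lp_norm_fwd_diff_bdd_above) auto

lemma modulus_le_Sobolev:
  assumes p: "1 \<le> p" and s: "1 \<le> s" and n: "1 \<le> n"
    and f: "f \<in> Lp_space p {a..b}" and g: "g \<in> Sobolev p a b s"
  shows "modulus p a b s f (1 / real n) \<le> 4 * (2 ^ s * real (s + 1) * real (s + 1)) *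
    (Lp_norm p {a..b} (\<lambda>y. f y - g y) + real n powi (- int s) * Lp_norm p {a..b} (nth_deriv a b s g))"
  unfolding modulus_def
proof (rule cSUP_least)
  fix h assume h: "h \<in> {0<..1 / real n}"
  define A where "A = Lp_norm p {a..b} (\<lambda>y. f y - g y)"
  define N where "N = Lp_norm p {a..b} (nth_deriv a b s g)"
  have AN: "0 \<le> A" "0 \<le> N" by (auto simp: A_def N_def)
  define c where "c = 2 ^ s * real (s + 1) * real (s + 1)"
  have c: "real s \<le> c"
  proof -
    have "1 * 1 * real s \<le> 2 ^ s * real (s + 1) * real (s + 1)" by (intro mult_mono) auto
    then show ?thesis by (simp add: c_def)
  qed
  have "Lp_norm p {a..b - real s * h} (fwd_diff s h f) \<le> 4 * (c * A + real s * h ^ s * N)"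
    unfolding A_def N_def c_def
    using Sobolev_in_Lp_space[OF g s p] f p h
    by (intro Lp_norm_fwd_diff_le Lp_space_diff Sobolev_abs_fwd_diff_le[OF p s g] s) auto
  also have "real s * h ^ s * N \<le> c * (1 / real n) ^ s * N"
    using h c AN by (intro mult_right_mono mult_mono power_mono) auto
  also have "(1 / real n) ^ s = real n powi (- int s)"
    by (simp add: power_int_minus power_one_over inverse_eq_divide)
  finally have "Lp_norm p {a..b - real s * h} (fwd_diff s h f) \<le> 4 * (c * A + c * real n powi (- int s) * N)"
    by simp
  also have "\<dots> = 4 * c * (A + real n powi (- int s) * N)" by (simp add: algebra_simps)
  finally show "Lp_norm p {a..b - real s * h} (fwd_diff s h f) \<le> 4 * (2 ^ s * real (s + 1) * real (s + 1)) *
    (Lp_norm p {a..b} (\<lambda>y. f y - g y) + real n powi (- int s) * Lp_norm p {a..b} (nth_deriv a b s g))"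
    by (simp only: A_def N_def c_def)
qed (use n in auto)


section \<open>Smooth functions are Sobolev functions\<close>

lemma lipschitz_imp_abs_continuous_on:
  assumes M: "\<And>x y. x \<in> {a..b} \<Longrightarrow> y \<in> {a..b} \<Longrightarrow> \<bar>g x - g y\<bar> \<le> M * \<bar>x - y\<bar>"
  shows "abs_continuous_on {a..b} g"
  unfolding abs_continuous_on_def
proof (intro allI impI)
  fix e :: real assume e: "0 < e"
  define \<delta> where "\<delta> = e / (\<bar>M\<bar> + 1)"
  show "\<exists>\<delta>>0. \<forall>d. d division_of \<Union>d \<and> \<Union>d \<subseteq> {a..b} \<and> (\<Sum>k\<in>d. Sup k - Inf k) < \<delta> \<longrightarrow>
      (\<Sum>k\<in>d. \<bar>g (Sup k) - g (Inf k)\<bar>) < e"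
  proof (intro exI[of _ \<delta>] conjI allI impI)
    show \<delta>: "0 < \<delta>" using e by (simp add: \<delta>_def)
    fix d assume d: "d division_of \<Union>d \<and> \<Union>d \<subseteq> {a..b} \<and> (\<Sum>k\<in>d. Sup k - Inf k) < \<delta>"
    then have div: "d division_of \<Union>d" by simp
    have "\<bar>g (Sup k) - g (Inf k)\<bar> \<le> (\<bar>M\<bar> + 1) * (Sup k - Inf k)" if k: "k \<in> d" for k
    proof -
      obtain y z where yz: "k = cbox y z" using division_ofD(4)[OF div k] by blast
      have "y \<le> z" using division_ofD(3)[OF div k] yz by auto
      moreover have "k \<subseteq> {a..b}" using d k by blast
      ultimately have mem: "y \<in> {a..b}" "z \<in> {a..b}" and "Sup k = z" "Inf k = y" using yz by auto
      moreover have "M * \<bar>z - y\<bar> \<le> (\<bar>M\<bar> + 1) * \<bar>z - y\<bar>" by (intro mult_right_mono) auto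
      ultimately show ?thesis using M[OF mem(2,1)] \<open>y \<le> z\<close> by simp
    qed
    then have "(\<Sum>k\<in>d. \<bar>g (Sup k) - g (Inf k)\<bar>) \<le> (\<bar>M\<bar> + 1) * (\<Sum>k\<in>d. Sup k - Inf k)"
      unfolding sum_distrib_left by (rule sum_mono)
    also have "\<dots> < (\<bar>M\<bar> + 1) * \<delta>" using d by (intro mult_strict_left_mono) auto
    also have "\<dots> = e" by (simp add: \<delta>_def)
    finally show "(\<Sum>k\<in>d. \<bar>g (Sup k) - g (Inf k)\<bar>) < e" .
  qed
qed

lemma smooth_imp_Sobolev:
  fixes G :: "nat \<Rightarrow> real \<Rightarrow> real"
  assumes ab: "a < b" and s: "1 \<le> s" and p: "1 \<le> p"
    and der: "\<And>j x. j < s \<Longrightarrow> x \<in> {a..b} \<Longrightarrow> (G j has_vector_derivative G (Suc j) x) (at x within {a..b})"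
    and cont: "continuous_on {a..b} (G s)"
  shows "G 0 \<in> Sobolev p a b s" "\<And>x. x \<in> {a..b} \<Longrightarrow> nth_deriv a b s (G 0) x = G s x"
proof -
  let ?D = "\<lambda>j. nth_deriv a b j (G 0)"
  have eq: "?D j x = G j x" if "j \<le> s" "x \<in> {a..b}" for j x
    using that
  proof (induction j arbitrary: x)
    case (Suc j)
    have "(?D j has_vector_derivative G (Suc j) x) (at x within {a..b})"
    proof (rule has_vector_derivative_transform)
      show "(G j has_vector_derivative G (Suc j) x) (at x within {a..b})"
        using Suc by (intro der) auto
    qed (use Suc in auto)
    then show ?case
      unfolding nth_deriv_Suc using ab Suc by (intro vector_derivative_within_closed_interval) auto
  qed (simp add: nth_deriv_def)
  have derD: "(?D j has_vector_derivative G (Suc j) x) (at x within {a..b})" if "j < s" "x \<in> {a..b}" for j x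
    using that by (intro has_vector_derivative_transform[OF _ _ der]) (auto simp: eq)
  have contG: "continuous_on {a..b} (G j)" if "j \<le> s" for j
  proof (cases "j = s")
    case False
    then have "j < s" using that by simp
    then show ?thesis
      unfolding continuous_on_eq_continuous_within
      by (intro ballI has_vector_derivative_continuous[OF der])
  qed (use cont in simp)
  have contD: "continuous_on {a..b} (?D j)" if "j \<le> s" for j
    using contG[OF that] by (rule continuous_on_eq) (use eq that in auto)
  have ac: "abs_continuous_on {a..b} (?D j)" if "j < s" for j
  proof -
    have "compact (G (Suc j) ` {a..b})"
      using that by (intro compact_continuous_image contG) auto
    then have "bounded (G (Suc j) ` {a..b})" by (rule compact_imp_bounded)
    then obtain M where M: "\<forall>x\<in>{a..b}. \<bar>G (Suc j) x\<bar> \<le> M"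
      unfolding bounded_iff by auto
    show ?thesis
    proof (rule lipschitz_imp_abs_continuous_on[where M = M])
      fix x y assume "x \<in> {a..b}" "y \<in> {a..b}"
      then show "\<bar>?D j x - ?D j y\<bar> \<le> M * \<bar>x - y\<bar>"
        using field_differentiable_bound[of "{a..b}" "?D j" "G (Suc j)" M x y] derD[OF that] M
        by (simp add: has_real_derivative_iff_has_vector_derivative)
    qed
  qed
  have diff: "?D j differentiable (at x within {a..b})" if "j < s" "x \<in> {a..b}" for j x
    using derD[OF that] by (metis differentiableI_vector)
  have "AE x in lebesgue_on {a..b}. ?D (s - 1) differentiable (at x within {a..b})"
    using s by (intro AE_I2 diff) auto
  moreover have "?D s \<in> Lp_space p {a..b}"
    using contD p by (intro continuous_on_imp_Lp_space) auto
  ultimately show "G 0 \<in> Sobolev p a b s"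
    using ac diff by (simp add: Sobolev_def)
  show "\<And>x. x \<in> {a..b} \<Longrightarrow> ?D s x = G s x" using eq by simp
qed

section \<open>Functions with locally integrable powers\<close>

definition locally_Lp :: "real \<Rightarrow> (real \<Rightarrow> real) \<Rightarrow> bool" where
  "locally_Lp p u \<longleftrightarrow> locally_integrable u \<and> (\<forall>c d. (\<lambda>x. \<bar>u x\<bar> powr p) integrable_on {c..d})"

lemma locally_integrable_measurable:
  "locally_integrable u \<Longrightarrow> u \<in> borel_measurable (lebesgue_on {c..d})"
  by (intro absolutely_integrable_imp_borel_measurable locally_integrableD) auto

lemma locally_Lp_imp_Lp_space: "locally_Lp p u \<Longrightarrow> u \<in> Lp_space p {c..d}"
  by (simp add: locally_Lp_def Lp_space_iff locally_integrable_measurable)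

lemma locally_Lp_of_bound:
  assumes "locally_integrable u" "\<And>c d. w integrable_on {c..d}" "\<And>x. \<bar>u x\<bar> powr p \<le> w x"
  shows "locally_Lp p u"
  unfolding locally_Lp_def
proof (intro conjI allI assms(1))
  fix c d
  have "u \<in> Lp_space p {c..d}"
    by (intro Lp_space_bounded_by[OF locally_integrable_measurable[OF assms(1)] assms(2)]) (simp add: assms(3))
  then show "(\<lambda>x. \<bar>u x\<bar> powr p) integrable_on {c..d}" by (simp add: Lp_space_iff)
qed

lemma locally_Lp_restrict_zero:
  assumes "u \<in> Lp_space p {a..b}" "1 \<le> p"
  shows "locally_Lp p (restrict_zero a b u)"
proof -
  have "(\<lambda>x. \<bar>restrict_zero a b u x\<bar> powr p) = restrict_zero a b (\<lambda>x. \<bar>u x\<bar> powr p)"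
    using assms by (simp add: restrict_zero_def fun_eq_iff)
  then show ?thesis
    using assms unfolding locally_Lp_def
    by (auto simp: Lp_space_iff intro!: restrict_zero_locally_integrable Lp_space_absolutely_integrable
        restrict_zero_integral(1))
qed

lemma fwd_diff_locally_integrable:
  assumes "locally_integrable f"
  shows "locally_integrable (fwd_diff k h f)"
proof -
  have "locally_integrable (\<lambda>x. f (x + real i * h))" for i
    using locally_integrable_affine[OF assms, of 1 "real i * h"] by simp
  then show ?thesis
    unfolding fwd_diff_def[abs_def] by (intro locally_integrable_sum locally_integrable_cmult) auto
qed

lemma fwd_diff_locally_Lp:
  assumes f: "locally_Lp p f" and p: "1 \<le> p"
  shows "locally_Lp p (fwd_diff k h f)"
proof (rule locally_Lp_of_bound)
  show "locally_integrable (fwd_diff k h f)"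
    using f by (intro fwd_diff_locally_integrable) (simp add: locally_Lp_def)
  have "(\<lambda>x. \<bar>f (x + real i * h)\<bar> powr p) integrable_on {c..d}" for i c d
    using f integrable_affine_real[of "\<lambda>x. \<bar>f x\<bar> powr p" 1 c "real i * h" d] by (simp add: locally_Lp_def)
  then show "(\<lambda>x. (2 ^ k) powr p * (real (k + 1) powr p * (\<Sum>i=0..k. \<bar>f (x + real i * h)\<bar> powr p))) integrable_on {c..d}" for c d
    by (intro integrable_on_mult_right integrable_sum) auto
qed (rule abs_fwd_diff_powr_le, use p in simp)

section \<open>The smooth approximant\<close>

lemma fwd_diff_cmult: "fwd_diff k h (\<lambda>x. c * f x) x = c * fwd_diff k h f x"
  by (induction k arbitrary: x) (simp_all add: fwd_diff_Suc right_diff_distrib)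

lemma fwd_diff_quotient:
  "fwd_diff k h (\<lambda>y. (f (y + h) - f y) / h) x = fwd_diff (Suc k) h f x / h"
proof -
  have "fwd_diff k h (\<lambda>y. (f (y + h) - f y) / h) x = fwd_diff k h (\<lambda>y. (1 / h) * (f (y + h) - f y)) x"
    by simp
  also have "\<dots> = (1 / h) * (fwd_diff k h (\<lambda>y. f (y + h)) x - fwd_diff k h f x)"
    by (simp only: fwd_diff_cmult fwd_diff_diff)
  also have "fwd_diff k h (\<lambda>y. f (y + h)) x = fwd_diff k h f (x + h)"
    by (simp add: fwd_diff_def add_ac)
  finally show ?thesis by (simp add: fwd_diff_Suc)
qed

lemma fwd_diff_mean:
  assumes f: "locally_integrable f" and h: "0 \<le> h"
  shows "fwd_diff k h (mean h f) y = mean h (fwd_diff k h f) y"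
proof (induction k arbitrary: y)
  case 0
  have "fwd_diff 0 h f = f" by (simp add: fun_eq_iff)
  then show ?case by simp
next
  case (Suc k)
  let ?D = "fwd_diff k h f"
  have int: "?D integrable_on {c..d}" for c d
    using f by (intro locally_integrableD(2) fwd_diff_locally_integrable)
  have int': "(\<lambda>x. ?D (x + h)) integrable_on {c..d}" for c d
    using integrable_affine_real[of ?D 1 c h d] int by simp
  have "mean h (fwd_diff (Suc k) h f) y = integral {y..y + h} (\<lambda>x. ?D (x + h) - ?D x) / h"
    by (simp add: mean_def fwd_diff_Suc[abs_def])
  also have "\<dots> = integral {y..y + h} (\<lambda>x. ?D (x + h)) / h - integral {y..y + h} ?D / h"
    by (simp add: integral_diff int int' diff_divide_distrib)
  also have "integral {y..y + h} (\<lambda>x. ?D (x + h)) = integral {y + h..y + h + h} ?D"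
    using integral_affine_real[of 1 y "y + h" ?D h] by simp
  finally show ?case by (simp only: fwd_diff_Suc Suc mean_def[of h ?D])
qed

text \<open>
  Each differentiation consumes one mean, so at least one mean must be left for the function to be continuous.
\<close>
lemma fwd_diff_mean_iterate_has_derivative:
  assumes f: "locally_integrable f" and h: "0 < h" and k: "1 \<le> k"
  shows "(fwd_diff j h ((mean h ^^ Suc k) f) has_vector_derivative
    fwd_diff (Suc j) h ((mean h ^^ k) f) y / h) (at y)"
proof -
  let ?u = "(mean h ^^ k) f"
  obtain l where l: "k = Suc l" using k by (cases k) auto
  have "continuous_on UNIV ?u" unfolding l using f h by (intro mean_iterate_continuous) auto
  then have "(mean h ?u has_vector_derivative (?u (z + h) - ?u z) / h) (at z)" for z
    using h by (intro mean_has_derivative)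
  then have d: "((\<lambda>y. mean h ?u (y + c)) has_vector_derivative (?u (y + c + h) - ?u (y + c)) / h) (at y)" for c
    using vector_diff_chain_at[of "\<lambda>y. y + c" 1 y "mean h ?u"] has_vector_derivative_add[OF has_vector_derivative_id[of "at y"] has_vector_derivative_const[of c]]
    by (simp add: o_def)
  have "(fwd_diff j h (mean h ?u) has_vector_derivative fwd_diff j h (\<lambda>z. (?u (z + h) - ?u z) / h) y) (at y)"
    unfolding fwd_diff_def by (intro has_vector_derivative_sum has_vector_derivative_mult_right d)
  then show ?thesis by (simp add: fwd_diff_quotient)
qed

text \<open>
  After an affine substitution in the \<open>m\<close>-th summand of the kernel, the Steklov average of order \<open>s + 1\<close>
  is a sum of iterated means with steps \<open>h = m * \<delta> / (s + 1)\<close>, evaluated at contractions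
  \<open>\<beta> * x + e\<close> of \<open>x\<close>. Every differentiation turns one mean into a difference quotient with step \<open>h\<close>
  and produces a factor \<open>\<beta>\<close>; the formulas below result after \<open>j\<close> differentiations.
\<close>
definition steklov_deriv_term ::
  "real \<Rightarrow> real \<Rightarrow> real \<Rightarrow> nat \<Rightarrow> (real \<Rightarrow> real) \<Rightarrow> nat \<Rightarrow> nat \<Rightarrow> real \<Rightarrow> real" where
  "steklov_deriv_term a b \<delta> s f m j x =
     (let h = real m * (\<delta> / real (s + 1)); \<beta> = 1 - real m * \<delta> / (b - a); e = real m * \<delta> * a / (b - a)
      in (-1) ^ (m + 1) * real (s + 1 choose m) * (\<beta> / h) ^ j * fwd_diff j h ((mean h ^^ (s + 1 - j)) f) (\<beta> * x + e))"

definition steklov_deriv :: "real \<Rightarrow> real \<Rightarrow> real \<Rightarrow> nat \<Rightarrow> (real \<Rightarrow> real) \<Rightarrow> nat \<Rightarrow> real \<Rightarrow> real" where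
  "steklov_deriv a b \<delta> s f j x = (\<Sum>m=1..s + 1. steklov_deriv_term a b \<delta> s f m j x)"

lemma steklov_deriv_has_vector_derivative:
  assumes f: "locally_integrable f" and \<delta>: "0 < \<delta>" and j: "j < s"
  shows "(steklov_deriv a b \<delta> s f j has_vector_derivative steklov_deriv a b \<delta> s f (Suc j) x) (at x)"
  unfolding steklov_deriv_def
proof (rule has_vector_derivative_sum)
  fix m assume m: "m \<in> {1..s + 1}"
  define h where "h = real m * (\<delta> / real (s + 1))"
  define \<beta> where "\<beta> = 1 - real m * \<delta> / (b - a)"
  define e where "e = real m * \<delta> * a / (b - a)"
  define c where "c = (-1) ^ (m + 1) * real (s + 1 choose m)"
  have h: "0 < h" using m \<delta> by (simp add: h_def)
  obtain k where k: "s + 1 - j = Suc k" "s + 1 - Suc j = k" "1 \<le> k"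
    using j by (metis Suc_diff_Suc Suc_eq_plus1 diff_Suc_Suc less_SucI zero_less_diff One_nat_def Suc_le_eq)
  let ?u = "fwd_diff j h ((mean h ^^ Suc k) f)" and ?u' = "\<lambda>y. fwd_diff (Suc j) h ((mean h ^^ k) f) y / h"
  have lin: "((\<lambda>x. \<beta> * x + e) has_vector_derivative \<beta>) (at x)"
    by (auto intro!: derivative_eq_intros simp: has_real_derivative_iff_has_vector_derivative[symmetric])
  have "((?u \<circ> (\<lambda>x. \<beta> * x + e)) has_vector_derivative \<beta> *\<^sub>R ?u' (\<beta> * x + e)) (at x)"
    by (intro vector_diff_chain_at lin fwd_diff_mean_iterate_has_derivative f h k)
  then have "((\<lambda>x. c * (\<beta> / h) ^ j * ?u (\<beta> * x + e)) has_vector_derivative c * (\<beta> / h) ^ j * (\<beta> * ?u' (\<beta> * x + e))) (at x)"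
    by (intro has_vector_derivative_mult_right) (simp add: o_def)
  moreover have "steklov_deriv_term a b \<delta> s f m j = (\<lambda>x. c * (\<beta> / h) ^ j * ?u (\<beta> * x + e))"
    unfolding steklov_deriv_term_def Let_def k h_def \<beta>_def e_def c_def by (rule ext) (rule refl)
  moreover have "steklov_deriv_term a b \<delta> s f m (Suc j) x = c * (\<beta> / h) ^ j * (\<beta> * ?u' (\<beta> * x + e))"
    unfolding steklov_deriv_term_def Let_def k(2) h_def[symmetric] \<beta>_def[symmetric] e_def[symmetric] c_def[symmetric] by simp
  ultimately show "((\<lambda>x. steklov_deriv_term a b \<delta> s f m j x) has_vector_derivative steklov_deriv_term a b \<delta> s f m (Suc j) x) (at x)"
    by simp
qed

lemma steklov_deriv_last:
  assumes f: "locally_integrable f" and \<delta>: "0 < \<delta>"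
  shows "steklov_deriv a b \<delta> s f s x = (\<Sum>m=1..s + 1.
     (-1) ^ (m + 1) * real (s + 1 choose m) * ((1 - real m * \<delta> / (b - a)) / (real m * (\<delta> / real (s + 1)))) ^ s *
     mean (real m * (\<delta> / real (s + 1))) (fwd_diff s (real m * (\<delta> / real (s + 1))) f)
       ((1 - real m * \<delta> / (b - a)) * x + real m * \<delta> * a / (b - a)))"
  unfolding steklov_deriv_def steklov_deriv_term_def Let_def
  using f \<delta> by (intro sum.cong refl) (simp add: fwd_diff_mean)

lemma steklov_deriv_continuous:
  assumes f: "locally_integrable f" and \<delta>: "0 < \<delta>"
  shows "continuous_on UNIV (\<lambda>x. steklov_deriv a b \<delta> s f s x)"
  unfolding steklov_deriv_last[OF assms]
  using \<delta> by (intro continuous_on_sum continuous_on_mult_left continuous_intros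
      continuous_on_compose2[OF mean_continuous[OF fwd_diff_locally_integrable[OF f]]]) auto

lemma steklov_deriv_0_eq_mean_iterate:
  assumes f: "locally_integrable f" and \<delta>: "0 < \<delta>"
  shows "steklov_deriv a b \<delta> s f 0 x = (mean (\<delta> / real (s + 1)) ^^ (s + 1))
    (\<lambda>\<tau>. steklov_kernel (s + 1) f x (\<tau> - (x - a) / (b - a) * \<delta>)) 0"
proof -
  define c where "c m = (-1) ^ (m + 1) * real (s + 1 choose m)" for m
  define u where "u = (x - a) / (b - a)"
  define d where "d = \<delta> / real (s + 1)"
  have d: "0 < d" using \<delta> by (simp add: d_def)
  have eqk: "steklov_kernel (s + 1) f x (\<tau> - u * \<delta>) = (\<Sum>m=1..s + 1. c m * f (real m * \<tau> + (x - real m * u * \<delta>)))" for \<tau>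
    unfolding steklov_kernel_def c_def by (intro sum.cong refl) (simp add: algebra_simps)
  have "(mean d ^^ (s + 1)) (\<lambda>\<tau>. \<Sum>m=1..s + 1. c m * f (real m * \<tau> + (x - real m * u * \<delta>))) 0
      = (\<Sum>m=1..s + 1. c m * (mean d ^^ (s + 1)) (\<lambda>\<tau>. f (real m * \<tau> + (x - real m * u * \<delta>))) 0)"
    using d by (subst mean_iterate_sum) (auto intro!: locally_integrable_affine f)
  also have "\<dots> = (\<Sum>m=1..s + 1. c m * (mean (real m * d) ^^ (s + 1)) f (x - real m * u * \<delta>))"
    by (intro sum.cong refl) (subst mean_iterate_affine, auto)
  also have "\<dots> = steklov_deriv a b \<delta> s f 0 x"
    unfolding steklov_deriv_def
  proof (intro sum.cong refl)
    fix m
    have "(1 - real m * \<delta> / (b - a)) * x + real m * \<delta> * a / (b - a) = x - real m * u * \<delta>"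
      by (simp add: u_def algebra_simps add_divide_distrib diff_divide_distrib)
    then show "c m * (mean (real m * d) ^^ (s + 1)) f (x - real m * u * \<delta>) = steklov_deriv_term a b \<delta> s f m 0 x"
      by (simp add: steklov_deriv_term_def Let_def c_def d_def del: funpow.simps)
  qed
  finally show ?thesis unfolding u_def[symmetric] d_def[symmetric] eqk by simp
qed

text \<open>
  As \<open>x\<close> runs through \<open>[a, b]\<close>, the argument of the \<open>m\<close>-th mean runs through \<open>[a, b - m * \<delta>]\<close>, so only
  differences of \<open>f\<close> with nodes in \<open>[a, b]\<close> enter. The bound \<open>2 * (s + 1) * \<delta> \<le> b - a\<close> makes the contraction
  factors at least \<open>1 / 2\<close>.
\<close>
lemma Lp_norm_steklov_deriv_le:
  assumes ab: "a < b" and s: "1 \<le> s" and p: "1 \<le> p" and f: "locally_Lp p f"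
    and \<delta>: "0 < \<delta>" "2 * real (s + 1) * \<delta> \<le> b - a"
    and \<omega>: "0 \<le> \<omega>" "\<And>h. 0 < h \<Longrightarrow> h \<le> \<delta> \<Longrightarrow> Lp_norm p {a..b - real s * h} (fwd_diff s h f) \<le> \<omega>"
  shows "Lp_norm p {a..b} (steklov_deriv a b \<delta> s f s)
    \<le> 2 ^ (s + 1) * real (s + 1) ^ s * (2 * real (s + 1) * real (s + 1)) / \<delta> ^ s * \<omega>"
proof -
  define R where "R = s + 1"
  define d where "d = \<delta> / real R"
  have d: "0 < d" "real R * d = \<delta>" using \<delta> by (auto simp: d_def R_def)
  have lf: "locally_integrable f" using f by (simp add: locally_Lp_def)
  define h where "h m = real m * d" for m
  define \<beta> where "\<beta> m = 1 - real m * \<delta> / (b - a)" for m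
  define e where "e m = real m * \<delta> * a / (b - a)" for m
  define D where "D m = fwd_diff s (h m) f" for m
  define T where "T m x = mean (h m) (D m) (\<beta> m * x + e m)" for m x
  define M where "M = 2 ^ R / d ^ s"
  have lD: "locally_Lp p (D m)" for m unfolding D_def using f p by (intro fwd_diff_locally_Lp)
  have lD': "locally_integrable (D m)" for m using lD[of m] by (simp add: locally_Lp_def)
  have m: "0 < h m" "h m \<le> \<delta>" "1 / 2 \<le> \<beta> m" "\<beta> m \<le> 1" "\<beta> m * a + e m = a" "\<beta> m * b + e m = b - real m * \<delta>"
    "b - real m * \<delta> + h m \<le> b - real s * h m" if "m \<in> {1..R}" for m
  proof -
    show h0: "0 < h m" using that d by (simp add: h_def)
    have "real m * d \<le> real R * d" using that d(1) by (intro mult_right_mono) auto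
    then show "h m \<le> \<delta>" unfolding h_def d(2) .
    have "real m * \<delta> \<le> real R * \<delta>" using that \<delta> by simp
    then have "2 * (real m * \<delta>) \<le> b - a" using \<delta> unfolding R_def by linarith
    then show "1 / 2 \<le> \<beta> m" using ab by (simp add: \<beta>_def field_simps)
    show "\<beta> m \<le> 1" using ab \<delta> by (simp add: \<beta>_def)
    have q: "real m * \<delta> / (b - a) * (b - a) = real m * \<delta>" using ab by simp
    show "\<beta> m * a + e m = a" by (simp add: \<beta>_def e_def algebra_simps)
    have "\<beta> m * b + e m = b - real m * \<delta> / (b - a) * (b - a)"
      by (simp add: \<beta>_def e_def algebra_simps diff_divide_distrib)
    then show "\<beta> m * b + e m = b - real m * \<delta>" unfolding q .
    have "real m * \<delta> = real R * h m" unfolding h_def using d by (simp add: algebra_simps)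
    then show "b - real m * \<delta> + h m \<le> b - real s * h m" by (simp add: R_def algebra_simps)
  qed
  have Ti: "(\<lambda>x. \<bar>T m x\<bar> powr p) integrable_on {a..b}" and Tle: "integral {a..b} (\<lambda>x. \<bar>T m x\<bar> powr p) \<le> 2 * \<omega> powr p"
    if mR: "m \<in> {1..R}" for m
  proof -
    note mm = m[OF mR]
    define U where "U y = \<bar>mean (h m) (D m) y\<bar> powr p" for y
    have cU: "continuous_on UNIV U"
      unfolding U_def using mm p
      by (intro continuous_on_powr' continuous_intros mean_continuous lD') auto
    have Ui: "U integrable_on {c1..c2}" for c1 c2
      by (intro integrable_continuous_real continuous_on_subset[OF cU]) auto
    have \<beta>: "0 < \<beta> m" using mm by simp
    have TU: "\<bar>T m x\<bar> powr p = U (\<beta> m * x + e m)" for x by (simp add: T_def U_def)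
    show "(\<lambda>x. \<bar>T m x\<bar> powr p) integrable_on {a..b}"
      unfolding TU using \<beta> Ui by (intro integrable_affine_real)
    have "integral {a..b} (\<lambda>x. \<bar>T m x\<bar> powr p) = integral {a..b - real m * \<delta>} U / \<beta> m"
      unfolding TU integral_affine_real[OF \<beta>] mm(5,6) ..
    also have "integral {a..b - real m * \<delta>} U \<le> \<omega> powr p"
    proof -
      let ?b = "b - real s * h m"
      define w where "w = restrict_zero a ?b (\<lambda>x. \<bar>D m x\<bar> powr p)"
      have Dp: "(\<lambda>x. \<bar>D m x\<bar> powr p) integrable_on {c1..c2}" for c1 c2 using lD[of m] by (simp add: locally_Lp_def)
      have "integral {a..?b} (\<lambda>x. \<bar>D m x\<bar> powr p) \<le> \<omega> powr p"
        using \<omega>(2)[of "h m"] mm \<omega>(1) p by (simp add: Lp_norm_le_iff D_def)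
      then have w: "w integrable_on {c1..c2}" "0 \<le> w t" "integral {c1..c2} w \<le> \<omega> powr p" for c1 c2 t
        unfolding w_def using restrict_zero_integral[OF Dp, of a ?b c1 c2]
        by (auto simp: restrict_zero_def)
      have "integral {a..b - real m * \<delta>} U \<le> integral {a..b - real m * \<delta>} (\<lambda>y. inverse (h m) * integral {y..y + h m} w)"
      proof (rule integral_le[OF Ui])
        show "(\<lambda>y. inverse (h m) * integral {y..y + h m} w) integrable_on {a..b - real m * \<delta>}"
          using mm w by (intro integrable_on_mult_right integral_sliding_integral_le(1)[where B = "\<omega> powr p"]) auto
        fix y assume y: "y \<in> {a..b - real m * \<delta>}"
        have "\<bar>mean (h m) (D m) y\<bar> \<le> integral {y..y + h m} (\<lambda>x. \<bar>D m x\<bar>) / h m"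
          using abs_mean_iterate_le[OF lD'[of m] mm(1), of 0 y] by simp
        then have "U y \<le> (integral {y..y + h m} (\<lambda>x. \<bar>D m x\<bar>) / h m) powr p"
          unfolding U_def using p by (intro powr_mono2) auto
        also have "\<dots> \<le> integral {y..y + h m} (\<lambda>x. \<bar>D m x\<bar> powr p) / h m"
          using mean_powr_le[OF p, of y "y + h m" "\<lambda>x. \<bar>D m x\<bar>"] mm Dp locally_integrableD(3)[OF lD'] by simp
        also have "integral {y..y + h m} (\<lambda>x. \<bar>D m x\<bar> powr p) = integral {y..y + h m} w"
          using y mm(7) by (intro integral_cong) (auto simp: w_def restrict_zero_def)
        finally show "U y \<le> inverse (h m) * integral {y..y + h m} w" by (simp add: divide_inverse mult.commute)
      qed
      also have "\<dots> = inverse (h m) * integral {a..b - real m * \<delta>} (\<lambda>y. integral {y..y + h m} w)" by simp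
      also have "\<dots> \<le> inverse (h m) * (h m * \<omega> powr p)"
        using mm w by (intro mult_left_mono integral_sliding_integral_le(2)) auto
      also have "\<dots> = \<omega> powr p" using mm(1) by simp
      finally show ?thesis .
    qed
    then have "integral {a..b - real m * \<delta>} U / \<beta> m \<le> \<omega> powr p / (1 / 2)"
      using mm \<beta> by (intro frac_le) auto
    finally show "integral {a..b} (\<lambda>x. \<bar>T m x\<bar> powr p) \<le> 2 * \<omega> powr p" by simp
  qed
  have pt: "\<bar>steklov_deriv a b \<delta> s f s x\<bar> \<le> M * (\<Sum>m=1..R. \<bar>T m x\<bar>)" for x
  proof -
    have "steklov_deriv a b \<delta> s f s x = (\<Sum>m=1..R. (-1) ^ (m + 1) * real (R choose m) * (\<beta> m / h m) ^ s * T m x)"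
      unfolding steklov_deriv_last[OF lf \<delta>(1)] R_def[symmetric] d_def[symmetric] h_def \<beta>_def e_def T_def D_def ..
    also have "\<bar>\<dots>\<bar> \<le> (\<Sum>m=1..R. M * \<bar>T m x\<bar>)"
    proof (rule order_trans[OF sum_abs], rule sum_mono)
      fix k assume kR: "k \<in> {1..R}"
      note mm = m[OF kR]
      have "real (R choose k) \<le> 2 ^ R" using binomial_le_pow2[of R k] by (simp flip: of_nat_le_iff)
      moreover have "\<beta> k ^ s \<le> 1" "0 \<le> \<beta> k ^ s" using mm by (auto intro!: power_le_one)
      ultimately have "real (R choose k) * \<beta> k ^ s \<le> 2 ^ R * 1" by (intro mult_mono) auto
      moreover have "d \<le> h k" using kR d by (simp add: h_def)
      then have "d ^ s \<le> h k ^ s" using d by (intro power_mono) auto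
      ultimately have "real (R choose k) * \<beta> k ^ s / h k ^ s \<le> M"
        unfolding M_def using d mm \<open>0 \<le> \<beta> k ^ s\<close> by (intro frac_le) auto
      then have "real (R choose k) * \<beta> k ^ s / h k ^ s * \<bar>T k x\<bar> \<le> M * \<bar>T k x\<bar>"
        by (intro mult_right_mono) auto
      then show "\<bar>(-1) ^ (k + 1) * real (R choose k) * (\<beta> k / h k) ^ s * T k x\<bar> \<le> M * \<bar>T k x\<bar>"
        using mm by (simp add: abs_mult power_divide)
    qed
    finally show ?thesis by (simp add: sum_distrib_left)
  qed
  have M0: "0 \<le> M" using d by (simp add: M_def)
  have "Lp_norm p {a..b} (steklov_deriv a b \<delta> s f s) \<le> M * real R * (2 * real R) * \<omega>"
  proof (rule Lp_norm_le_of_integral_le[OF p])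
    let ?w = "\<lambda>x. (M * real R) powr p * (\<Sum>m=1..R. \<bar>T m x\<bar> powr p)"
    show "?w integrable_on {a..b}"
      by (intro integrable_on_mult_right integrable_sum Ti) auto
    have "integral {a..b} ?w = (M * real R) powr p * (\<Sum>m=1..R. integral {a..b} (\<lambda>x. \<bar>T m x\<bar> powr p))"
      by (subst integral_mult_right, subst integral_sum) (use Ti in auto)
    also have "\<dots> \<le> (M * real R) powr p * (\<Sum>m=1..R. 2 * \<omega> powr p)"
      by (intro mult_left_mono sum_mono Tle) auto
    also have "\<dots> = (M * real R) powr p * (2 * real R) powr 1 * \<omega> powr p"
      by (simp add: R_def)
    also have "\<dots> \<le> (M * real R) powr p * (2 * real R) powr p * \<omega> powr p"
      using p by (intro mult_right_mono mult_left_mono powr_mono) (auto simp: R_def)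
    finally show "integral {a..b} ?w \<le> (M * real R * (2 * real R) * \<omega>) powr p"
      by (simp only: powr_mult)
    fix x
    have "\<bar>steklov_deriv a b \<delta> s f s x\<bar> powr p \<le> (M * (\<Sum>m=1..R. \<bar>T m x\<bar>)) powr p"
      using p by (intro powr_mono2 pt) auto
    also have "\<dots> \<le> M powr p * (real (card {1..R}) powr p * (\<Sum>m=1..R. \<bar>T m x\<bar> powr p))"
      unfolding powr_mult[of M] using p by (intro mult_left_mono powr_sum_le) auto
    finally show "\<bar>steklov_deriv a b \<delta> s f s x\<bar> powr p \<le> ?w x" by (simp add: powr_mult)
  qed (use M0 \<omega> in auto)
  also have "M * real R * (2 * real R) * \<omega> = 2 ^ (s + 1) * real (s + 1) ^ s * (2 * real (s + 1) * real (s + 1)) / \<delta> ^ s * \<omega>"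
    unfolding M_def d_def R_def by (simp add: power_divide)
  finally show ?thesis .
qed


text \<open>
  A difference of order \<open>s + 1\<close> is a difference of two differences of order \<open>s\<close>; the approximant involves the former,
  the modulus of smoothness the latter.
\<close>
lemma Lp_norm_fwd_diff_Suc_le:
  assumes p: "1 \<le> p" and f: "locally_Lp p f" and h: "0 < h"
    and \<omega>: "0 \<le> \<omega>" "Lp_norm p {a..b - real s * h} (fwd_diff s h f) \<le> \<omega>"
  shows "Lp_norm p {a..b - real (s + 1) * h} (fwd_diff (s + 1) h f) \<le> 8 * \<omega>"
proof (rule Lp_norm_le_of_integral_le[OF p])
  let ?D = "fwd_diff s h f" and ?b = "b - real (s + 1) * h"
  define U where "U = (\<lambda>x. \<bar>?D x\<bar> powr p)"
  have U: "U integrable_on {c..d}" for c d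
    unfolding U_def using fwd_diff_locally_Lp[OF f p, of s h] by (simp add: locally_Lp_def)
  have U': "(\<lambda>x. U (x + h)) integrable_on {c..d}" for c d
    using integrable_affine_real[of U 1 c h d] U by simp
  have le: "integral {a..b - real s * h} U \<le> \<omega> powr p"
    using \<omega> p by (simp add: Lp_norm_le_iff U_def)
  have le1: "integral {c..d} U \<le> \<omega> powr p" if "a \<le> c" "d \<le> b - real s * h" for c d
  proof -
    have "integral {c..d} U \<le> integral {a..b - real s * h} U"
      using that U by (intro integral_subset_le) (auto simp: U_def)
    then show ?thesis using le by simp
  qed
  let ?w = "\<lambda>x. 2 powr p * (U (x + h) + U x)"
  show "?w integrable_on {a..?b}" by (intro integrable_on_mult_right integrable_add U U')
  have "integral {a..?b} ?w = 2 powr p * (integral {a..?b} (\<lambda>x. U (x + h)) + integral {a..?b} U)"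
    by (simp only: integral_mult_right integral_add[OF U' U])
  also have "integral {a..?b} (\<lambda>x. U (x + h)) = integral {a + h..?b + h} U"
    using integral_affine_real[of 1 a ?b U h] by simp
  also have "2 powr p * (integral {a + h..?b + h} U + integral {a..?b} U) \<le> 2 powr p * (\<omega> powr p + \<omega> powr p)"
    using h by (intro mult_left_mono add_mono le1) (auto simp: algebra_simps)
  also have "\<dots> \<le> (4 * (\<omega> + \<omega>)) powr p" using p \<omega> by (intro powr_add_le_add_powr) auto
  finally show "integral {a..?b} ?w \<le> (8 * \<omega>) powr p" by simp
  fix x
  have "\<bar>fwd_diff (s + 1) h f x\<bar> powr p \<le> (\<bar>?D (x + h)\<bar> + \<bar>?D x\<bar>) powr p"
    using p by (intro powr_mono2) (auto simp: fwd_diff_Suc)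
  also have "\<dots> \<le> ?w x" unfolding U_def using p by (intro powr_add_le) auto
  finally show "\<bar>fwd_diff (s + 1) h f x\<bar> powr p \<le> ?w x" .
qed (use \<omega> in auto)

lemma nn_integral_powr_Icc:
  assumes "(\<lambda>x. \<bar>u x\<bar> powr p) integrable_on {c..d}"
  shows "(\<integral>\<^sup>+x. ennreal (\<bar>u x\<bar> powr p) * indicator {c..d} x \<partial>lborel) = ennreal (integral {c..d} (\<lambda>x. \<bar>u x\<bar> powr p))"
  using assms by (intro nn_integral_has_integral_lebesgue') auto

text \<open>
  The step of the difference depends on \<open>x\<close>. Enlarging the range of the steps to \<open>[- \<delta>, \<delta>]\<close>
  makes the two variables independent, and Tonelli's theorem leaves an average over the steps of norms of
  differences with a constant step. A Borel measurable \<open>f\<close> makes the integrand jointly measurable in \<open>x\<close> and the step.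
\<close>
lemma nn_integral_fwd_diff_steps_le:
  fixes f :: "real \<Rightarrow> real"
  assumes p: "1 \<le> p" and R: "1 \<le> R" and fB[measurable]: "f \<in> borel_measurable borel" and f: "locally_Lp p f"
    and \<delta>: "0 < \<delta>"
    and \<omega>: "0 \<le> \<omega>" "\<And>h. 0 < h \<Longrightarrow> h \<le> \<delta> \<Longrightarrow> Lp_norm p {a..b - real R * h} (fwd_diff R h f) \<le> \<omega>"
  defines "K \<equiv> \<lambda>x \<theta>. if a \<le> x \<and> x \<le> b \<and> a \<le> x + real R * \<theta> \<and> x + real R * \<theta> \<le> b \<and> - \<delta> \<le> \<theta> \<and> \<theta> \<le> \<delta>
    then ennreal (\<bar>fwd_diff R \<theta> f x\<bar> powr p) else 0"
  shows "(\<integral>\<^sup>+x. (\<integral>\<^sup>+\<theta>. K x \<theta> \<partial>lborel) \<partial>lborel) \<le> ennreal (2 * \<delta> * \<omega> powr p)"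
proof -
  have "(\<integral>\<^sup>+x. (\<integral>\<^sup>+\<theta>. K x \<theta> \<partial>lborel) \<partial>lborel) = (\<integral>\<^sup>+\<theta>. (\<integral>\<^sup>+x. K x \<theta> \<partial>lborel) \<partial>lborel)"
  proof (rule lborel_pair.Fubini'[symmetric])
    have "(\<lambda>(x, \<theta>). K x \<theta>) \<in> borel_measurable (borel \<Otimes>\<^sub>M borel)"
      unfolding K_def fwd_diff_def by measurable
    then show "case_prod K \<in> borel_measurable (lborel \<Otimes>\<^sub>M lborel)"
      by (simp cong: measurable_cong_sets)
  qed
  also have "\<dots> \<le> (\<integral>\<^sup>+\<theta>. ennreal (\<omega> powr p) * indicator {- \<delta>..\<delta>} \<theta> \<partial>lborel)"
  proof (rule nn_integral_mono)
    fix \<theta> :: real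
    have Dp: "(\<lambda>x. \<bar>fwd_diff R h f x\<bar> powr p) integrable_on {c..d}" for h c d
      using fwd_diff_locally_Lp[OF f p, of R h] by (simp add: locally_Lp_def)
    have int: "integral {a..b - real R * h} (\<lambda>x. \<bar>fwd_diff R h f x\<bar> powr p) \<le> \<omega> powr p" if "0 < h" "h \<le> \<delta>" for h
      using \<omega>(2)[OF that] p \<omega>(1) by (simp add: Lp_norm_le_iff)
    \<comment> \<open>A negative step is turned into a positive one by a translation of \<open>x\<close>.\<close>
    consider "\<theta> \<notin> {- \<delta>..\<delta>}" | "\<theta> = 0" | "\<theta> \<in> {0<..\<delta>}" | "- \<theta> \<in> {0<..\<delta>}" by fastforce
    then show "(\<integral>\<^sup>+x. K x \<theta> \<partial>lborel) \<le> ennreal (\<omega> powr p) * indicator {- \<delta>..\<delta>} \<theta>"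
    proof cases
      case 1
      then have "K x \<theta> = 0" for x by (auto simp: K_def)
      then show ?thesis by simp
    next
      case 2
      then have "K x \<theta> = 0" for x using R p by (auto simp: K_def fwd_diff_zero_step)
      then show ?thesis by simp
    next
      case 3
      have aux: "(a \<le> x \<and> x \<le> b \<and> a \<le> x + t \<and> x + t \<le> b \<and> P) = (x \<in> {a..b - t} \<and> P)" if "0 \<le> t" for x t :: real and P
        using that by auto
      have "0 \<le> real R * \<theta>" using 3 by simp
      then have "K x \<theta> = ennreal (\<bar>fwd_diff R \<theta> f x\<bar> powr p) * indicator {a..b - real R * \<theta>} x" for x
        using 3 unfolding K_def by (subst aux) (auto simp: indicator_def)
      then have "(\<integral>\<^sup>+x. K x \<theta> \<partial>lborel) = ennreal (integral {a..b - real R * \<theta>} (\<lambda>x. \<bar>fwd_diff R \<theta> f x\<bar> powr p))"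
        using nn_integral_powr_Icc[OF Dp] by simp
      also have "\<dots> \<le> ennreal (\<omega> powr p)" using int[of \<theta>] 3 by (intro ennreal_leI) auto
      finally show ?thesis using 3 by (simp add: indicator_def)
    next
      case 4
      define h where "h = - \<theta>"
      have h: "0 < h" "h \<le> \<delta>" "\<theta> = - h" using 4 by (auto simp: h_def)
      then have h0: "0 \<le> real R * h" by simp
      define D where "D x = fwd_diff R h f (1 * x + (- (real R * h)))" for x
      have "K x \<theta> = ennreal (\<bar>D x\<bar> powr p) * indicator {a + real R * h..b} x" for x
      proof -
        have aux: "(a \<le> x \<and> x \<le> b \<and> a \<le> x + t \<and> x + t \<le> b \<and> P) = (x \<in> {a - t..b} \<and> P)" if "t \<le> 0" for x t :: real and P
          using that by auto
        have t: "real R * \<theta> \<le> 0" "a - real R * \<theta> = a + real R * h" using h h0 by auto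
        show ?thesis
          unfolding K_def aux[OF t(1)] t(2) using h abs_fwd_diff_symmetric[of R h f x]
          by (auto simp: indicator_def D_def)
      qed
      moreover have Di: "(\<lambda>x. \<bar>D x\<bar> powr p) integrable_on {c..d}" for c d
        unfolding D_def using Dp by (rule integrable_affine_real) simp
      ultimately have "(\<integral>\<^sup>+x. K x \<theta> \<partial>lborel) = ennreal (integral {a + real R * h..b} (\<lambda>x. \<bar>D x\<bar> powr p))"
        using nn_integral_powr_Icc[OF Di] by simp
      also have "integral {a + real R * h..b} (\<lambda>x. \<bar>D x\<bar> powr p) = integral {a..b - real R * h} (\<lambda>x. \<bar>fwd_diff R h f x\<bar> powr p)"
        unfolding D_def by (subst integral_affine_real[of 1 _ _ "\<lambda>x. \<bar>fwd_diff R h f x\<bar> powr p"]) auto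
      also have "ennreal \<dots> \<le> ennreal (\<omega> powr p)" using int[of h] h by (intro ennreal_leI) auto
      finally show ?thesis using 4 by (simp add: indicator_def)
    qed
  qed
  also have "\<dots> = ennreal (\<omega> powr p) * ennreal (2 * \<delta>)"
    using \<delta> by (subst nn_integral_cmult_indicator) auto
  also have "\<dots> = ennreal (2 * \<delta> * \<omega> powr p)"
    using \<delta> by (simp add: ennreal_mult' mult.commute)
  finally show ?thesis .
qed

text \<open>
  Jensen's inequality for the mean over the sliding window bounds the power of \<open>f x - g x\<close> by a mean of powers of
  differences, whose integral over \<open>x\<close> is bounded by \<open>nn_integral_fwd_diff_steps_le\<close>.
\<close>
lemma Lp_norm_minus_steklov_deriv_le:
  fixes f :: "real \<Rightarrow> real"
  assumes ab: "a < b" and p: "1 \<le> p" and fB: "f \<in> borel_measurable borel" and f: "locally_Lp p f"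
    and \<delta>: "0 < \<delta>" "2 * real (s + 1) * \<delta> \<le> b - a"
    and fg: "(\<lambda>x. f x - steklov_deriv a b \<delta> s f 0 x) \<in> Lp_space p {a..b}"
    and \<omega>: "0 \<le> \<omega>" "\<And>h. 0 < h \<Longrightarrow> h \<le> \<delta> \<Longrightarrow> Lp_norm p {a..b - real s * h} (fwd_diff s h f) \<le> \<omega>"
  shows "Lp_norm p {a..b} (\<lambda>x. f x - steklov_deriv a b \<delta> s f 0 x) \<le> 2 * real (s + 1) * (8 * \<omega>)"
proof -
  define R where "R = s + 1"
  have R: "1 \<le> R" by (simp add: R_def)
  have lf: "locally_integrable f" using f by (simp add: locally_Lp_def)
  define g where "g = steklov_deriv a b \<delta> s f 0"
  define K where "K x \<theta> = (if a \<le> x \<and> x \<le> b \<and> a \<le> x + real R * \<theta> \<and> x + real R * \<theta> \<le> b \<and> - \<delta> \<le> \<theta> \<and> \<theta> \<le> \<delta>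
    then ennreal (\<bar>fwd_diff R \<theta> f x\<bar> powr p) else 0)" for x \<theta>
  have K: "(\<integral>\<^sup>+x. (\<integral>\<^sup>+\<theta>. K x \<theta> \<partial>lborel) \<partial>lborel) \<le> ennreal (2 * \<delta> * (8 * \<omega>) powr p)"
    unfolding K_def
  proof (rule nn_integral_fwd_diff_steps_le[OF p R fB f \<delta>(1)])
    show "Lp_norm p {a..b - real R * h} (fwd_diff R h f) \<le> 8 * \<omega>" if "0 < h" "h \<le> \<delta>" for h
      unfolding R_def using that by (intro Lp_norm_fwd_diff_Suc_le p f \<omega>)
  qed (use \<omega> in auto)
  define c where "c = real R powr p / \<delta>"
  have pt: "ennreal (\<bar>f x - g x\<bar> powr p) * indicator {a..b} x \<le> ennreal c * (\<integral>\<^sup>+\<theta>. K x \<theta> \<partial>lborel)" for x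
  proof (cases "x \<in> {a..b}")
    case x: True
    define u where "u = (x - a) / (b - a)"
    have u: "0 \<le> u" "u \<le> 1" using x ab by (auto simp: u_def)
    define H where "H = (\<lambda>\<tau>. \<bar>fwd_diff R (\<tau> - u * \<delta>) f x\<bar>)"
    have H_eq: "H \<tau> = \<bar>steklov_kernel R f x (\<tau> - u * \<delta>) - f x\<bar>" for \<tau>
      by (simp add: H_def steklov_kernel_eq abs_mult)
    have lk: "locally_integrable (\<lambda>\<tau>. steklov_kernel R f x (\<tau> - u * \<delta>))"
      by (rule steklov_kernel_locally_integrable[OF lf])
    have lH: "locally_Lp p H"
    proof (rule locally_Lp_of_bound)
      show "locally_integrable H"
        unfolding H_eq[abs_def] by (intro locally_integrable_abs locally_integrable_diff lk locally_integrable_const)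
      have "(\<lambda>\<tau>. \<bar>f (x + real i * (\<tau> - u * \<delta>))\<bar> powr p) integrable_on {c..d}" for i c d
      proof (cases "i = 0")
        case False
        then show ?thesis
          using f integrable_affine_real[of "\<lambda>x. \<bar>f x\<bar> powr p" "real i" c "x - real i * (u * \<delta>)" d]
          by (simp add: locally_Lp_def algebra_simps)
      qed (simp add: integrable_const_ivl)
      then show "(\<lambda>\<tau>. (2 ^ R) powr p * (real (R + 1) powr p * (\<Sum>i=0..R. \<bar>f (x + real i * (\<tau> - u * \<delta>))\<bar> powr p))) integrable_on {c..d}" for c d
        by (intro integrable_on_mult_right integrable_sum) auto
    qed (simp only: H_def abs_abs, rule abs_fwd_diff_powr_le, use p in simp)
    then have Hi: "H integrable_on {0..\<delta>}" "(\<lambda>\<tau>. H \<tau> powr p) integrable_on {0..\<delta>}"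
      by (auto simp: locally_Lp_def H_def intro: locally_integrableD(2))
    have "\<bar>g x - f x\<bar> \<le> integral {0..0 + real (Suc s) * (\<delta> / real R)} H / (\<delta> / real R)"
      using abs_mean_iterate_diff_const_le[OF lk, of "\<delta> / real R" s 0 "f x"] \<delta> R
      unfolding g_def steklov_deriv_0_eq_mean_iterate[OF lf \<delta>(1)] H_eq[abs_def]
      by (simp add: R_def u_def del: funpow.simps)
    then have "\<bar>f x - g x\<bar> \<le> real R * (integral {0..\<delta>} H / \<delta>)"
      by (simp add: R_def abs_minus_commute mult.commute)
    then have "\<bar>f x - g x\<bar> powr p \<le> real R powr p * (integral {0..\<delta>} H / \<delta>) powr p"
      using p powr_mono2[of p "\<bar>f x - g x\<bar>" "real R * (integral {0..\<delta>} H / \<delta>)"] unfolding powr_mult[of "real R"] by simp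
    also have "\<dots> \<le> real R powr p * (integral {0..\<delta>} (\<lambda>\<tau>. H \<tau> powr p) / \<delta>)"
      using mean_powr_le[OF p \<delta>(1) Hi] by (intro mult_left_mono) (auto simp: H_def)
    also have "\<dots> = c * integral {0..\<delta>} (\<lambda>\<tau>. H \<tau> powr p)" by (simp add: c_def)
    also have "integral {0..\<delta>} (\<lambda>\<tau>. H \<tau> powr p) = integral {- (u * \<delta>)..\<delta> - u * \<delta>} (\<lambda>\<theta>. \<bar>fwd_diff R \<theta> f x\<bar> powr p)"
      using integral_affine_real[of 1 0 \<delta> "\<lambda>\<theta>. \<bar>fwd_diff R \<theta> f x\<bar> powr p" "- (u * \<delta>)"] by (simp add: H_def)
    finally have le: "\<bar>f x - g x\<bar> powr p \<le> c * integral {- (u * \<delta>)..\<delta> - u * \<delta>} (\<lambda>\<theta>. \<bar>fwd_diff R \<theta> f x\<bar> powr p)" .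
    have "(\<lambda>\<theta>. \<bar>fwd_diff R \<theta> f x\<bar> powr p) integrable_on {- (u * \<delta>)..\<delta> - u * \<delta>}"
    proof -
      have "(\<lambda>\<tau>. H (1 * \<tau> + u * \<delta>) powr p) integrable_on {- (u * \<delta>)..\<delta> - u * \<delta>}"
        using Hi(2) by (intro integrable_affine_real[of "\<lambda>\<tau>. H \<tau> powr p"]) auto
      then show ?thesis by (simp add: H_def)
    qed
    then have eq: "ennreal (integral {- (u * \<delta>)..\<delta> - u * \<delta>} (\<lambda>\<theta>. \<bar>fwd_diff R \<theta> f x\<bar> powr p))
      = (\<integral>\<^sup>+\<theta>. ennreal (\<bar>fwd_diff R \<theta> f x\<bar> powr p) * indicator {- (u * \<delta>)..\<delta> - u * \<delta>} \<theta> \<partial>lborel)"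
      by (rule nn_integral_powr_Icc[symmetric])
    have "\<dots> \<le> (\<integral>\<^sup>+\<theta>. K x \<theta> \<partial>lborel)"
    proof (rule nn_integral_mono)
      fix \<theta>
      have "a \<le> x + real R * \<theta> \<and> x + real R * \<theta> \<le> b \<and> - \<delta> \<le> \<theta> \<and> \<theta> \<le> \<delta>" if \<theta>: "\<theta> \<in> {- (u * \<delta>)..\<delta> - u * \<delta>}"
      proof -
        have \<tau>: "\<theta> + u * \<delta> \<in> {0..\<delta>}" using \<theta> by auto
        have "0 \<le> real R * \<delta>" using \<delta> by simp
        then have "real R * \<delta> \<le> b - a" using \<delta> unfolding R_def[symmetric] mult.assoc by linarith
        then have "x + real R * (\<theta> + u * \<delta> - (x - a) / (b - a) * \<delta>) \<in> {a..b}"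
          by (intro sliding_window_mem[OF ab _ _ x \<tau>]) auto
        moreover have "\<bar>\<theta>\<bar> \<le> \<delta>" using sliding_parameter_bounds(1)[OF ab x \<tau>] by (simp add: u_def)
        ultimately show ?thesis by (auto simp: u_def)
      qed
      then show "ennreal (\<bar>fwd_diff R \<theta> f x\<bar> powr p) * indicator {- (u * \<delta>)..\<delta> - u * \<delta>} \<theta> \<le> K x \<theta>"
        using x by (auto simp: K_def indicator_def)
    qed
    then have "ennreal c * ennreal (integral {- (u * \<delta>)..\<delta> - u * \<delta>} (\<lambda>\<theta>. \<bar>fwd_diff R \<theta> f x\<bar> powr p)) \<le> ennreal c * (\<integral>\<^sup>+\<theta>. K x \<theta> \<partial>lborel)"
      unfolding eq by (intro mult_left_mono) auto
    moreover have "ennreal (\<bar>f x - g x\<bar> powr p) \<le> ennreal c * ennreal (integral {- (u * \<delta>)..\<delta> - u * \<delta>} (\<lambda>\<theta>. \<bar>fwd_diff R \<theta> f x\<bar> powr p))"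
      using le \<delta> by (subst ennreal_mult'[symmetric]) (auto simp: c_def intro: ennreal_leI)
    ultimately have "ennreal (\<bar>f x - g x\<bar> powr p) \<le> ennreal c * (\<integral>\<^sup>+\<theta>. K x \<theta> \<partial>lborel)"
      by (rule order_trans[rotated])
    then show ?thesis using x by simp
  qed simp
  have i: "(\<lambda>x. \<bar>f x - g x\<bar> powr p) integrable_on {a..b}" using fg by (simp add: g_def Lp_space_iff)
  have [measurable]: "(\<lambda>x. \<integral>\<^sup>+\<theta>. K x \<theta> \<partial>lborel) \<in> borel_measurable lborel"
  proof -
    have "(\<lambda>(x, \<theta>). K x \<theta>) \<in> borel_measurable (borel \<Otimes>\<^sub>M borel)"
      unfolding K_def fwd_diff_def using fB by measurable
    then have "case_prod K \<in> borel_measurable (lborel \<Otimes>\<^sub>M lborel)"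
      by (simp cong: measurable_cong_sets)
    then show ?thesis by (rule lborel.borel_measurable_nn_integral)
  qed
  have "ennreal (integral {a..b} (\<lambda>x. \<bar>f x - g x\<bar> powr p)) = (\<integral>\<^sup>+x. ennreal (\<bar>f x - g x\<bar> powr p) * indicator {a..b} x \<partial>lborel)"
    by (rule nn_integral_powr_Icc[OF i, symmetric])
  also have "\<dots> \<le> (\<integral>\<^sup>+x. ennreal c * (\<integral>\<^sup>+\<theta>. K x \<theta> \<partial>lborel) \<partial>lborel)"
    by (intro nn_integral_mono pt)
  also have "\<dots> = ennreal c * (\<integral>\<^sup>+x. (\<integral>\<^sup>+\<theta>. K x \<theta> \<partial>lborel) \<partial>lborel)"
    by (rule nn_integral_cmult) simp
  also have "\<dots> \<le> ennreal c * ennreal (2 * \<delta> * (8 * \<omega>) powr p)" by (intro mult_left_mono K) auto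
  also have "\<dots> = ennreal (c * (2 * \<delta> * (8 * \<omega>) powr p))"
    using \<delta> by (subst ennreal_mult'[symmetric]) (auto simp: c_def)
  finally have "integral {a..b} (\<lambda>x. \<bar>f x - g x\<bar> powr p) \<le> c * (2 * \<delta> * (8 * \<omega>) powr p)"
    using \<delta> by (subst (asm) ennreal_le_iff) (auto simp: c_def)
  also have "\<dots> = 2 powr 1 * real R powr p * (8 * \<omega>) powr p" using \<delta> by (simp add: c_def)
  also have "\<dots> \<le> 2 powr p * real R powr p * (8 * \<omega>) powr p"
    using p by (intro mult_right_mono powr_mono) auto
  also have "\<dots> = (2 * real R * (8 * \<omega>)) powr p" by (simp only: powr_mult)
  finally have "Lp_norm p {a..b} (\<lambda>x. f x - g x) \<le> 2 * real R * (8 * \<omega>)"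
    using p \<omega> by (subst Lp_norm_le_iff) auto
  then show ?thesis by (simp only: g_def R_def)
qed

lemma Lp_norm_spike:
  assumes "negligible N" "\<And>x. x \<in> {c..d} - N \<Longrightarrow> u x = v x"
  shows "Lp_norm p {c..d} u = Lp_norm p {c..d} v"
  unfolding Lp_norm_eq using integral_spike[OF assms(1), of "{c..d}" "\<lambda>x. \<bar>v x\<bar> powr p" "\<lambda>x. \<bar>u x\<bar> powr p"] assms(2) by simp

text \<open>
  Johnen's inequality. The Steklov average of order \<open>s + 1\<close>, rather than \<open>s\<close>, has a continuous derivative
  of order \<open>s\<close>, so that Lebesgue's differentiation theorem is avoided. Changing \<open>f\<close> on a null set changes neither the
  norms nor the modulus of smoothness, so a Borel representative may be averaged.
\<close>
lemma modulus_Sobolev_approximation: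
  assumes ab: "a < b" and s: "1 \<le> s" and p: "1 \<le> p"
  shows "\<exists>C>0. \<forall>f\<in>Lp_space p {a..b}. \<forall>n\<ge>1. \<exists>g\<in>Sobolev p a b s.
    Lp_norm p {a..b} (\<lambda>x. f x - g x) + real n powi (- int s) * Lp_norm p {a..b} (nth_deriv a b s g)
      \<le> C * modulus p a b s f (1 / real n)"
proof -
  \<comment> \<open>The step \<open>\<delta> = c / n\<close> is at most \<open>1 / n\<close>, and it is short enough for the contraction factors even if \<open>1 / n\<close> exceeds \<open>b - a\<close>.\<close>
  define c where "c = min 1 ((b - a) / (2 * real (s + 1)))"
  have c: "0 < c" "c \<le> 1" "2 * real (s + 1) * c \<le> b - a"
  proof -
    show "0 < c" "c \<le> 1" using ab by (auto simp: c_def)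
    have "c \<le> (b - a) / (2 * real (s + 1))" by (simp add: c_def)
    then show "2 * real (s + 1) * c \<le> b - a"
      by (subst (asm) pos_le_divide_eq) (auto simp: mult.commute)
  qed
  define C1 where "C1 = 2 * real (s + 1) * 8"
  define C2 where "C2 = 2 ^ (s + 1) * real (s + 1) ^ s * (2 * real (s + 1) * real (s + 1))"
  define C where "C = C1 + C2 / c ^ s"
  have "0 < C" using c by (auto simp: C_def C1_def C2_def intro!: add_pos_nonneg)
  moreover have "\<exists>g\<in>Sobolev p a b s.
    Lp_norm p {a..b} (\<lambda>x. f x - g x) + real n powi (- int s) * Lp_norm p {a..b} (nth_deriv a b s g)
      \<le> C * modulus p a b s f (1 / real n)" if f: "f \<in> Lp_space p {a..b}" and n: "1 \<le> n" for f n
  proof -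
    define \<omega> where "\<omega> = modulus p a b s f (1 / real n)"
    define \<delta> where "\<delta> = c / real n"
    have \<delta>: "0 < \<delta>" "\<delta> \<le> 1 / real n" "2 * real (s + 1) * \<delta> \<le> b - a"
    proof -
      show "0 < \<delta>" "\<delta> \<le> 1 / real n" using c n by (auto simp: \<delta>_def intro!: divide_right_mono)
      have "\<delta> \<le> c / 1" unfolding \<delta>_def using c n by (intro divide_left_mono) auto
      then have "2 * real (s + 1) * \<delta> \<le> 2 * real (s + 1) * c" by (intro mult_left_mono) auto
      then show "2 * real (s + 1) * \<delta> \<le> b - a" using c by linarith
    qed
    have f_\<omega>: "Lp_norm p {a..b - real s * h} (fwd_diff s h f) \<le> \<omega>" if "0 < h" "h \<le> \<delta>" for h
      unfolding \<omega>_def using that \<delta> by (intro Lp_norm_fwd_diff_le_modulus p s f) auto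
    have \<omega>0: "0 \<le> \<omega>" using f_\<omega>[OF \<delta>(1)] Lp_norm_nonneg[of p "{a..b - real s * \<delta>}" "fwd_diff s \<delta> f"] by linarith
    define f0 where "f0 = restrict_zero a b f"
    have "f0 \<in> borel_measurable lebesgue"
      using f borel_measurable_if[of "{a..b}" f] by (simp add: f0_def restrict_zero_def[abs_def] Lp_space_iff)
    then obtain f1 where f1: "f1 \<in> borel_measurable borel" and ae: "AE x in lborel. f0 x = f1 x"
      using completion_ex_borel_measurable_real[of f0 lborel] by auto
    from AE_completion[OF ae] obtain N where N: "negligible N" and sub: "{x. f0 x \<noteq> f1 x} \<subseteq> N"
      unfolding eventually_ae_filter_negligible by auto
    have f1_eq: "f1 x = f0 x" if "x \<notin> N" for x
    proof (rule ccontr)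
      assume "f1 x \<noteq> f0 x"
      then have "x \<in> {x. f0 x \<noteq> f1 x}" by simp
      then show False using sub that by blast
    qed
    have lf0: "locally_Lp p f0" unfolding f0_def using f p by (rule locally_Lp_restrict_zero)
    have lf1: "locally_Lp p f1"
      unfolding locally_Lp_def locally_integrable_def
    proof (intro conjI allI)
      fix c d
      show "f1 absolutely_integrable_on {c..d}"
        by (rule absolutely_integrable_spike[OF _ N f1_eq])
          (use lf0 in \<open>auto simp: locally_Lp_def intro: locally_integrableD\<close>)
      show "(\<lambda>x. \<bar>f1 x\<bar> powr p) integrable_on {c..d}"
        by (rule integrable_spike[OF _ N, of "\<lambda>x. \<bar>f0 x\<bar> powr p"]) (use lf0 f1_eq in \<open>auto simp: locally_Lp_def\<close>)
    qed
    have f1_\<omega>: "Lp_norm p {a..b - real s * h} (fwd_diff s h f1) \<le> \<omega>" if h: "0 < h" "h \<le> \<delta>" for h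
    proof -
      \<comment> \<open>The points at which some node of the difference meets the null set.\<close>
      let ?N = "\<Union>i\<in>{0..s}. (+) (- (real i * h)) ` N"
      have "negligible ?N"
      proof (rule negligible_Union)
        fix t assume "t \<in> (\<lambda>i. (+) (- (real i * h)) ` N) ` {0..s}"
        then obtain i where "t = (+) (- (real i * h)) ` N" by blast
        then show "negligible t" using negligible_translation[OF N] by blast
      qed simp
      moreover have "fwd_diff s h f1 x = fwd_diff s h f x" if x: "x \<in> {a..b - real s * h} - ?N" for x
      proof (rule fwd_diff_cong)
        fix j assume j: "j \<le> s"
        have "x + real j * h \<notin> N"
        proof
          assume "x + real j * h \<in> N"
          then have "- (real j * h) + (x + real j * h) \<in> (+) (- (real j * h)) ` N" by (rule imageI)
          then have "x \<in> ?N" using j by auto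
          then show False using x by simp
        qed
        moreover have "real j * h \<le> real s * h" "0 \<le> real j * h" using j h by auto
        then have "x + real j * h \<in> {a..b}" using x by auto
        ultimately show "f1 (x + real j * h) = f (x + real j * h)" by (simp add: f1_eq f0_def del: atLeastAtMost_iff)
      qed
      ultimately have "Lp_norm p {a..b - real s * h} (fwd_diff s h f1) = Lp_norm p {a..b - real s * h} (fwd_diff s h f)"
        by (rule Lp_norm_spike)
      then show ?thesis using f_\<omega>[OF h] by simp
    qed
    have li1: "locally_integrable f1" using lf1 by (simp add: locally_Lp_def)
    let ?G = "steklov_deriv a b \<delta> s f1"
    have G: "?G 0 \<in> Sobolev p a b s" "\<And>x. x \<in> {a..b} \<Longrightarrow> nth_deriv a b s (?G 0) x = ?G s x"
    proof -
      have der: "(?G j has_vector_derivative ?G (Suc j) x) (at x within {a..b})" if "j < s" "x \<in> {a..b}" for j x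
        using steklov_deriv_has_vector_derivative[OF li1 \<delta>(1) that(1)] by (rule has_vector_derivative_at_within)
      have "continuous_on {a..b} (?G s)"
        by (rule continuous_on_subset[OF steklov_deriv_continuous[OF li1 \<delta>(1)]]) simp
      then show "?G 0 \<in> Sobolev p a b s" "\<And>x. x \<in> {a..b} \<Longrightarrow> nth_deriv a b s (?G 0) x = ?G s x"
        using smooth_imp_Sobolev[OF ab s p, of ?G] der by blast+
    qed
    have "Lp_norm p {a..b} (\<lambda>x. f x - ?G 0 x) = Lp_norm p {a..b} (\<lambda>x. f1 x - ?G 0 x)"
      by (rule Lp_norm_spike[OF N]) (simp add: f1_eq f0_def)
    also have "\<dots> \<le> 2 * real (s + 1) * (8 * \<omega>)"
      using Sobolev_in_Lp_space[OF G(1) s p] locally_Lp_imp_Lp_space[OF lf1] p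
      by (intro Lp_norm_minus_steklov_deriv_le ab f1 lf1 \<delta> \<omega>0 f1_\<omega> Lp_space_diff)
    finally have A: "Lp_norm p {a..b} (\<lambda>x. f x - ?G 0 x) \<le> C1 * \<omega>" by (simp only: C1_def mult.assoc)
    have "Lp_norm p {a..b} (nth_deriv a b s (?G 0)) = Lp_norm p {a..b} (?G s)"
      by (rule Lp_norm_spike[of "{}"]) (simp_all add: G)
    also have "\<dots> \<le> C2 / \<delta> ^ s * \<omega>"
      unfolding C2_def by (rule Lp_norm_steklov_deriv_le[OF ab s p lf1 \<delta>(1,3) \<omega>0 f1_\<omega>])
    finally have "real n powi (- int s) * Lp_norm p {a..b} (nth_deriv a b s (?G 0)) \<le> real n powi (- int s) * (C2 / \<delta> ^ s * \<omega>)"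
      by (intro mult_left_mono) auto
    also have "\<dots> = C2 / c ^ s * \<omega>"
      using n c by (simp add: \<delta>_def power_divide power_int_minus divide_simps)
    finally have "Lp_norm p {a..b} (\<lambda>x. f x - ?G 0 x) + real n powi (- int s) * Lp_norm p {a..b} (nth_deriv a b s (?G 0)) \<le> C * \<omega>"
      using A by (simp add: C_def distrib_right)
    then show ?thesis using G(1) unfolding \<omega>_def by blast
  qed
  ultimately show ?thesis by blast
qed


section \<open>Measurability of the local modulus\<close>

text \<open>
  The gaps to the right of the points are disjoint open intervals.
\<close>
lemma countable_right_isolated:
  fixes E :: "real set"
  assumes "\<And>x. x \<in> E \<Longrightarrow> \<exists>y>x. {x<..<y} \<inter> E = {}"
  shows "countable E"
proof -
  obtain Y where Y: "\<And>x. x \<in> E \<Longrightarrow> x < Y x" "\<And>x. x \<in> E \<Longrightarrow> {x<..<Y x} \<inter> E = {}"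
    using assms by metis
  have disj: "{x<..<Y x} \<inter> {z<..<Y z} = {}" if "x \<in> E" "z \<in> E" "x < z" for x z
  proof -
    have "z \<notin> {x<..<Y x}" using Y(2)[OF that(1)] that(2) by blast
    then show ?thesis using that(3) by auto
  qed
  have ne: "{x<..<Y x} \<noteq> {}" if "x \<in> E" for x using Y(1)[OF that] dense by force
  let ?F = "(\<lambda>x. {x<..<Y x}) ` E"
  have "countable ?F"
  proof (rule countable_disjoint_open_subsets)
    show "disjoint ?F"
      unfolding disjoint_def
    proof (intro ballI impI)
      fix A B assume AB: "A \<in> ?F" "B \<in> ?F" "A \<noteq> B"
      then obtain x z where xz: "x \<in> E" "z \<in> E" "A = {x<..<Y x}" "B = {z<..<Y z}" by blast
      then have "x \<noteq> z" using AB(3) by blast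
      then consider "x < z" | "z < x" by linarith
      then show "A \<inter> B = {}"
        using disj[OF xz(1,2)] disj[OF xz(2,1)] unfolding xz(3,4) by cases blast+
    qed
  qed auto
  moreover have "inj_on (\<lambda>x. {x<..<Y x}) E"
  proof (rule inj_onI)
    fix x z assume xz: "x \<in> E" "z \<in> E" "{x<..<Y x} = {z<..<Y z}"
    show "x = z"
    proof (rule ccontr)
      assume "x \<noteq> z"
      then have "{x<..<Y x} \<inter> {z<..<Y z} = {}" using disj[OF xz(1,2)] disj[OF xz(2,1)] by (cases "x < z") auto
      then show False using xz ne[OF xz(1)] by simp
    qed
  qed
  ultimately show ?thesis using countable_image_inj_on by blast
qed

text \<open>
  The union differs from the union of the open intervals by end points only, and the left (right) end points outside the
  open union are isolated from the right (left).
\<close>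
lemma Union_intervals_borel:
  fixes \<alpha> \<beta> :: "'i \<Rightarrow> real"
  assumes "\<And>i. i \<in> I \<Longrightarrow> \<alpha> i < \<beta> i"
  shows "(\<Union>i\<in>I. {\<alpha> i..\<beta> i}) \<in> sets borel"
proof -
  let ?S = "\<Union>i\<in>I. {\<alpha> i..\<beta> i}"
  define U where "U = (\<Union>i\<in>I. {\<alpha> i<..<\<beta> i})"
  define El where "El = {x \<in> ?S - U. \<exists>i\<in>I. x = \<alpha> i}"
  define Er where "Er = {x \<in> ?S - U. \<exists>i\<in>I. x = \<beta> i}"
  have "countable El"
  proof (rule countable_right_isolated)
    fix x assume "x \<in> El"
    then obtain i where i: "i \<in> I" "x = \<alpha> i" by (auto simp: El_def)
    then have "{x<..<\<beta> i} \<subseteq> U" by (auto simp: U_def)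
    moreover have "El \<inter> U = {}" by (auto simp: El_def)
    ultimately show "\<exists>y>x. {x<..<y} \<inter> El = {}" using assms[OF i(1)] i(2) by blast
  qed
  moreover have "countable (uminus ` Er)"
  proof (rule countable_right_isolated)
    fix x assume "x \<in> uminus ` Er"
    then obtain i where i: "i \<in> I" "x = - \<beta> i" by (auto simp: Er_def)
    have "{x<..<- \<alpha> i} \<inter> uminus ` Er = {}"
      using i by (fastforce simp: Er_def U_def)
    then show "\<exists>y>x. {x<..<y} \<inter> uminus ` Er = {}" using assms[OF i(1)] i(2) by (intro exI[of _ "- \<alpha> i"]) simp
  qed
  then have "countable Er"
    by (rule countable_image_inj_on) simp
  moreover have "?S = U \<union> (El \<union> Er)"
    by (force simp: U_def El_def Er_def)
  moreover have "open U" unfolding U_def by auto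
  ultimately have "?S = U \<union> (El \<union> Er)" "U \<in> sets borel" "El \<in> sets borel" "Er \<in> sets borel"
    by (auto intro: sets.countable borel_open)
  then show ?thesis by (metis sets.Un)
qed

lemma bounded_fwd_diff:
  fixes f :: "real \<Rightarrow> real"
  assumes M: "\<And>y. y \<in> {a..b} \<Longrightarrow> \<bar>f y\<bar> \<le> M" and t: "t \<in> {a..b}" "t + real s * h \<in> {a..b}"
  shows "\<bar>fwd_diff s h f t\<bar> \<le> 2 ^ s * (real (s + 1) * M)"
proof -
  have "\<bar>f (t + real i * h)\<bar> \<le> M" if i: "i \<in> {0..s}" for i
  proof (rule M)
    show "t + real i * h \<in> {a..b}"
    proof (cases "0 \<le> h")
      case True
      then have "real i * h \<le> real s * h" "0 \<le> real i * h" using i by (auto intro: mult_right_mono)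
      then show ?thesis using t by auto
    next
      case False
      then have "real s * h \<le> real i * h" "real i * h \<le> 0" using i by (auto intro: mult_right_mono_neg mult_nonneg_nonpos)
      then show ?thesis using t by auto
    qed
  qed
  then have "(\<Sum>i=0..s. \<bar>f (t + real i * h)\<bar>) \<le> (\<Sum>i=0..s. M)" by (rule sum_mono)
  then have "2 ^ s * (\<Sum>i=0..s. \<bar>f (t + real i * h)\<bar>) \<le> 2 ^ s * (real (s + 1) * M)"
    by (intro mult_left_mono) (auto simp: add.commute)
  then show ?thesis using abs_fwd_diff_le[of s h f t] by linarith
qed

text \<open>
  The window of the local modulus is an intersection; unfolded into separate memberships, each of them can be
  supplied or used on its own.
\<close>
definition window_diffs :: "real \<Rightarrow> real \<Rightarrow> real \<Rightarrow> nat \<Rightarrow> (real \<Rightarrow> real) \<Rightarrow> real \<Rightarrow> real set" where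
  "window_diffs a b \<delta> s f x = {\<bar>fwd_diff s h f t\<bar> | t h.
     t \<in> {x - real s * \<delta> / 2..x + real s * \<delta> / 2} \<and> t \<in> {a..b} \<and>
     t + real s * h \<in> {x - real s * \<delta> / 2..x + real s * \<delta> / 2} \<and> t + real s * h \<in> {a..b}}"

lemma local_modulus_alt: "local_modulus a b s f x \<delta> = Sup (window_diffs a b \<delta> s f x)"
  unfolding local_modulus_def window_diffs_def Let_def by (rule arg_cong[where f = Sup]) auto

context
  fixes a b \<delta> :: real and s :: nat and f :: "real \<Rightarrow> real"
  assumes s: "1 \<le> s" and \<delta>: "0 < \<delta>" and bdd: "bounded (f ` {a..b})"
begin

lemma window_diffs_bdd_above: "bdd_above (window_diffs a b \<delta> s f x)"
proof -
  obtain M where M: "\<forall>y\<in>{a..b}. \<bar>f y\<bar> \<le> M" using bdd unfolding bounded_iff by auto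
  show ?thesis
    unfolding window_diffs_def
    by (rule bdd_aboveI[of _ "2 ^ s * (real (s + 1) * M)"]) (use bounded_fwd_diff M in blast)
qed

lemma abs_fwd_diff_le_local_modulus:
  assumes "t \<in> {x - real s * \<delta> / 2..x + real s * \<delta> / 2}" "t \<in> {a..b}"
    "t + real s * h \<in> {x - real s * \<delta> / 2..x + real s * \<delta> / 2}" "t + real s * h \<in> {a..b}"
  shows "\<bar>fwd_diff s h f t\<bar> \<le> local_modulus a b s f x \<delta>"
  unfolding local_modulus_alt
  by (rule cSup_upper[OF _ window_diffs_bdd_above]) (use assms in \<open>unfold window_diffs_def, blast\<close>)

lemma local_modulus_nonneg:
  assumes "x \<in> {a..b}"
  shows "0 \<le> local_modulus a b s f x \<delta>"
  using abs_fwd_diff_le_local_modulus[of x x 0] assms \<delta> s by (simp add: fwd_diff_zero_step)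

lemma less_local_modulus_iff:
  assumes "x \<in> {a..b}"
  shows "c < local_modulus a b s f x \<delta> \<longleftrightarrow> (\<exists>t h.
     t \<in> {x - real s * \<delta> / 2..x + real s * \<delta> / 2} \<and> t \<in> {a..b} \<and>
     t + real s * h \<in> {x - real s * \<delta> / 2..x + real s * \<delta> / 2} \<and> t + real s * h \<in> {a..b} \<and>
     c < \<bar>fwd_diff s h f t\<bar>)"
  unfolding local_modulus_alt
proof (subst less_cSup_iff[OF _ window_diffs_bdd_above])
  have "x \<in> {x - real s * \<delta> / 2..x + real s * \<delta> / 2}" using \<delta> by simp
  then have "\<bar>fwd_diff s 0 f x\<bar> \<in> window_diffs a b \<delta> s f x"
    unfolding window_diffs_def using assms by (intro CollectI exI[of _ x] exI[of _ 0]) auto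
  then show "window_diffs a b \<delta> s f x \<noteq> {}" by blast
qed (unfold window_diffs_def, blast)

text \<open>
  The points where the local modulus exceeds a level \<open>c\<close> form a union of intervals, one for each
  difference exceeding \<open>c\<close>. Such an interval degenerates to a point only if the step is \<open>\<delta>\<close> or
  \<open>- \<delta>\<close>; these points form a level set of a single measurable difference.
\<close>
lemma local_modulus_measurable:
  assumes f: "f absolutely_integrable_on {a..b}"
  shows "(\<lambda>x. local_modulus a b s f x \<delta>) \<in> borel_measurable (lebesgue_on {a..b})"
proof (subst borel_measurable_iff_greater, intro allI)
  fix c
  define L where "L = real s * \<delta> / 2"
  have L: "0 < L" "real s * \<delta> = 2 * L" using s \<delta> by (auto simp: L_def)
  define Q where "Q = {(t, h). t \<in> {a..b} \<and> t + real s * h \<in> {a..b} \<and> c < \<bar>fwd_diff s h f t\<bar> \<and> \<bar>h\<bar> < \<delta>}"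
  define lo where "lo = (\<lambda>(t, h). max t (t + real s * h) - L)"
  define hi where "hi = (\<lambda>(t, h). min t (t + real s * h) + L)"
  define S1 where "S1 = (\<Union>q\<in>Q. {lo q..hi q})"
  define f0 where "f0 = restrict_zero a b f"
  define S2 where "S2 = {x \<in> {a + L..b - L}. c < \<bar>fwd_diff s \<delta> f0 (x - L)\<bar>}"
  have "S1 \<in> sets borel"
    unfolding S1_def
  proof (rule Union_intervals_borel)
    fix q assume "q \<in> Q"
    then obtain t h where q: "q = (t, h)" "\<bar>h\<bar> < \<delta>" by (auto simp: Q_def)
    have "\<bar>real s * h\<bar> < real s * \<delta>" using q s by (simp add: abs_mult)
    then show "lo q < hi q" using L by (auto simp: q(1) lo_def hi_def)
  qed
  then have S1: "S1 \<in> sets lebesgue" by simp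
  have S2: "S2 \<in> sets lebesgue"
  proof -
    have "locally_integrable (\<lambda>x. fwd_diff s \<delta> f0 (1 * x + (- L)))"
      unfolding f0_def using f by (intro locally_integrable_affine fwd_diff_locally_integrable restrict_zero_locally_integrable) auto
    then have "(\<lambda>x. fwd_diff s \<delta> f0 (x - L)) \<in> borel_measurable (lebesgue_on {a + L..b - L})"
      using locally_integrable_measurable by simp
    then have "(\<lambda>x. \<bar>fwd_diff s \<delta> f0 (x - L)\<bar>) \<in> borel_measurable (lebesgue_on {a + L..b - L})"
      by measurable
    then have "S2 \<in> sets (lebesgue_on {a + L..b - L})"
      unfolding S2_def borel_measurable_iff_greater by simp
    then show ?thesis by (simp add: sets_restrict_space_iff)
  qed
  have f0_eq: "fwd_diff s \<delta> f0 t = fwd_diff s \<delta> f t" if "t \<in> {a..b}" "t + real s * \<delta> \<in> {a..b}" for t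
  proof (rule fwd_diff_cong)
    fix j assume "j \<le> s"
    then have "real j * \<delta> \<le> real s * \<delta>" "0 \<le> real j * \<delta>" using \<delta> by auto
    then have "t + real j * \<delta> \<in> {a..b}" using that by auto
    then show "f0 (t + real j * \<delta>) = f (t + real j * \<delta>)" unfolding f0_def by (rule restrict_zero_in)
  qed
  have "{x \<in> space (lebesgue_on {a..b}). c < local_modulus a b s f x \<delta>} = {a..b} \<inter> (S1 \<union> S2)"
  proof (intro equalityI subsetI)
    fix x assume "x \<in> {x \<in> space (lebesgue_on {a..b}). c < local_modulus a b s f x \<delta>}"
    then have x: "x \<in> {a..b}" "c < local_modulus a b s f x \<delta>" by auto
    then obtain t h where th: "t \<in> {x - L..x + L}" "t \<in> {a..b}" "t + real s * h \<in> {x - L..x + L}"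
        "t + real s * h \<in> {a..b}" "c < \<bar>fwd_diff s h f t\<bar>"
      using less_local_modulus_iff[OF x(1)] unfolding L_def by auto
    have "\<bar>real s * h\<bar> \<le> real s * \<delta>" using th L by auto
    then have "\<bar>h\<bar> \<le> \<delta>" using s by (simp add: abs_mult)
    then consider "\<bar>h\<bar> < \<delta>" | "h = \<delta>" | "h = - \<delta>" by linarith
    then have "x \<in> S1 \<union> S2"
    proof cases
      case 1
      then have "(t, h) \<in> Q" using th by (simp add: Q_def)
      moreover have "x \<in> {lo (t, h)..hi (t, h)}" using th by (auto simp: lo_def hi_def)
      ultimately show ?thesis unfolding S1_def by blast
    next
      case 2
      then have t: "t = x - L" "t + real s * \<delta> = x + L" using th L by auto
      then have "x \<in> S2" using th 2 f0_eq[of t] unfolding S2_def by auto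
      then show ?thesis by simp
    next
      case 3
      then have t: "t = x + L" "t - real s * \<delta> = x - L" using th L by auto
      then have "\<bar>fwd_diff s (- \<delta>) f t\<bar> = \<bar>fwd_diff s \<delta> f0 (x - L)\<bar>"
        using abs_fwd_diff_symmetric[of s \<delta> f t] f0_eq[of "x - L"] th 3 L by auto
      then have "x \<in> S2" using th 3 t unfolding S2_def by auto
      then show ?thesis by simp
    qed
    then show "x \<in> {a..b} \<inter> (S1 \<union> S2)" using x by simp
  next
    fix x assume x: "x \<in> {a..b} \<inter> (S1 \<union> S2)"
    have "\<exists>t h. t \<in> {x - L..x + L} \<and> t \<in> {a..b} \<and> t + real s * h \<in> {x - L..x + L} \<and>
        t + real s * h \<in> {a..b} \<and> c < \<bar>fwd_diff s h f t\<bar>"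
    proof (cases "x \<in> S1")
      case True
      then obtain t h where "(t, h) \<in> Q" "x \<in> {lo (t, h)..hi (t, h)}" by (auto simp: S1_def)
      then show ?thesis by (intro exI[of _ t] exI[of _ h]) (auto simp: Q_def lo_def hi_def)
    next
      case False
      then have "x \<in> {a + L..b - L}" "c < \<bar>fwd_diff s \<delta> f0 (x - L)\<bar>" using x by (auto simp: S2_def)
      then show ?thesis using L f0_eq[of "x - L"]
        by (intro exI[of _ "x - L"] exI[of _ \<delta>]) auto
    qed
    then have "c < local_modulus a b s f x \<delta>"
      using less_local_modulus_iff[of x c] x unfolding L_def by auto
    then show "x \<in> {x \<in> space (lebesgue_on {a..b}). c < local_modulus a b s f x \<delta>}" using x by simp
  qed
  then show "{x \<in> space (lebesgue_on {a..b}). c < local_modulus a b s f x \<delta>} \<in> sets (lebesgue_on {a..b})"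
    using S1 S2 by (auto simp: sets_restrict_space)
qed

lemma local_modulus_Lp_space:
  assumes f: "f absolutely_integrable_on {a..b}" and p: "1 \<le> p"
  shows "(\<lambda>x. local_modulus a b s f x \<delta>) \<in> Lp_space p {a..b}"
proof -
  obtain M where M: "\<forall>y\<in>{a..b}. \<bar>f y\<bar> \<le> M" using bdd unfolding bounded_iff by auto
  let ?B = "2 ^ s * (real (s + 1) * M)"
  have "local_modulus a b s f x \<delta> \<le> ?B" if x: "x \<in> {a..b}" for x
  proof (rule ccontr)
    assume "\<not> ?thesis"
    then have "?B < local_modulus a b s f x \<delta>" by simp
    then obtain t h where "t \<in> {a..b}" "t + real s * h \<in> {a..b}" "?B < \<bar>fwd_diff s h f t\<bar>"
      unfolding less_local_modulus_iff[OF x] by blast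
    then show False using bounded_fwd_diff[of a b f M t s h] M by auto
  qed
  then have "\<bar>local_modulus a b s f x \<delta>\<bar> powr p \<le> ?B powr p" if "x \<in> {a..b}" for x
    using that p local_modulus_nonneg[OF that] by (intro powr_mono2) auto
  then show ?thesis
    by (intro Lp_space_bounded_by[OF local_modulus_measurable[OF f], of "\<lambda>_. ?B powr p"] integrable_const_ivl)
qed

text \<open>
  A difference with step at most \<open>\<delta>\<close> is bounded by the local modulus at the midpoint of its nodes, which is a
  translate of \<open>t\<close> by a constant.
\<close>
lemma modulus_le_averaged_modulus:
  assumes f: "f absolutely_integrable_on {a..b}" and p: "1 \<le> p"
  shows "modulus p a b s f \<delta> \<le> averaged_modulus p a b s f \<delta>"
  unfolding modulus_def
proof (rule cSUP_least)
  fix h assume h: "h \<in> {0<..\<delta>}"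
  define w where "w = (\<lambda>x. \<bar>local_modulus a b s f x \<delta>\<bar> powr p)"
  define c where "c = real s * h / 2"
  have w: "w integrable_on {a..b}" using local_modulus_Lp_space[OF f p] by (simp add: w_def Lp_space_iff)
  have "real s * h \<le> real s * \<delta>" using h by (intro mult_left_mono) auto
  then have c: "0 \<le> c" "real s * h = 2 * c" "c \<le> real s * \<delta> / 2" using h by (auto simp: c_def)
  have wi: "w integrable_on {a + c..b - real s * h + c}"
    using w c by (rule_tac integrable_on_subinterval[of w "{a..b}"]) auto
  show "Lp_norm p {a..b - real s * h} (fwd_diff s h f) \<le> averaged_modulus p a b s f \<delta>"
  proof (rule Lp_norm_le_of_integral_le[OF p])
    show "(\<lambda>t. w (1 * t + c)) integrable_on {a..b - real s * h}"
      using wi by (intro integrable_affine_real) auto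
    have "integral {a..b - real s * h} (\<lambda>t. w (1 * t + c)) = integral {a + c..b - real s * h + c} w"
      by (subst integral_affine_real) auto
    also have "\<dots> \<le> integral {a..b} w"
      using c by (intro integral_subset_le wi w) (auto simp: w_def)
    also have "\<dots> = averaged_modulus p a b s f \<delta> powr p"
      by (simp add: averaged_modulus_def Lp_norm_powr[OF p] w_def)
    finally show "integral {a..b - real s * h} (\<lambda>t. w (1 * t + c)) \<le> averaged_modulus p a b s f \<delta> powr p" .
    fix t assume t: "t \<in> {a..b - real s * h}"
    have "\<bar>fwd_diff s h f t\<bar> \<le> local_modulus a b s f (t + c) \<delta>"
      using t c by (intro abs_fwd_diff_le_local_modulus) auto
    then show "\<bar>fwd_diff s h f t\<bar> powr p \<le> w (1 * t + c)"
      unfolding w_def using p by (intro powr_mono2) auto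
  qed (simp add: averaged_modulus_def)
qed (use \<delta> in auto)

text \<open>
  A difference of order \<open>r\<close> is a combination of differences of order \<open>s\<close> with the nodes \<open>x + i * \<theta>, ..., x + (i + s) * \<theta>\<close>,
  whose midpoint is \<open>x + (i + s / 2) * \<theta>\<close>. For \<open>\<bar>\<theta>\<bar> = \<delta>\<close> no other point can serve as centre of a local modulus,
  so for a single step the bound would involve a single value of the local modulus; it is the integration over
  \<open>\<theta>\<close> that produces its mean.
\<close>
lemma abs_steklov_minus_le_local_modulus:
  fixes p :: real
  assumes ab: "a < b" and r: "s \<le> r" and f: "f absolutely_integrable_on {a..b}" and p: "1 \<le> p"
    and d: "0 < d" "d \<le> \<delta>" "d \<le> (b - a) / real r" and x: "x \<in> {a..b}"
  shows "\<bar>steklov a b d r f x - f x\<bar> \<le> real r * (2 ^ r * (real (r + 1) * 2)) * (1 / d) *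
    integral {x - real r * d..x + real r * d} (\<lambda>t. \<bar>restrict_zero a b (\<lambda>x. local_modulus a b s f x \<delta>) t\<bar>)"
proof -
  have r1: "1 \<le> r" using s r by simp
  define u where "u = (x - a) / (b - a)"
  define f0 where "f0 = restrict_zero a b f"
  define \<omega> where "\<omega> = (\<lambda>t. \<bar>restrict_zero a b (\<lambda>x. local_modulus a b s f x \<delta>) t\<bar>)"
  have lf: "locally_integrable f0" unfolding f0_def using f by (rule restrict_zero_locally_integrable)
  have l\<omega>: "locally_integrable \<omega>"
    unfolding \<omega>_def using local_modulus_Lp_space[OF f p] p
    by (intro locally_integrable_abs restrict_zero_locally_integrable Lp_space_absolutely_integrable)
  \<comment> \<open>The midpoint of the nodes of the \<open>i\<close>-th difference of order \<open>s\<close> is \<open>x + \<kappa> i * \<theta>\<close>.\<close>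
  define \<kappa> where "\<kappa> i = real i + real s / 2" for i :: nat
  have \<kappa>: "1 / 2 \<le> \<kappa> i" "\<kappa> i \<le> real r" if "i \<in> {0..r - s}" for i
    using that s r by (auto simp: \<kappa>_def)
  have bound: "\<bar>steklov_kernel r f0 x (\<tau> - u * d) - f x\<bar> \<le> 2 ^ r * (\<Sum>i=0..r - s. \<omega> (x + \<kappa> i * (\<tau> - u * d)))"
    if \<tau>: "\<tau> \<in> {0..d}" for \<tau>
  proof -
    define \<theta> where "\<theta> = \<tau> - u * d"
    have \<theta>: "\<bar>\<theta>\<bar> \<le> d" using sliding_parameter_bounds[OF ab x \<tau>] by (simp add: \<theta>_def u_def)
    have mem: "x + k * \<theta> \<in> {a..b}" if "0 \<le> k" "k \<le> real r" for k
    proof -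
      have "k * d \<le> real r * d" using that d by (intro mult_right_mono) auto
      also have "\<dots> \<le> b - a" using d r1 by (simp add: field_simps)
      finally show ?thesis unfolding \<theta>_def u_def using that by (intro sliding_window_mem[OF ab _ _ x \<tau>])
    qed
    have "f0 x = f x" unfolding f0_def by (rule restrict_zero_in[OF x])
    then have "\<bar>steklov_kernel r f0 x \<theta> - f x\<bar> = \<bar>fwd_diff r \<theta> f0 x\<bar>"
      by (simp add: steklov_kernel_eq abs_mult)
    also have "fwd_diff r \<theta> f0 x = fwd_diff r \<theta> f x"
      by (rule fwd_diff_cong) (use mem in \<open>simp add: f0_def del: atLeastAtMost_iff\<close>)
    also have "\<bar>fwd_diff r \<theta> f x\<bar> \<le> 2 ^ (r - s) * (\<Sum>i=0..r - s. \<bar>fwd_diff s \<theta> f (x + real i * \<theta>)\<bar>)"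
      using abs_fwd_diff_add_le[of s "r - s" \<theta> f x] r by simp
    also have "\<dots> \<le> 2 ^ r * (\<Sum>i=0..r - s. \<omega> (x + \<kappa> i * \<theta>))"
    proof (intro mult_mono sum_mono power_increasing)
      fix i assume i: "i \<in> {0..r - s}"
      define t where "t = x + real i * \<theta>"
      have t: "t \<in> {a..b}" unfolding t_def using i r by (intro mem) auto
      have t': "t + real s * \<theta> \<in> {a..b}"
      proof -
        have "x + real (i + s) * \<theta> \<in> {a..b}" using i r by (intro mem) auto
        then show ?thesis by (simp add: t_def algebra_simps)
      qed
      have y: "x + \<kappa> i * \<theta> \<in> {a..b}" "x + \<kappa> i * \<theta> = t + real s * \<theta> / 2"
      proof -
        show "x + \<kappa> i * \<theta> \<in> {a..b}" using \<kappa>[OF i] by (intro mem) linarith+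
        show "x + \<kappa> i * \<theta> = t + real s * \<theta> / 2" by (simp add: t_def \<kappa>_def algebra_simps)
      qed
      have "\<bar>real s * \<theta>\<bar> \<le> real s * \<delta>" using \<theta> d by (simp add: abs_mult mult_left_mono)
      then have "\<bar>fwd_diff s \<theta> f t\<bar> \<le> local_modulus a b s f (x + \<kappa> i * \<theta>) \<delta>"
        unfolding y(2) by (intro abs_fwd_diff_le_local_modulus t t') auto
      also have "\<dots> \<le> \<omega> (x + \<kappa> i * \<theta>)" unfolding \<omega>_def restrict_zero_in[OF y(1)] by simp
      finally show "\<bar>fwd_diff s \<theta> f (x + real i * \<theta>)\<bar> \<le> \<omega> (x + \<kappa> i * \<theta>)" by (simp add: t_def)
    qed (auto intro!: sum_nonneg)
    finally show ?thesis by (simp add: \<theta>_def)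
  qed
  define \<Omega> where "\<Omega> = integral {x - real r * d..x + real r * d} \<omega>"
  have \<Omega>0: "0 \<le> \<Omega>" unfolding \<Omega>_def using locally_integrableD(2)[OF l\<omega>] by (intro integral_nonneg) (auto simp: \<omega>_def)
  have "\<bar>steklov a b d r f x - f x\<bar> \<le> real r / d * (2 ^ r * (real (card {0..r - s}) * (2 * \<Omega>)) + d * 0)"
    unfolding \<Omega>_def
    by (rule abs_steklov_minus_le_window[OF ab r1 d(1,3) x lf _ l\<omega>, where \<kappa> = \<kappa>])
      (use bound \<kappa> in \<open>auto simp: f0_def u_def \<omega>_def\<close>)
  also have "\<dots> \<le> real r / d * (2 ^ r * (real (r + 1) * (2 * \<Omega>)))"
    using d \<Omega>0 by (intro mult_left_mono) (auto intro!: mult_left_mono mult_right_mono)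
  also have "\<dots> = real r * (2 ^ r * (real (r + 1) * 2)) * (1 / d) * \<Omega>"
    by (simp only: divide_inverse mult_1_left mult_ac)
  finally show ?thesis by (simp only: \<Omega>_def \<omega>_def)
qed

end


section \<open>The K-functional and the semi-discrete modulus\<close>

lemma K_functional_le:
  assumes "g \<in> Sobolev p a b s"
  shows "K_functional p a b s n x f \<le> lp_seminorm p a b n x (\<lambda>y. f y - g y) + Lp_norm p {a..b} (\<lambda>y. f y - g y)
    + real n powi (- int s) * Lp_norm p {a..b} (nth_deriv a b s g)"
  unfolding K_functional_def
  by (rule cINF_lower[OF _ assms]) (auto intro!: bdd_belowI2[of _ 0] add_nonneg_nonneg)

theorem theorem4p11:
  fixes a b p \<gamma> :: real and r s :: nat and X :: "nat \<Rightarrow> nat \<Rightarrow> real"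
  assumes "a < b" and "1 \<le> s" and "s \<le> r" and "1 \<le> p" and "0 < \<gamma>" and "\<gamma> \<le> 1"
    and "\<And>n. 1 \<le> n \<Longrightarrow> X n ` {0..n} \<subseteq> {a..b}"
    and "\<And>n. 1 \<le> n \<Longrightarrow> strict_mono_on {0..n} (X n)"
    and "\<And>n. 1 \<le> n \<Longrightarrow> min_gap a b n (X n) \<ge> \<gamma> / real n"
  shows "(\<exists>C1>0. \<exists>C2>0. \<forall>f\<in>Lp_space p {a..b}. \<forall>n\<ge>1. \<gamma> / real n \<le> (b - a) / real r \<longrightarrow>
            K_functional p a b s n (X n) f \<le> C1 * semi_discrete_modulus p a b r s \<gamma> n (X n) f \<and>
            semi_discrete_modulus p a b r s \<gamma> n (X n) f \<le> C2 * K_functional p a b s n (X n) f) \<and>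
         (\<exists>C>0. \<forall>f\<in>Lp_space p {a..b}. bounded (f ` {a..b}) \<longrightarrow>
            (\<forall>n\<ge>1. \<gamma> / real n \<le> (b - a) / real r \<and> 1 / real n \<le> (b - a) / real s \<longrightarrow>
              semi_discrete_modulus p a b r s \<gamma> n (X n) f
                \<le> C * averaged_modulus p a b s f (1 / real n)))"
proof -
  note ab = assms(1) and s = assms(2,3) and p = assms(4) and \<gamma> = assms(5,6)
  have mem: "X n k \<in> {a..b}" if "1 \<le> n" "k \<le> n" for n k
    using assms(7)[OF that(1)] by (rule subsetD) (use that(2) in simp)
  have spaced: "X n k + \<gamma> / real n \<le> X n (Suc k)" if "1 \<le> n" "k < n" for n k
    by (rule min_gap_imp_spaced[OF assms(9)[OF that(1)] that(2)])
  define cD where "cD = 2 * real r * (1 + 2 * (b - a) / \<gamma>) * (real r * (2 ^ r * (real (r + 1) * 2))) * 4"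
  define cE where "cE = (4 * (2 ^ s * real (s + 1) * real (s + 1)) :: real)"
  have cD: "0 \<le> cD" and cE: "0 \<le> cE" using ab \<gamma> by (auto simp: cD_def cE_def)
  define E where "E n f g = Lp_norm p {a..b} (\<lambda>y. f y - g y) + real n powi (- int s) * Lp_norm p {a..b} (nth_deriv a b s g)"
    for n f g
  have E0: "0 \<le> E n f g" for n f g by (auto simp: E_def)
  have D: "lp_seminorm p a b n (X n) (\<lambda>y. steklov a b (\<gamma> / real n) r f y - g y) \<le> cD * E n f g"
    if "1 \<le> n" "\<gamma> / real n \<le> (b - a) / real r" "f \<in> Lp_space p {a..b}" "g \<in> Sobolev p a b s" for n f g
    unfolding cD_def E_def using that
    by (intro lp_seminorm_steklov_minus_Sobolev_le ab s p \<gamma> mem spaced)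
  obtain cJ where cJ: "0 < cJ" "\<And>f n. f \<in> Lp_space p {a..b} \<Longrightarrow> 1 \<le> n \<Longrightarrow>
      \<exists>g\<in>Sobolev p a b s. E n f g \<le> cJ * modulus p a b s f (1 / real n)"
    using modulus_Sobolev_approximation[OF ab s(1) p] unfolding E_def by blast
  define C1 where "C1 = 4 + (4 * cD + 1) * cJ"
  define C2 where "C2 = 4 * (cD + 1) + cE"
  \<comment> \<open>Johnen's approximant serves in the infimum; at the points it is compared with the Steklov average.\<close>
  have "K_functional p a b s n (X n) f \<le> C1 * semi_discrete_modulus p a b r s \<gamma> n (X n) f"
    if f: "f \<in> Lp_space p {a..b}" and n: "1 \<le> n" "\<gamma> / real n \<le> (b - a) / real r" for f n
  proof -
    define A where "A = lp_seminorm p a b n (X n) (\<lambda>y. steklov a b (\<gamma> / real n) r f y - f y)"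
    define \<omega> where "\<omega> = modulus p a b s f (1 / real n)"
    obtain g where g: "g \<in> Sobolev p a b s" "E n f g \<le> cJ * \<omega>" using cJ(2)[OF f n(1)] by (auto simp: \<omega>_def)
    have "0 \<le> cJ * \<omega>" using g(2) E0 order_trans by blast
    then have \<omega>0: "0 \<le> \<omega>" using cJ(1) by (simp add: zero_le_mult_iff)
    have A0: "0 \<le> A" by (simp add: A_def)
    have "lp_seminorm p a b n (X n) (\<lambda>y. f y - g y)
        \<le> 4 * (A + lp_seminorm p a b n (X n) (\<lambda>y. steklov a b (\<gamma> / real n) r f y - g y))"
      unfolding A_def using p ab by (intro lp_seminorm_add_le) auto
    moreover have "lp_seminorm p a b n (X n) (\<lambda>y. steklov a b (\<gamma> / real n) r f y - g y) \<le> cD * E n f g"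
      by (rule D[OF n f g(1)])
    moreover have "K_functional p a b s n (X n) f \<le> lp_seminorm p a b n (X n) (\<lambda>y. f y - g y) + E n f g"
      using K_functional_le[OF g(1), of n "X n" f] by (simp add: E_def add.assoc)
    ultimately have "K_functional p a b s n (X n) f \<le> 4 * A + (4 * cD + 1) * E n f g"
      by (simp add: distrib_right)
    also have "\<dots> \<le> 4 * A + (4 * cD + 1) * (cJ * \<omega>)"
      using g(2) cD by (intro add_left_mono mult_left_mono) auto
    also have "\<dots> \<le> C1 * A + C1 * \<omega>"
    proof (rule add_mono)
      have nn: "0 \<le> (4 * cD + 1) * cJ" using cD cJ by auto
      show "4 * A \<le> C1 * A" using nn A0 unfolding C1_def by (intro mult_right_mono) auto
      have "(4 * cD + 1) * cJ * \<omega> \<le> C1 * \<omega>" using \<omega>0 unfolding C1_def by (intro mult_right_mono) auto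
      then show "(4 * cD + 1) * (cJ * \<omega>) \<le> C1 * \<omega>" by (simp only: mult.assoc)
    qed
    finally show ?thesis
      by (simp add: semi_discrete_modulus_def A_def \<omega>_def distrib_left)
  qed
  \<comment> \<open>Every \<open>g\<close> in the infimum satisfies the bound. The infimum is over a non-empty set by Johnen's inequality.\<close>
  moreover have "semi_discrete_modulus p a b r s \<gamma> n (X n) f \<le> C2 * K_functional p a b s n (X n) f"
    if f: "f \<in> Lp_space p {a..b}" and n: "1 \<le> n" "\<gamma> / real n \<le> (b - a) / real r" for f n
  proof -
    have C2: "0 < C2" using cD cE by (simp add: C2_def)
    have "semi_discrete_modulus p a b r s \<gamma> n (X n) f / C2 \<le> K_functional p a b s n (X n) f"
      unfolding K_functional_def
    proof (rule cINF_greatest)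
      show "Sobolev p a b s \<noteq> {}" using cJ(2)[OF f n(1)] by blast
      fix g assume g: "g \<in> Sobolev p a b s"
      define B where "B = lp_seminorm p a b n (X n) (\<lambda>y. f y - g y)"
      have B0: "0 \<le> B" by (simp add: B_def)
      have "lp_seminorm p a b n (X n) (\<lambda>y. steklov a b (\<gamma> / real n) r f y - f y)
          \<le> 4 * (lp_seminorm p a b n (X n) (\<lambda>y. steklov a b (\<gamma> / real n) r f y - g y) + B)"
        unfolding B_def using p ab by (intro lp_seminorm_add_le) auto
      also have "\<dots> \<le> 4 * (cD * E n f g + B)" by (intro mult_left_mono add_right_mono D n f g) auto
      finally have "semi_discrete_modulus p a b r s \<gamma> n (X n) f \<le> 4 * (cD * E n f g + B) + cE * E n f g"
        unfolding semi_discrete_modulus_def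
        using modulus_le_Sobolev[OF p s(1) n(1) f g] by (simp add: cE_def E_def)
      also have "\<dots> = 4 * B + (4 * cD + cE) * E n f g" by (simp add: algebra_simps)
      also have "\<dots> \<le> C2 * B + C2 * E n f g"
        using cD cE B0 E0 by (intro add_mono mult_right_mono) (auto simp: C2_def)
      finally have "semi_discrete_modulus p a b r s \<gamma> n (X n) f / C2 \<le> B + E n f g"
        using C2 by (simp add: pos_divide_le_eq algebra_simps)
      then show "semi_discrete_modulus p a b r s \<gamma> n (X n) f / C2
        \<le> lp_seminorm p a b n (X n) (\<lambda>y. f y - g y) + Lp_norm p {a..b} (\<lambda>y. f y - g y)
          + real n powi (- int s) * Lp_norm p {a..b} (nth_deriv a b s g)"
        by (simp add: B_def E_def)
    qed
    then show ?thesis using C2 by (simp add: pos_divide_le_eq mult.commute)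
  qed
  moreover have "0 < C1" "0 < C2" using cD cE cJ by (auto simp: C1_def C2_def intro!: add_pos_nonneg)
  moreover
  define cT where "cT = 2 * real r * (1 + 2 * (b - a) / \<gamma>) * (real r * (2 ^ r * (real (r + 1) * 2)))"
  have "semi_discrete_modulus p a b r s \<gamma> n (X n) f \<le> (cT + 1) * averaged_modulus p a b s f (1 / real n)"
    if f: "f \<in> Lp_space p {a..b}" and bdd: "bounded (f ` {a..b})" and n: "1 \<le> n" "\<gamma> / real n \<le> (b - a) / real r" for f n
  proof -
    have \<delta>: "0 < 1 / real n" using n by simp
    have fi: "f absolutely_integrable_on {a..b}" by (rule Lp_space_absolutely_integrable[OF f p])
    have "lp_seminorm p a b n (X n) (\<lambda>y. steklov a b (\<gamma> / real n) r f y - f y)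
        \<le> cT * Lp_norm p {a..b} (\<lambda>x. local_modulus a b s f x (1 / real n))"
      unfolding cT_def
    proof (rule lp_seminorm_window_le[where x = "X n" and n = n and \<gamma> = \<gamma>, OF ab p n(1) \<gamma>(1)])
      show "(\<lambda>x. local_modulus a b s f x (1 / real n)) \<in> Lp_space p {a..b}"
        by (rule local_modulus_Lp_space[OF s(1) \<delta> bdd fi p])
      fix k assume k: "k \<le> n"
      show "\<bar>steklov a b (\<gamma> / real n) r f (X n k) - f (X n k)\<bar> \<le> real r * (2 ^ r * (real (r + 1) * 2)) * (real n / \<gamma>) *
         integral {X n k - real r * (\<gamma> / real n)..X n k + real r * (\<gamma> / real n)}
           (\<lambda>t. \<bar>restrict_zero a b (\<lambda>x. local_modulus a b s f x (1 / real n)) t\<bar>)"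
        using abs_steklov_minus_le_local_modulus[OF s(1) \<delta> bdd ab s(2) fi p, of "\<gamma> / real n" "X n k"]
          n \<gamma> mem[OF n(1) k] by (simp add: divide_right_mono)
    qed (use s spaced n in auto)
    then show ?thesis
      using modulus_le_averaged_modulus[OF s(1) \<delta> bdd fi p]
      by (simp add: semi_discrete_modulus_def averaged_modulus_def distrib_right)
  qed
  moreover have "0 < cT + 1" using ab \<gamma> by (simp add: cT_def add_nonneg_pos)
  ultimately show ?thesis by blast
qed

end
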